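(* Let $\gamma>0$ and let $f\in W^{1,\infty}(\mathbb{R}^2)^2\cap H^1(\mathbb{R}^2)^2$ have zero mean, $g=\nabla^\perp\cdot f$. Let $(u^{(\nu)},\omega^{(\nu)})$, with $\nu\to0$ along a sequence of positive numbers, be a sequence of solutions of the stationary damped and driven Navier-Stokes equations $$ -\nu\Delta u^{(\nu)}+\gamma u^{(\nu)}+\nabla p^{(\nu)}+u^{(\nu)}\cdot\nabla u^{(\nu)}=f,\quad\nabla\cdot u^{(\nu)}=0,\quad \omega^{(\nu)}=\nabla^\perp\cdot u^{(\nu)} . $$ Then the enstrophy dissipation vanishes in the limit $\nu\to0$: $$ \lim_{\nu\to0}\nu\int_{\mathbb{R}^2}|\nabla\omega^{(\nu)}|^2\,dx=0 . $$
   Context: Notation: $\nabla^\perp\cdot u=\partial_1u_2-\partial_2u_1$. Solutions $(u^{(\nu)},\omega^{(\nu)})$ of the stationary viscous equations are understood to be smooth with decay at infinity (the velocity being $u^{(\nu)}=K\star\omega^{(\nu)}$, $K=\frac1{2\pi}\frac{x^\perp}{|x|^2}$, $x^\perp=(-x_2,x_1)$), sufficient for the vorticity equation $\gamma\omega^{(\nu)}+u^{(\nu)}\cdot\nabla\omega^{(\nu)}-\nu\Delta\omega^{(\nu)}=g$, the energy balance $\gamma\|u^{(\nu)}\|_{L^2}^2+\nu\|\nabla u^{(\nu)}\|_{L^2}^2=\int f\cdot u^{(\nu)}dx$ and the enstrophy balance $\gamma\|\omega^{(\nu)}\|_{L^2}^2+\nu\|\nabla\omega^{(\nu)}\|_{L^2}^2=\int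 g\,\omega^{(\nu)}dx$ to hold with all terms finite. $f,g,\gamma$ are kept fixed as $\nu\to0$. *)

theory Defs
  imports "HOL-Analysis.Analysis"
begin

definition pd :: "2 \<Rightarrow> (real^2 \<Rightarrow> real) \<Rightarrow> real^2 \<Rightarrow> real" where
  "pd j h x = frechet_derivative h (at x) (axis j 1)"

fun Ck :: "nat \<Rightarrow> (real^2 \<Rightarrow> real) \<Rightarrow> bool" where
  "Ck 0 h \<longleftrightarrow> continuous_on UNIV h"
| "Ck (Suc k) h \<longleftrightarrow> (\<forall>x. h differentiable (at x)) \<and> (\<forall>j. Ck k (pd j h))"

definition laplacian :: "(real^2 \<Rightarrow> real) \<Rightarrow> real^2 \<Rightarrow> real" where
  "laplacian h x = (\<Sum>j\<in>UNIV. pd j (pd j h) x)"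

definition test_function :: "(real^2 \<Rightarrow> real) \<Rightarrow> bool" where
  "test_function \<phi> \<longleftrightarrow> (\<forall>k. Ck k \<phi>) \<and> compact (closure {x. \<phi> x \<noteq> 0})"

definition locally_integrable :: "(real^2 \<Rightarrow> real) \<Rightarrow> bool" where
  "locally_integrable h \<longleftrightarrow> (\<forall>C. compact C \<longrightarrow> set_integrable lebesgue C h)"

definition has_weak_partial :: "2 \<Rightarrow> (real^2 \<Rightarrow> real) \<Rightarrow> (real^2 \<Rightarrow> real) \<Rightarrow> bool" where
  "has_weak_partial j h d \<longleftrightarrow> locally_integrable h \<and> locally_integrable d \<and>
     (\<forall>\<phi>. test_function \<phi> \<longrightarrow>
        (LINT x|lebesgue. h x * pd j \<phi> x) = - (LINT x|lebesgue. d x * \<phi> x))"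

definition has_weak_laplacian :: "(real^2 \<Rightarrow> real) \<Rightarrow> (real^2 \<Rightarrow> real) \<Rightarrow> bool" where
  "has_weak_laplacian h l \<longleftrightarrow> locally_integrable h \<and> locally_integrable l \<and>
     (\<forall>\<phi>. test_function \<phi> \<longrightarrow>
        (LINT x|lebesgue. h x * laplacian \<phi> x) = (LINT x|lebesgue. l x * \<phi> x))"

definition in_L2 :: "(real^2 \<Rightarrow> real) \<Rightarrow> bool" where
  "in_L2 h \<longleftrightarrow> h \<in> borel_measurable lebesgue \<and> integrable lebesgue (\<lambda>x. (h x)\<^sup>2)"

definition in_Linf :: "(real^2 \<Rightarrow> real) \<Rightarrow> bool" where
  "in_Linf h \<longleftrightarrow> h \<in> borel_measurable lebesgue \<and> (\<exists>C. AE x in lebesgue. \<bar>h x\<bar> \<le> C)"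

definition in_H1 :: "(real^2 \<Rightarrow> real) \<Rightarrow> bool" where
  "in_H1 h \<longleftrightarrow> in_L2 h \<and> (\<forall>j. \<exists>d. has_weak_partial j h d \<and> in_L2 d)"

definition in_W1inf :: "(real^2 \<Rightarrow> real) \<Rightarrow> bool" where
  "in_W1inf h \<longleftrightarrow> in_Linf h \<and> (\<forall>j. \<exists>d. has_weak_partial j h d \<and> in_Linf d)"

definition has_weak_curl :: "(real^2 \<Rightarrow> real^2) \<Rightarrow> (real^2 \<Rightarrow> real) \<Rightarrow> bool" where
  "has_weak_curl v g \<longleftrightarrow>
     (\<exists>a b. has_weak_partial 1 (\<lambda>x. v x $ 2) a \<and> has_weak_partial 2 (\<lambda>x. v x $ 1) b \<and>
        (AE x in lebesgue. g x = a x - b x))"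

definition curl :: "(real^2 \<Rightarrow> real^2) \<Rightarrow> real^2 \<Rightarrow> real" where
  "curl v x = pd 1 (\<lambda>y. v y $ 2) x - pd 2 (\<lambda>y. v y $ 1) x"

definition divergence :: "(real^2 \<Rightarrow> real^2) \<Rightarrow> real^2 \<Rightarrow> real" where
  "divergence v x = (\<Sum>i\<in>UNIV. pd i (\<lambda>y. v y $ i) x)"

definition advect :: "(real^2 \<Rightarrow> real^2) \<Rightarrow> (real^2 \<Rightarrow> real) \<Rightarrow> real^2 \<Rightarrow> real" where
  "advect v h x = (\<Sum>j\<in>UNIV. v x $ j * pd j h x)"

definition grad_sq :: "(real^2 \<Rightarrow> real) \<Rightarrow> real^2 \<Rightarrow> real" where
  "grad_sq h x = (\<Sum>j\<in>UNIV. (pd j h x)\<^sup>2)"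

definition vgrad_sq :: "(real^2 \<Rightarrow> real^2) \<Rightarrow> real^2 \<Rightarrow> real" where
  "vgrad_sq v x = (\<Sum>i\<in>UNIV. grad_sq (\<lambda>y. v y $ i) x)"

definition biot_savart_kernel :: "real^2 \<Rightarrow> real^2" where
  "biot_savart_kernel x = (1 / (2 * pi * (norm x)\<^sup>2)) *\<^sub>R vector [- (x $ 2), x $ 1]"

definition momentum_equation ::
    "real \<Rightarrow> real \<Rightarrow> (real^2 \<Rightarrow> real^2) \<Rightarrow> (real^2 \<Rightarrow> real^2) \<Rightarrow> (real^2 \<Rightarrow> real) \<Rightarrow> bool" where
  "momentum_equation \<nu> \<gamma> f u p \<longleftrightarrow>
     (\<forall>i. AE x in lebesgue.
        - \<nu> * laplacian (\<lambda>y. u y $ i) x + \<gamma> * u x $ i + pd i p x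
          + advect u (\<lambda>y. u y $ i) x = f x $ i)"

text \<open>The Laplacian is taken in the weak sense because the curl \<open>g\<close> of the forcing need not
  be continuous, so that \<open>\<omega>\<close> need not be twice differentiable. For a \<open>\<omega>\<close> that is twice
  continuously differentiable this is the classical equation.\<close>
definition vorticity_equation ::
    "real \<Rightarrow> real \<Rightarrow> (real^2 \<Rightarrow> real) \<Rightarrow> (real^2 \<Rightarrow> real^2) \<Rightarrow> (real^2 \<Rightarrow> real) \<Rightarrow> bool" where
  "vorticity_equation \<nu> \<gamma> g u \<omega> \<longleftrightarrow>
     (\<exists>l. has_weak_laplacian \<omega> l \<and>
        (AE x in lebesgue. \<gamma> * \<omega> x + advect u \<omega> x - \<nu> * l x = g x))"

definition energy_balance ::
    "real \<Rightarrow> real \<Rightarrow> (real^2 \<Rightarrow> real^2) \<Rightarrow> (real^2 \<Rightarrow> real^2) \<Rightarrow> bool" where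
  "energy_balance \<nu> \<gamma> f u \<longleftrightarrow>
     integrable lebesgue (\<lambda>x. (norm (u x))\<^sup>2) \<and>
     integrable lebesgue (vgrad_sq u) \<and>
     integrable lebesgue (\<lambda>x. f x \<bullet> u x) \<and>
     \<gamma> * (LINT x|lebesgue. (norm (u x))\<^sup>2) + \<nu> * (LINT x|lebesgue. vgrad_sq u x)
       = (LINT x|lebesgue. f x \<bullet> u x)"

definition enstrophy_balance ::
    "real \<Rightarrow> real \<Rightarrow> (real^2 \<Rightarrow> real) \<Rightarrow> (real^2 \<Rightarrow> real) \<Rightarrow> bool" where
  "enstrophy_balance \<nu> \<gamma> g \<omega> \<longleftrightarrow>
     integrable lebesgue (\<lambda>x. (\<omega> x)\<^sup>2) \<and>
     integrable lebesgue (grad_sq \<omega>) \<and>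
     integrable lebesgue (\<lambda>x. g x * \<omega> x) \<and>
     \<gamma> * (LINT x|lebesgue. (\<omega> x)\<^sup>2) + \<nu> * (LINT x|lebesgue. grad_sq \<omega> x)
       = (LINT x|lebesgue. g x * \<omega> x)"

text \<open>Smoothness is required only to the order at which the equations make sense for a
  Lipschitz forcing (velocity twice, pressure and vorticity once continuously differentiable);
  infinite differentiability of \<open>u\<close> and \<open>p\<close> would force \<open>f\<close> itself to be smooth. Decay at infinity
  enters through the absolute convergence of the Biot-Savart integral at every point and the
  finiteness of all terms in the two balances.\<close>
definition stationary_damped_NS ::
    "real \<Rightarrow> real \<Rightarrow> (real^2 \<Rightarrow> real^2) \<Rightarrow> (real^2 \<Rightarrow> real) \<Rightarrow>
     (real^2 \<Rightarrow> real^2) \<Rightarrow> (real^2 \<Rightarrow> real) \<Rightarrow> bool" where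
  "stationary_damped_NS \<nu> \<gamma> f g u \<omega> \<longleftrightarrow>
     (\<forall>i. Ck 2 (\<lambda>x. u x $ i)) \<and>
     (\<exists>p. Ck 1 p \<and> momentum_equation \<nu> \<gamma> f u p) \<and>
     (\<forall>x. divergence u x = 0) \<and>
     (\<forall>x. \<omega> x = curl u x) \<and>
     (\<forall>x. has_bochner_integral lebesgue (\<lambda>y. \<omega> y *\<^sub>R biot_savart_kernel (x - y)) (u x)) \<and>
     vorticity_equation \<nu> \<gamma> g u \<omega> \<and>
     energy_balance \<nu> \<gamma> f u \<and>
     enstrophy_balance \<nu> \<gamma> g \<omega>"

end

theory Submission
  imports Defs "HOL-Library.Diagonal_Subsequence"
begin

text \<open>
  The enstrophy balance reads \<open>\<nu> \<integral>|\<nabla>\<omega>|\<^sup>2 = \<integral>g \<omega> - \<gamma> \<integral>\<omega>\<^sup>2\<close>. Along a subsequence on which the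
  vorticities converge weakly in \<open>L\<^sup>2\<close> to some \<open>W\<close>, the first term on the right converges to
  \<open>\<integral>g W\<close>, while weak lower semicontinuity of the norm bounds the upper limit of the second
  by \<open>- \<gamma> \<integral>W\<^sup>2\<close>. Hence no dissipation survives in the limit as soon as the limit itself
  satisfies the inviscid balance \<open>\<gamma> \<integral>W\<^sup>2 = \<integral>g W\<close>. Since every subsequence contains a further
  one of this kind, the whole sequence of dissipations then tends to zero.

  The two balances bound the vorticities and the velocities in \<open>L\<^sup>2\<close>, uniformly in the viscosity,
  and for divergence-free fields the full gradient is controlled by the curl
  (\<open>div_free_gradient_le_curl\<close>). Weak compactness (\<open>weak_compactness_L2\<close>) yields limits \<open>W\<close>
  and \<open>U\<close>; the gradient bound makes the convergence of the velocities strong on bounded sets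
  (\<open>Rellich_local\<close>), which is what the product \<open>u \<omega>\<close> needs. So \<open>W\<close> is a distributional
  solution of \<open>\<gamma> W + div (U W) = g\<close>, here used only after testing with translates of a
  mollifying kernel.

  Multiplying this equation by \<open>W\<close> is not legitimate, since \<open>W\<close> is merely square integrable.
  Following DiPerna and Lions, one mollifies: the mollified \<open>W\<close> solves the same transport
  equation up to the commutator of mollification with the transport by \<open>U\<close>, and this
  commutator tends to zero in \<open>L\<^sup>1\<close> (\<open>commutator_tendsto_0\<close>), because it is bounded by
  \<open>\<parallel>W\<parallel> \<parallel>\<nabla>U\<parallel>\<close> uniformly in the scale and tends to zero when \<open>W\<close> is smooth. As it vanishes
  only in \<open>L\<^sup>1\<close>, the multiplier has to be bounded: instead of \<open>W\<close> one takes \<open>W / (1 + e W\<^sup>2)\<close>,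
  lets the scale tend to zero, and then \<open>e\<close> (\<open>renormalized_identity\<close>, \<open>limit_enstrophy\<close>).

  Two choices keep the analysis elementary. Differentiability of the limits is never
  expressed by weak derivatives: for the velocity it is the translation estimate
  \<open>trans_bound\<close>, for \<open>W\<close> it is that \<open>W\<close> is a strong limit of linear combinations of the
  smooth vorticities (\<open>C1_approximable\<close>), and both survive weak limits. Moreover all
  functions are Borel, so that \<open>h (x - z)\<close> is jointly measurable in \<open>x\<close> and \<open>z\<close> and the
  theorems of Tonelli and Fubini apply.
\<close>

section \<open>The space of square integrable functions\<close>

definition L2 :: "('a::euclidean_space \<Rightarrow> real) \<Rightarrow> bool" where
  "L2 h \<longleftrightarrow> h \<in> borel_measurable borel \<and> integrable lborel (\<lambda>x. (h x)\<^sup>2)"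

definition ip2 :: "('a::euclidean_space \<Rightarrow> real) \<Rightarrow> ('a \<Rightarrow> real) \<Rightarrow> real" where
  "ip2 f g = (LINT x|lborel. f x * g x)"

definition norm2 :: "('a::euclidean_space \<Rightarrow> real) \<Rightarrow> real" where
  "norm2 f = sqrt (ip2 f f)"

lemma L2_measurable[measurable_dest]: "L2 h \<Longrightarrow> h \<in> borel_measurable borel"
  by (simp add: L2_def)

lemma L2_sq_integrable: "L2 h \<Longrightarrow> integrable lborel (\<lambda>x. (h x)\<^sup>2)"
  by (simp add: L2_def)

lemma L2_mult_integrable:
  assumes "L2 f" "L2 g" shows "integrable lborel (\<lambda>x. f x * g x)"
proof (rule Bochner_Integration.integrable_bound)
  show "integrable lborel (\<lambda>x. (f x)\<^sup>2 + (g x)\<^sup>2)"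
    using assms by (auto simp: L2_def)
  have [measurable]: "f \<in> borel_measurable borel" "g \<in> borel_measurable borel"
    using assms by (auto simp: L2_def)
  show "(\<lambda>x. f x * g x) \<in> borel_measurable lborel" by measurable
  show "AE x in lborel. norm (f x * g x) \<le> norm ((f x)\<^sup>2 + (g x)\<^sup>2)"
  proof (rule AE_I2)
    fix x
    have "2 * (\<bar>f x\<bar> * \<bar>g x\<bar>) \<le> \<bar>f x\<bar>\<^sup>2 + \<bar>g x\<bar>\<^sup>2"
      using sum_squares_bound[of "\<bar>f x\<bar>" "\<bar>g x\<bar>"] by (simp add: mult.assoc)
    moreover have "0 \<le> \<bar>f x\<bar> * \<bar>g x\<bar>" by simp
    ultimately have "\<bar>f x\<bar> * \<bar>g x\<bar> \<le> (f x)\<^sup>2 + (g x)\<^sup>2" unfolding power2_abs by linarith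
    then show "norm (f x * g x) \<le> norm ((f x)\<^sup>2 + (g x)\<^sup>2)"
      by (simp add: abs_mult)
  qed
qed

lemma L2_bound:
  assumes "L2 g" "h \<in> borel_measurable borel" "\<And>x. \<bar>h x\<bar> \<le> C * \<bar>g x\<bar>"
  shows "L2 h"
  unfolding L2_def
proof
  show "h \<in> borel_measurable borel" by fact
  have [measurable]: "h \<in> borel_measurable borel" by fact
  show "integrable lborel (\<lambda>x. (h x)\<^sup>2)"
  proof (rule Bochner_Integration.integrable_bound)
    show "integrable lborel (\<lambda>x. C\<^sup>2 * (g x)\<^sup>2)"
      using assms(1) by (auto simp: L2_def)
    show "(\<lambda>x. (h x)\<^sup>2) \<in> borel_measurable lborel" by measurable
    show "AE x in lborel. norm ((h x)\<^sup>2) \<le> norm (C\<^sup>2 * (g x)\<^sup>2)"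
    proof (rule AE_I2)
      fix x
      have "\<bar>h x\<bar>\<^sup>2 \<le> (C * \<bar>g x\<bar>)\<^sup>2" by (rule power_mono) (use assms(3) in auto)
      then show "norm ((h x)\<^sup>2) \<le> norm (C\<^sup>2 * (g x)\<^sup>2)"
        by (simp add: power_mult_distrib)
    qed
  qed
qed

lemma L2_zero[simp]: "L2 (\<lambda>x. 0)"
  by (simp add: L2_def)

lemma L2_scale: "L2 f \<Longrightarrow> L2 (\<lambda>x. c * f x)"
  by (auto simp: L2_def power_mult_distrib)

lemma L2_add:
  assumes "L2 f" "L2 g" shows "L2 (\<lambda>x. f x + g x)"
proof -
  have "integrable lborel (\<lambda>x. (f x)\<^sup>2 + (g x)\<^sup>2 + 2 * (f x * g x))"
    using assms L2_mult_integrable[OF assms] by (auto simp: L2_def)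
  moreover have "(\<lambda>x. (f x)\<^sup>2 + (g x)\<^sup>2 + 2 * (f x * g x)) = (\<lambda>x. (f x + g x)\<^sup>2)"
    by (auto simp: power2_sum)
  ultimately show ?thesis using assms by (auto simp: L2_def)
qed

lemma L2_diff:
  assumes "L2 f" "L2 g" shows "L2 (\<lambda>x. f x - g x)"
  using L2_add[OF assms(1) L2_scale[OF assms(2), of "-1"]] by simp

lemma L2_sum: "(\<And>i. i \<in> I \<Longrightarrow> L2 (f i)) \<Longrightarrow> L2 (\<lambda>x. \<Sum>i\<in>I. f i x)"
  by (induction I rule: infinite_finite_induct) (auto intro: L2_add)

lemma L2_bounded_mult:
  assumes "L2 f" "h \<in> borel_measurable borel" "\<And>x. \<bar>h x\<bar> \<le> C"
  shows "L2 (\<lambda>x. f x * h x)"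
proof (rule L2_bound[OF assms(1), where C=C])
  show "(\<lambda>x. f x * h x) \<in> borel_measurable borel"
    using assms by (auto simp: L2_def)
  fix x have "\<bar>h x\<bar> * \<bar>f x\<bar> \<le> C * \<bar>f x\<bar>" using assms(3) by (rule mult_right_mono) auto
  then show "\<bar>f x * h x\<bar> \<le> C * \<bar>f x\<bar>" by (simp add: abs_mult mult.commute)
qed

lemma ip2_commute: "ip2 f g = ip2 g f"
  by (simp add: ip2_def mult.commute)

lemma ip2_add: "L2 f \<Longrightarrow> L2 g \<Longrightarrow> L2 h \<Longrightarrow> ip2 (\<lambda>x. f x + g x) h = ip2 f h + ip2 g h"
  using L2_mult_integrable[of f h] L2_mult_integrable[of g h] by (simp add: ip2_def algebra_simps)

lemma ip2_diff: "L2 f \<Longrightarrow> L2 g \<Longrightarrow> L2 h \<Longrightarrow> ip2 (\<lambda>x. f x - g x) h = ip2 f h - ip2 g h"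
  using L2_mult_integrable[of f h] L2_mult_integrable[of g h] by (simp add: ip2_def algebra_simps)

lemma ip2_scale: "ip2 (\<lambda>x. c * f x) h = c * ip2 f h"
  by (simp add: ip2_def mult.assoc)

lemma ip2_add_right: "L2 f \<Longrightarrow> L2 g \<Longrightarrow> L2 h \<Longrightarrow> ip2 h (\<lambda>x. f x + g x) = ip2 h f + ip2 h g"
  using ip2_add[of f g h] by (simp add: ip2_commute)

lemma ip2_diff_right: "L2 f \<Longrightarrow> L2 g \<Longrightarrow> L2 h \<Longrightarrow> ip2 h (\<lambda>x. f x - g x) = ip2 h f - ip2 h g"
  using ip2_diff[of f g h] by (simp add: ip2_commute)

lemma ip2_scale_right: "ip2 h (\<lambda>x. c * f x) = c * ip2 h f"
  using ip2_scale[of c f h] by (simp add: ip2_commute)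

lemma ip2_self_nonneg: "0 \<le> ip2 f f"
  by (simp add: ip2_def)

lemma norm2_nonneg[simp]: "0 \<le> norm2 f"
  by (simp add: norm2_def ip2_self_nonneg)

lemma norm2_sq: "(norm2 f)\<^sup>2 = ip2 f f"
  by (simp add: norm2_def ip2_self_nonneg)

lemma norm2_sq_integral: "(norm2 f)\<^sup>2 = (LINT x|lborel. (f x)\<^sup>2)"
  unfolding norm2_sq by (simp add: ip2_def power2_eq_square)

text \<open>The case \<open>c = 0\<close> is included so that the Cauchy-Schwarz inequality and \<open>near_Riesz\<close> need
  no separate treatment of functions that vanish almost everywhere.\<close>
lemma discriminant_bound:
  fixes a b c :: real
  assumes "\<And>t. 0 \<le> a + 2 * t * b + t\<^sup>2 * c" "0 \<le> c"
  shows "b\<^sup>2 \<le> a * c"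
proof (cases "c = 0")
  case True
  have "b = 0"
  proof (rule ccontr)
    assume "b \<noteq> 0"
    have "0 \<le> a + 2 * (- (a + 1) / (2 * b)) * b + (- (a + 1) / (2 * b))\<^sup>2 * c" by (rule assms)
    then show False using \<open>b \<noteq> 0\<close> True by (simp add: field_simps)
  qed
  then show ?thesis using True by simp
next
  case False
  have "0 \<le> a + 2 * (- b / c) * b + (- b / c)\<^sup>2 * c" by (rule assms)
  also have "\<dots> = a - b\<^sup>2 / c" using False by (simp add: field_simps power2_eq_square)
  finally show ?thesis using False assms(2) by (simp add: field_simps)
qed

lemma Cauchy_Schwarz_L2:
  assumes "L2 f" "L2 g" shows "\<bar>ip2 f g\<bar> \<le> norm2 f * norm2 g"
proof -
  have "0 \<le> ip2 f f + 2 * t * ip2 f g + t\<^sup>2 * ip2 g g" for t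
  proof -
    have "0 \<le> ip2 (\<lambda>x. f x + t * g x) (\<lambda>x. f x + t * g x)" by (rule ip2_self_nonneg)
    also have "\<dots> = ip2 f f + 2 * t * ip2 f g + t\<^sup>2 * ip2 g g"
      using assms ip2_commute[of f g]
      by (simp add: ip2_add ip2_add_right ip2_scale ip2_scale_right L2_add L2_scale
          algebra_simps power2_eq_square)
    finally show ?thesis .
  qed
  then have "(ip2 f g)\<^sup>2 \<le> ip2 f f * ip2 g g"
    by (rule discriminant_bound) (rule ip2_self_nonneg)
  then have "\<bar>ip2 f g\<bar> \<le> sqrt (ip2 f f * ip2 g g)"
    using real_sqrt_le_mono by fastforce
  then show ?thesis by (simp add: norm2_def real_sqrt_mult)
qed

lemma norm2_triangle:
  assumes "L2 f" "L2 g" shows "norm2 (\<lambda>x. f x + g x) \<le> norm2 f + norm2 g"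
proof (rule power2_le_imp_le)
  have "(norm2 (\<lambda>x. f x + g x))\<^sup>2 = ip2 f f + 2 * ip2 f g + ip2 g g"
    using assms ip2_commute[of f g] by (simp add: norm2_sq ip2_add ip2_add_right L2_add)
  also have "\<dots> \<le> (norm2 f)\<^sup>2 + 2 * (norm2 f * norm2 g) + (norm2 g)\<^sup>2"
    using Cauchy_Schwarz_L2[OF assms] by (simp add: norm2_sq)
  finally show "(norm2 (\<lambda>x. f x + g x))\<^sup>2 \<le> (norm2 f + norm2 g)\<^sup>2"
    by (simp add: power2_sum mult.assoc)
qed simp

lemma norm2_scale: "norm2 (\<lambda>x. c * f x) = \<bar>c\<bar> * norm2 f"
proof -
  have "ip2 (\<lambda>x. c * f x) (\<lambda>x. c * f x) = c\<^sup>2 * ip2 f f"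
    by (simp add: ip2_scale ip2_scale_right power2_eq_square)
  then show ?thesis by (simp add: norm2_def real_sqrt_mult)
qed

lemma norm2_minus_commute: "norm2 (\<lambda>x. f x - g x) = norm2 (\<lambda>x. g x - f x)"
  by (simp add: norm2_def ip2_def algebra_simps)

lemma norm2_triangle_diff:
  assumes "L2 f" "L2 g" "L2 h"
  shows "norm2 (\<lambda>x. f x - h x) \<le> norm2 (\<lambda>x. f x - g x) + norm2 (\<lambda>x. g x - h x)"
  using norm2_triangle[OF L2_diff[OF assms(1,2)] L2_diff[OF assms(2,3)]] by simp

lemma norm2_mono:
  assumes "L2 g" "f \<in> borel_measurable borel" "\<And>x. \<bar>f x\<bar> \<le> C * \<bar>g x\<bar>" "0 \<le> C"
  shows "norm2 f \<le> C * norm2 g"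
proof (rule power2_le_imp_le)
  have "L2 f" using L2_bound[OF assms(1-3)] .
  have "(norm2 f)\<^sup>2 \<le> (LINT x|lborel. C\<^sup>2 * (g x)\<^sup>2)"
    unfolding norm2_sq_integral
  proof (rule integral_mono)
    show "integrable lborel (\<lambda>x. (f x)\<^sup>2)" using \<open>L2 f\<close> by (simp add: L2_def)
    show "integrable lborel (\<lambda>x. C\<^sup>2 * (g x)\<^sup>2)" using assms by (simp add: L2_def)
    fix x
    have "\<bar>f x\<bar>\<^sup>2 \<le> (C * \<bar>g x\<bar>)\<^sup>2" by (rule power_mono) (use assms(3) in auto)
    then show "(f x)\<^sup>2 \<le> C\<^sup>2 * (g x)\<^sup>2" by (simp add: power_mult_distrib)
  qed
  then show "(norm2 f)\<^sup>2 \<le> (C * norm2 g)\<^sup>2"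
    by (simp add: norm2_sq_integral power_mult_distrib)
  show "0 \<le> C * norm2 g" using assms by simp
qed

lemma nn_integral_norm2:
  assumes "L2 f" shows "(\<integral>\<^sup>+x. ennreal ((f x)\<^sup>2) \<partial>lborel) = ennreal ((norm2 f)\<^sup>2)"
  unfolding norm2_sq_integral by (rule nn_integral_eq_integral) (use assms in \<open>auto simp: L2_def\<close>)

lemma L2_norm2_of_nn_integral:
  assumes [measurable]: "f \<in> borel_measurable borel"
    and "(\<integral>\<^sup>+x. ennreal ((f x)\<^sup>2) \<partial>lborel) \<le> ennreal (C\<^sup>2)" "0 \<le> C"
  shows "L2 f" "norm2 f \<le> C"
proof -
  show L: "L2 f" unfolding L2_def
  proof (intro conjI integrableI_nonneg)
    show "(\<integral>\<^sup>+x. ennreal ((f x)\<^sup>2) \<partial>lborel) < \<infinity>"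
      using assms(2) by (rule le_less_trans) simp
  qed auto
  show "norm2 f \<le> C"
    using assms(2,3) unfolding nn_integral_norm2[OF L] by (auto intro: power2_le_imp_le)
qed

section \<open>Completeness and weak compactness\<close>

text \<open>A sequence with geometrically decreasing distances converges almost everywhere: the weighted
  series of the squared increments has finite integral, so almost everywhere the increments are
  dominated by a geometric series. Fatou's lemma then controls the distance to the pointwise
  limit.\<close>
lemma L2_complete:
  fixes v :: "nat \<Rightarrow> 'a::euclidean_space \<Rightarrow> real"
  assumes L: "\<And>n. L2 (v n)"
    and C: "\<And>m n. norm2 (\<lambda>x. v m x - v n x) \<le> (1/2)^m + (1/2)^n"
  obtains H where "L2 H" "\<And>n. norm2 (\<lambda>x. v n x - H x) \<le> 2 * (1/2)^n"
proof -
  have [measurable]: "v n \<in> borel_measurable borel" for n using L by (auto simp: L2_def)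
  \<comment> \<open>The weight still leaves a summable series of integrals, and it forces geometric decay pointwise.\<close>
  define d where "d k x = 2^k * (v (Suc k) x - v k x)\<^sup>2" for k x
  have [measurable]: "d k \<in> borel_measurable borel" for k unfolding d_def by measurable
  have d_int: "(\<integral>\<^sup>+x. ennreal (d k x) \<partial>lborel) \<le> ennreal (4 * (1/2)^k)" for k
  proof -
    have "norm2 (\<lambda>x. v (Suc k) x - v k x) \<le> 2 * (1/2)^k"
      by (rule order_trans[OF C]) simp
    then have "(norm2 (\<lambda>x. v (Suc k) x - v k x))\<^sup>2 \<le> (2 * (1/2)^k)\<^sup>2"
      by (rule power_mono) simp
    moreover have "(2 * (1/2::real)^k)\<^sup>2 * 2^k = 4 * (1/2)^k"
    proof -
      have "(2 * (1/2::real)^k)\<^sup>2 * 2^k = 4 * (1/2)^k * ((1/2) * 2)^k"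
        unfolding power_mult_distrib power2_eq_square by (simp add: mult.assoc)
      then show ?thesis by simp
    qed
    ultimately have le: "2^k * (norm2 (\<lambda>x. v (Suc k) x - v k x))\<^sup>2 \<le> 4 * (1/2)^k"
      using mult_right_mono[of _ _ "2^k::real"] by (smt (verit, best) mult.commute zero_le_power)
    have "(\<integral>\<^sup>+x. ennreal (d k x) \<partial>lborel)
        = ennreal (2^k) * (\<integral>\<^sup>+x. ennreal ((v (Suc k) x - v k x)\<^sup>2) \<partial>lborel)"
      unfolding d_def by (simp add: ennreal_mult nn_integral_cmult)
    also have "\<dots> = ennreal (2^k * (norm2 (\<lambda>x. v (Suc k) x - v k x))\<^sup>2)"
      using nn_integral_norm2[OF L2_diff[OF L L], of "Suc k" k] by (simp add: ennreal_mult)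
    finally show ?thesis using le by (simp add: ennreal_leI)
  qed
  have "(\<integral>\<^sup>+x. (\<Sum>k. ennreal (d k x)) \<partial>lborel) = (\<Sum>k. \<integral>\<^sup>+x. ennreal (d k x) \<partial>lborel)"
    by (rule nn_integral_suminf) auto
  also have "\<dots> \<le> (\<Sum>k. ennreal (4 * (1/2)^k))"
    by (intro suminf_le d_int) auto
  also have "\<dots> = ennreal (\<Sum>k. 4 * (1/2)^k)"
    by (rule suminf_ennreal2) (auto intro!: summable_mult summable_geometric)
  finally have "(\<integral>\<^sup>+x. (\<Sum>k. ennreal (d k x)) \<partial>lborel) \<noteq> \<infinity>"
    by (auto simp: top_unique)
  then have "AE x in lborel. (\<Sum>k. ennreal (d k x)) \<noteq> \<infinity>"
    by (intro nn_integral_PInf_AE) auto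
  then have conv: "AE x in lborel. convergent (\<lambda>k. v k x)"
  proof (rule AE_mp, intro AE_I2 impI)
    fix x assume fin: "(\<Sum>k. ennreal (d k x)) \<noteq> \<infinity>"
    define S where "S = enn2real (\<Sum>k. ennreal (d k x))"
    have dle: "d k x \<le> S" for k
    proof -
      have "ennreal (d k x) \<le> (\<Sum>k. ennreal (d k x))"
        using sum_le_suminf[of "\<lambda>k. ennreal (d k x)" "{k}"] by auto
      also have "\<dots> = ennreal S" unfolding S_def using fin by (simp add: less_top)
      finally show ?thesis by (simp add: S_def)
    qed
    have step: "\<bar>v (Suc k) x - v k x\<bar> \<le> sqrt S * (sqrt (1/2))^k" for k
    proof -
      have "(v (Suc k) x - v k x)\<^sup>2 \<le> S * (1/2)^k"
        using dle[of k] by (simp add: d_def field_simps power_divide)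
      then have "sqrt ((v (Suc k) x - v k x)\<^sup>2) \<le> sqrt (S * (1/2)^k)" by (rule real_sqrt_le_mono)
      then show ?thesis by (simp only: real_sqrt_abs) (simp only: real_sqrt_mult real_sqrt_power)
    qed
    have "summable (\<lambda>k. v (Suc k) x - v k x)"
    proof (rule summable_comparison_test')
      show "summable (\<lambda>k. sqrt S * (sqrt (1/2))^k)"
        by (intro summable_mult summable_geometric) (simp add: real_sqrt_divide)
      show "norm (v (Suc k) x - v k x) \<le> sqrt S * (sqrt (1/2))^k" if "k \<ge> 0" for k
        using step by simp
    qed
    then have "convergent (\<lambda>n. \<Sum>k<n. v (Suc k) x - v k x)"
      by (simp add: summable_iff_convergent)
    then have "convergent (\<lambda>n. v n x - v 0 x)"
      by (simp only: sum_lessThan_telescope[of "\<lambda>k. v k x"])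
    then show "convergent (\<lambda>k. v k x)"
      using convergent_add[OF _ convergent_const, of "\<lambda>n. v n x - v 0 x" "v 0 x"] by simp
  qed
  define H where "H x = lim (\<lambda>k. v k x)" for x
  have Hm[measurable]: "H \<in> borel_measurable borel"
    unfolding H_def by (rule borel_measurable_lim_metric) auto
  have tend: "AE x in lborel. (\<lambda>k. v k x) \<longlonglongrightarrow> H x"
    using conv unfolding H_def by eventually_elim (simp add: convergent_LIMSEQ_iff)
  have close: "L2 (\<lambda>x. v n x - H x) \<and> norm2 (\<lambda>x. v n x - H x) \<le> 2 * (1/2)^n" for n
  proof -
    have "(\<integral>\<^sup>+x. ennreal ((v n x - H x)\<^sup>2) \<partial>lborel)
        = (\<integral>\<^sup>+x. liminf (\<lambda>k. ennreal ((v n x - v k x)\<^sup>2)) \<partial>lborel)"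
    proof (rule nn_integral_cong_AE)
      show "AE x in lborel. ennreal ((v n x - H x)\<^sup>2) = liminf (\<lambda>k. ennreal ((v n x - v k x)\<^sup>2))"
        using tend
      proof eventually_elim
        fix x assume "(\<lambda>k. v k x) \<longlonglongrightarrow> H x"
        then have "(\<lambda>k. ennreal ((v n x - v k x)\<^sup>2)) \<longlonglongrightarrow> ennreal ((v n x - H x)\<^sup>2)"
          by (intro tendsto_intros) 
        then show "ennreal ((v n x - H x)\<^sup>2) = liminf (\<lambda>k. ennreal ((v n x - v k x)\<^sup>2))"
          by (intro lim_imp_Liminf[symmetric]) simp_all
      qed
    qed
    also have "\<dots> \<le> liminf (\<lambda>k. \<integral>\<^sup>+x. ennreal ((v n x - v k x)\<^sup>2) \<partial>lborel)"
      by (rule nn_integral_liminf) auto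
    also have "\<dots> \<le> ennreal ((2 * (1/2)^n)\<^sup>2)"
    proof -
      have "eventually (\<lambda>k. (\<integral>\<^sup>+x. ennreal ((v n x - v k x)\<^sup>2) \<partial>lborel) \<le> ennreal ((2 * (1/2)^n)\<^sup>2)) sequentially"
        using eventually_ge_at_top[of n]
      proof eventually_elim
        fix k assume "n \<le> k"
        then have "(1/2::real)^k \<le> (1/2)^n" by (intro power_decreasing) auto
        then have "norm2 (\<lambda>x. v n x - v k x) \<le> 2 * (1/2)^n" using C[of n k] by linarith
        then have "(norm2 (\<lambda>x. v n x - v k x))\<^sup>2 \<le> (2 * (1/2)^n)\<^sup>2" by (rule power_mono) simp
        then show "(\<integral>\<^sup>+x. ennreal ((v n x - v k x)\<^sup>2) \<partial>lborel) \<le> ennreal ((2 * (1/2)^n)\<^sup>2)"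
          by (simp add: nn_integral_norm2[OF L2_diff[OF L L]] ennreal_leI)
      qed
      then have "liminf (\<lambda>k. \<integral>\<^sup>+x. ennreal ((v n x - v k x)\<^sup>2) \<partial>lborel) \<le> liminf (\<lambda>k::nat. ennreal ((2 * (1/2)^n)\<^sup>2))"
        by (rule Liminf_mono)
      then show ?thesis by (simp add: Liminf_const)
    qed
    finally show ?thesis
      using L2_norm2_of_nn_integral[of "\<lambda>x. v n x - H x" "2 * (1/2)^n"] by simp
  qed
  have "L2 H"
    using L2_diff[OF L[of 0] conjunct1[OF close[of 0]]] by simp
  with close that show ?thesis by blast
qed

text \<open>Representation of a bounded functional on a subspace that need not be closed: near-minimisers
  of \<open>\<parallel>s\<parallel>\<^sup>2 - 2 l s\<close> represent \<open>l\<close> up to a small multiple of the norm, because the quadratic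
  functional cannot decrease much along any line through them. With \<open>l\<close> an inner product this
  is an approximate orthogonal projection.\<close>
lemma near_Riesz:
  assumes S: "\<And>s. s \<in> S \<Longrightarrow> L2 s" "S \<noteq> {}"
    and sub: "\<And>s t c. s \<in> S \<Longrightarrow> t \<in> S \<Longrightarrow> (\<lambda>x. s x + c * t x) \<in> S"
    and lin: "\<And>s t c. s \<in> S \<Longrightarrow> t \<in> S \<Longrightarrow> l (\<lambda>x. s x + c * t x) = l s + c * l t"
    and bnd: "\<And>s. s \<in> S \<Longrightarrow> \<bar>l s\<bar> \<le> C * norm2 s"
    and e: "0 < e"
  shows "\<exists>s\<in>S. \<forall>t\<in>S. \<bar>ip2 s t - l t\<bar> \<le> e * norm2 t"
proof -
  define Q where "Q s = ip2 s s - 2 * l s" for s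
  have low: "- C\<^sup>2 \<le> Q s" if "s \<in> S" for s
  proof -
    have "Q s \<ge> (norm2 s)\<^sup>2 - 2 * C * norm2 s"
      using bnd[OF that] by (simp add: Q_def norm2_sq)
    moreover have "0 \<le> (norm2 s)\<^sup>2 + C\<^sup>2 - 2 * norm2 s * C"
      using zero_le_power2[of "norm2 s - C"] unfolding power2_diff .
    moreover have "2 * norm2 s * C = 2 * C * norm2 s" by (simp only: mult_ac)
    ultimately show ?thesis by linarith
  qed
  define m where "m = Inf (Q ` S)"
  have bdd: "bdd_below (Q ` S)" using low by (auto intro!: bdd_belowI[of _ "- C\<^sup>2"])
  have "\<exists>q\<in>Q ` S. q < m + e\<^sup>2"
    using cInf_lessD[of "Q ` S" "m + e\<^sup>2"] S(2) e by (auto simp: m_def)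
  then obtain s where s: "s \<in> S" "Q s < m + e\<^sup>2" by auto
  have mle: "m \<le> Q t" if "t \<in> S" for t
    unfolding m_def using that bdd by (intro cInf_lower) auto
  show ?thesis
  proof (intro bexI[OF _ s(1)] ballI)
    fix t assume t: "t \<in> S"
    define b where "b = ip2 s t - l t"
    have "0 \<le> e\<^sup>2 + 2 * r * b + r\<^sup>2 * ip2 t t" for r
    proof -
      have "m \<le> Q (\<lambda>x. s x + r * t x)" by (intro mle sub s t)
      also have "\<dots> = ip2 (\<lambda>x. s x + r * t x) (\<lambda>x. s x + r * t x) - 2 * (l s + r * l t)"
        by (simp add: Q_def lin s t)
      also have "ip2 (\<lambda>x. s x + r * t x) (\<lambda>x. s x + r * t x) = ip2 s s + 2 * r * ip2 s t + r\<^sup>2 * ip2 t t"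
        using S(1)[OF s(1)] S(1)[OF t] ip2_commute[of s t]
        by (simp add: ip2_add ip2_add_right ip2_scale ip2_scale_right L2_add L2_scale
          algebra_simps power2_eq_square)
      finally have "m \<le> Q s + 2 * r * b + r\<^sup>2 * ip2 t t"
        by (simp add: Q_def b_def algebra_simps)
      then show ?thesis using s(2) by linarith
    qed
    then have "b\<^sup>2 \<le> e\<^sup>2 * ip2 t t"
      by (rule discriminant_bound) (rule ip2_self_nonneg)
    then have "\<bar>b\<bar>\<^sup>2 \<le> (e * norm2 t)\<^sup>2" by (simp add: power_mult_distrib norm2_sq)
    then show "\<bar>ip2 s t - l t\<bar> \<le> e * norm2 t"
      unfolding b_def by (rule power2_le_imp_le) (use e in simp)
  qed
qed

inductive_set lin_span :: "(nat \<Rightarrow> 'a \<Rightarrow> real) \<Rightarrow> ('a \<Rightarrow> real) set" for h where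
  zero: "(\<lambda>x. 0) \<in> lin_span h"
| step: "s \<in> lin_span h \<Longrightarrow> (\<lambda>x. s x + c * h n x) \<in> lin_span h"

lemma lin_span_base: "h n \<in> lin_span h"
  using lin_span.step[OF lin_span.zero, where c=1 and n=n and h=h] by simp

lemma lin_span_add:
  assumes "s \<in> lin_span h" "t \<in> lin_span h"
  shows "(\<lambda>x. s x + c * t x) \<in> lin_span h"
  using assms(2)
proof induction
  case zero
  then show ?case using assms by simp
next
  case (step t b n)
  have "(\<lambda>x. (s x + c * t x) + (c * b) * h n x) \<in> lin_span h"
    by (rule lin_span.step) (rule step)
  then show ?case by (simp add: algebra_simps)
qed

lemma lin_span_L2:
  assumes "\<And>n. L2 (h n)" "s \<in> lin_span h" shows "L2 s"
  using assms(2)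
proof induction
  case zero
  show ?case by simp
next
  case (step s c n)
  then show ?case by (intro L2_add L2_scale assms(1))
qed

definition weak_L2 :: "(nat \<Rightarrow> 'a::euclidean_space \<Rightarrow> real) \<Rightarrow> ('a \<Rightarrow> real) \<Rightarrow> bool" where
  "weak_L2 h H \<longleftrightarrow> (\<forall>\<phi>. L2 \<phi> \<longrightarrow> (\<lambda>n. ip2 (h n) \<phi>) \<longlonglongrightarrow> ip2 H \<phi>)"

lemma weak_L2_D: "weak_L2 h H \<Longrightarrow> L2 \<phi> \<Longrightarrow> (\<lambda>n. ip2 (h n) \<phi>) \<longlonglongrightarrow> ip2 H \<phi>"
  by (simp add: weak_L2_def)

lemma weak_L2_subseq: "weak_L2 h H \<Longrightarrow> strict_mono r \<Longrightarrow> weak_L2 (h \<circ> r) H"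
  unfolding weak_L2_def o_def using LIMSEQ_subseq_LIMSEQ[of _ _ r] by (auto simp: o_def)

lemma bounded_diagonal_subseq:
  fixes a :: "nat \<Rightarrow> nat \<Rightarrow> real"
  assumes "\<And>m. bounded (range (a m))"
  obtains r :: "nat \<Rightarrow> nat" where "strict_mono r" "\<And>m. convergent (a m \<circ> r)"
proof -
  interpret subseqs "\<lambda>m r. convergent (a m \<circ> r)"
  proof
    fix m and s :: "nat \<Rightarrow> nat" assume "strict_mono s"
    have "bounded (range (a m \<circ> s))" by (rule bounded_subset[OF assms]) auto
    then have "\<exists>l r. strict_mono r \<and> ((a m \<circ> s) \<circ> r) \<longlonglongrightarrow> l"
      using bounded_imp_convergent_subsequence[of "a m \<circ> s"] by blast
    then show "\<exists>r'. strict_mono r' \<and> convergent (a m \<circ> (s \<circ> r'))"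
      by (auto simp: convergent_def o_assoc)
  qed
  show thesis
  proof (rule that[OF subseq_diagseq])
    fix m
    have "convergent (a m \<circ> (diagseq \<circ> ((+) (Suc m))))"
    proof (rule diagseq_holds)
      fix r s :: "nat \<Rightarrow> nat" and n assume "strict_mono r" "convergent (a n \<circ> s)"
      then show "convergent (a n \<circ> (s \<circ> r))"
        using convergent_subseq_convergent[of "a n \<circ> s" r] by (simp add: o_assoc)
    qed
    then have "convergent (\<lambda>n. (a m \<circ> diagseq) (n + Suc m))"
      by (simp add: o_def add.commute)
    then show "convergent (a m \<circ> diagseq)" by (simp only: convergent_ignore_initial_segment)
  qed
qed

text \<open>A diagonal argument makes the inner products with all members of the sequence converge. The
  limits define a bounded functional on the span of the sequence; approximate representatives of
  it form a Cauchy sequence, whose limit \<open>H\<close> lies in the closure of the span. An arbitrary test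
  function is first projected approximately onto the span, and so separability of the whole space
  is not involved. That \<open>H\<close> is a strong limit of finite linear combinations is what later makes
  the weak limit of smooth functions approximable by smooth functions.\<close>
theorem weak_compactness_L2:
  fixes h :: "nat \<Rightarrow> 'a::euclidean_space \<Rightarrow> real"
  assumes L: "\<And>n. L2 (h n)" and B: "\<And>n. norm2 (h n) \<le> B"
  obtains r :: "nat \<Rightarrow> nat" and H where "strict_mono r" "L2 H" "weak_L2 (h \<circ> r) H"
    "\<forall>e>0. \<exists>s\<in>lin_span h. norm2 (\<lambda>x. H x - s x) \<le> e"
proof -
  have B0: "0 \<le> B" using B[of 0] norm2_nonneg[of "h 0"] by linarith
  let ?S = "lin_span h"
  have SL: "L2 s" if "s \<in> ?S" for s using lin_span_L2[of h] L that by blast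
  have ne: "?S \<noteq> {}" using lin_span.zero by blast
  have ipB: "\<bar>ip2 (h n) s\<bar> \<le> B * norm2 s" if "L2 s" for n s
    by (rule order_trans[OF Cauchy_Schwarz_L2[OF L that]]) (intro mult_right_mono B norm2_nonneg)
  have "bounded (range (\<lambda>n. ip2 (h n) (h m)))" for m
    unfolding bounded_iff by (auto intro!: exI[of _ "B * norm2 (h m)"] ipB L)
  then obtain r :: "nat \<Rightarrow> nat" where r: "strict_mono r"
      and cv: "\<And>m. convergent ((\<lambda>n. ip2 (h n) (h m)) \<circ> r)"
    using bounded_diagonal_subseq[of "\<lambda>m n. ip2 (h n) (h m)"] by metis
  have cvS: "convergent (\<lambda>n. ip2 (h (r n)) s)" if "s \<in> ?S" for s
    using that
  proof induction
    case zero then show ?case by (simp add: ip2_def convergent_const)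
  next
    case (step s c m)
    have "convergent (\<lambda>n. ip2 (h (r n)) s + c * ip2 (h (r n)) (h m))"
      using step cv[of m] by (intro convergent_add convergent_mult convergent_const) (simp_all add: o_def)
    moreover have "L2 s" using SL step by blast
    ultimately show ?case by (simp add: ip2_add_right ip2_scale_right L L2_scale)
  qed
  define l where "l s = lim (\<lambda>n. ip2 (h (r n)) s)" for s
  have tl: "(\<lambda>n. ip2 (h (r n)) s) \<longlonglongrightarrow> l s" if "s \<in> ?S" for s
    using cvS[OF that] by (simp add: l_def convergent_LIMSEQ_iff)
  have lin: "l (\<lambda>x. s x + c * t x) = l s + c * l t" if "s \<in> ?S" "t \<in> ?S" for s t c
  proof -
    have "(\<lambda>n. ip2 (h (r n)) s + c * ip2 (h (r n)) t) \<longlonglongrightarrow> l s + c * l t"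
      by (intro tendsto_intros tl that)
    then have "(\<lambda>n. ip2 (h (r n)) (\<lambda>x. s x + c * t x)) \<longlonglongrightarrow> l s + c * l t"
      using SL that by (simp add: ip2_add_right ip2_scale_right L L2_scale)
    then show ?thesis using tl[OF lin_span_add[OF that]] LIMSEQ_unique by blast
  qed
  have bnd: "\<bar>l s\<bar> \<le> B * norm2 s" if "s \<in> ?S" for s
  proof (rule LIMSEQ_le_const2)
    show "(\<lambda>n. \<bar>ip2 (h (r n)) s\<bar>) \<longlonglongrightarrow> \<bar>l s\<bar>" by (intro tendsto_rabs tl that)
    show "\<exists>N. \<forall>n\<ge>N. \<bar>ip2 (h (r n)) s\<bar> \<le> B * norm2 s" using ipB SL that by blast
  qed
  have "\<exists>s\<in>?S. \<forall>t\<in>?S. \<bar>ip2 s t - l t\<bar> \<le> (1/2)^k * norm2 t" for k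
    by (rule near_Riesz[of ?S l B, OF SL ne lin_span_add lin bnd]) simp_all
  then obtain s where s: "\<And>k. s k \<in> ?S" "\<And>k t. t \<in> ?S \<Longrightarrow> \<bar>ip2 (s k) t - l t\<bar> \<le> (1/2)^k * norm2 t"
    by metis
  have cauchy: "norm2 (\<lambda>x. s m x - s n x) \<le> (1/2)^m + (1/2)^n" for m n
  proof -
    define t where "t = (\<lambda>x. s m x - s n x)"
    have t: "t \<in> ?S" unfolding t_def using lin_span_add[OF s(1) s(1), where c="-1"] by simp
    have "(norm2 t)\<^sup>2 = ip2 (s m) t - ip2 (s n) t"
      using SL[OF s(1)] SL[OF t] by (simp add: norm2_sq t_def ip2_diff)
    also have "\<dots> \<le> ((1/2)^m + (1/2)^n) * norm2 t"
      using s(2)[OF t, of m] s(2)[OF t, of n] by (simp add: algebra_simps)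
    finally have "norm2 t * norm2 t \<le> ((1/2)^m + (1/2)^n) * norm2 t" by (simp add: power2_eq_square)
    then have "norm2 t \<le> (1/2)^m + (1/2)^n \<or> norm2 t = 0"
      by (auto simp: mult_le_cancel_right less_le)
    then show ?thesis unfolding t_def[symmetric] by (auto simp: add_nonneg_nonneg)
  qed
  obtain H where H: "L2 H" "\<And>n. norm2 (\<lambda>x. s n x - H x) \<le> 2 * (1/2)^n"
    using L2_complete[OF SL[OF s(1)] cauchy] by blast
  have dense: "\<exists>t\<in>?S. norm2 (\<lambda>x. H x - t x) \<le> e" if e: "0 < e" for e
  proof -
    obtain n where "(1/2::real)^n < e / 2" using real_arch_pow_inv[of "e/2" "1/2"] e by auto
    then have "norm2 (\<lambda>x. H x - s n x) \<le> e" using H(2)[of n] by (simp add: norm2_minus_commute)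
    then show ?thesis using s(1) by blast
  qed
  have Hl: "ip2 H t = l t" if t: "t \<in> ?S" for t
  proof -
    have "\<bar>ip2 H t - l t\<bar> \<le> 3 * (1/2)^n * norm2 t" for n
    proof -
      have "\<bar>ip2 (\<lambda>x. s n x - H x) t\<bar> \<le> 2 * (1/2)^n * norm2 t"
        by (rule order_trans[OF Cauchy_Schwarz_L2])
           (use L2_diff SL s H t in \<open>auto intro!: mult_right_mono\<close>)
      then have "\<bar>ip2 (s n) t - ip2 H t\<bar> \<le> 2 * (1/2)^n * norm2 t"
        using SL s H t by (simp add: ip2_diff)
      with s(2)[OF t, of n] show ?thesis by (simp add: algebra_simps)
    qed
    moreover have "(\<lambda>n. 3 * (1/2)^n * norm2 t) \<longlonglongrightarrow> 3 * 0 * norm2 t"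
      by (intro tendsto_intros LIMSEQ_realpow_zero) auto
    ultimately have "\<bar>ip2 H t - l t\<bar> \<le> 3 * 0 * norm2 t"
      by (intro LIMSEQ_le_const) auto
    then show ?thesis by simp
  qed
  have "weak_L2 (h \<circ> r) H"
    unfolding weak_L2_def
  proof (intro allI impI LIMSEQ_I)
    fix \<phi> :: "'a \<Rightarrow> real" and \<epsilon> :: real assume \<phi>: "L2 \<phi>" and \<epsilon>: "0 < \<epsilon>"
    \<comment> \<open>This constant bounds the norms of the sequence and of the limit, with room for one approximation error.\<close>
    define D where "D = 2 + B + norm2 H"
    have D: "0 < D" "B \<le> D" using B0 norm2_nonneg[of H] by (auto simp: D_def intro: add_pos_nonneg)
    define e where "e = \<epsilon> / (4 * D)"
    have e: "0 < e" using \<epsilon> D by (simp add: e_def)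
    have "\<exists>p\<in>?S. \<forall>t\<in>?S. \<bar>ip2 p t - ip2 \<phi> t\<bar> \<le> e * norm2 t"
    proof (rule near_Riesz[of ?S "ip2 \<phi>" "norm2 \<phi>" e, OF SL ne lin_span_add _ _ e])
      show "ip2 \<phi> (\<lambda>x. s x + c * t x) = ip2 \<phi> s + c * ip2 \<phi> t" if "s \<in> ?S" "t \<in> ?S" for s t c
        using SL that \<phi> by (simp add: ip2_add_right ip2_scale_right L2_scale)
      show "\<bar>ip2 \<phi> s\<bar> \<le> norm2 \<phi> * norm2 s" if "s \<in> ?S" for s
        by (intro Cauchy_Schwarz_L2 \<phi> SL that)
    qed
    then obtain p where p: "p \<in> ?S" "\<And>t. t \<in> ?S \<Longrightarrow> \<bar>ip2 p t - ip2 \<phi> t\<bar> \<le> e * norm2 t"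
      by blast
    have 1: "\<bar>ip2 (h n) p - ip2 (h n) \<phi>\<bar> \<le> e * D" for n
    proof -
      have "\<bar>ip2 p (h n) - ip2 \<phi> (h n)\<bar> \<le> e * norm2 (h n)" by (rule p(2)[OF lin_span_base])
      also have "\<dots> \<le> e * D" using e B[of n] D by (intro mult_left_mono) auto
      finally show ?thesis by (simp add: ip2_commute)
    qed
    have 2: "\<bar>ip2 H p - ip2 H \<phi>\<bar> \<le> e * D"
    proof -
      obtain t where t: "t \<in> ?S" "norm2 (\<lambda>x. H x - t x) \<le> min 1 (e / (norm2 (\<lambda>x. p x - \<phi> x) + 1))"
        using dense[of "min 1 (e / (norm2 (\<lambda>x. p x - \<phi> x) + 1))"] e norm2_nonneg[of "\<lambda>x. p x - \<phi> x"]
        by (auto simp: add_nonneg_pos)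
      note LL = SL[OF p(1)] SL[OF t(1)] \<phi> H(1)
      define q where "q = norm2 (\<lambda>x. p x - \<phi> x)"
      have q0: "0 \<le> q" by (simp add: q_def)
      have "\<bar>ip2 (\<lambda>x. H x - t x) (\<lambda>x. p x - \<phi> x)\<bar> \<le> norm2 (\<lambda>x. H x - t x) * q"
        unfolding q_def by (intro Cauchy_Schwarz_L2 L2_diff LL)
      also have "\<dots> \<le> (e / (q + 1)) * (q + 1)"
        using t(2) q0 e unfolding q_def[symmetric] by (intro mult_mono) auto
      also have "\<dots> = e" using q0 by simp
      finally have a: "\<bar>ip2 (\<lambda>x. H x - t x) (\<lambda>x. p x - \<phi> x)\<bar> \<le> e" .
      have b: "norm2 t - norm2 H \<le> 1"
      proof -
        have "norm2 t \<le> norm2 (\<lambda>x. t x - H x) + norm2 H"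
          using norm2_triangle[OF L2_diff[OF LL(2,4)] LL(4)] by simp
        then show ?thesis using t(2) norm2_minus_commute[of t H] by simp
      qed
      have "\<bar>ip2 t (\<lambda>x. p x - \<phi> x)\<bar> \<le> e * norm2 t"
        using p(2)[OF t(1)] LL by (simp add: ip2_diff_right) (simp add: ip2_commute)
      also have "\<dots> \<le> e * (norm2 H + 1)" using b e by (intro mult_left_mono) auto
      finally have c: "\<bar>ip2 t (\<lambda>x. p x - \<phi> x)\<bar> \<le> e * (norm2 H + 1)" .
      have "ip2 H p - ip2 H \<phi> = ip2 (\<lambda>x. H x - t x) (\<lambda>x. p x - \<phi> x) + ip2 t (\<lambda>x. p x - \<phi> x)"
        using LL by (simp add: ip2_diff ip2_diff_right L2_diff)
      then have "\<bar>ip2 H p - ip2 H \<phi>\<bar> \<le> e * (2 + norm2 H)"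
        using a c by (simp add: algebra_simps)
      also have "\<dots> \<le> e * D" using e B0 by (intro mult_left_mono) (auto simp: D_def)
      finally show ?thesis .
    qed
    obtain N where N: "\<And>n. n \<ge> N \<Longrightarrow> \<bar>ip2 (h (r n)) p - l p\<bar> < \<epsilon> / 2"
      using LIMSEQ_D[OF tl[OF p(1)], of "\<epsilon>/2"] \<epsilon> by auto
    have "\<bar>ip2 ((h \<circ> r) n) \<phi> - ip2 H \<phi>\<bar> < \<epsilon>" if "n \<ge> N" for n
    proof -
      have "2 * (e * D) = \<epsilon> / 2" using D by (simp add: e_def)
      then have "\<bar>ip2 (h (r n)) \<phi> - ip2 H \<phi>\<bar> < \<epsilon>"
        using N[OF that] 1[of "r n"] 2 unfolding Hl[OF p(1)] by arith
      then show ?thesis by simp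
    qed
    then show "\<exists>N. \<forall>n\<ge>N. norm (ip2 ((h \<circ> r) n) \<phi> - ip2 H \<phi>) < \<epsilon>" by auto
  qed
  with that[OF r H(1)] dense show thesis by blast
qed

declare Ck.simps [simp del]

section \<open>Continuously differentiable functions on the plane\<close>

text \<open>In finite dimension this is compactness of the closed support, in a form that is easier to
  combine.\<close>
definition csupp :: "('a::real_normed_vector \<Rightarrow> real) \<Rightarrow> bool" where
  "csupp h \<longleftrightarrow> (\<exists>R. \<forall>x. R < norm x \<longrightarrow> h x = 0)"

definition C1 :: "(real^2 \<Rightarrow> real) \<Rightarrow> bool" where
  "C1 h \<longleftrightarrow> (\<forall>x. h differentiable (at x)) \<and> (\<forall>j. continuous_on UNIV (pd j h))"

lemma Ck_1_iff: "Ck 1 h \<longleftrightarrow> C1 h"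
  by (simp add: C1_def Ck.simps)

lemma has_derivative_pd:
  assumes "h differentiable (at x)"
  shows "(h has_derivative (\<lambda>v. \<Sum>j\<in>UNIV. v $ j * pd j h x)) (at x)"
proof -
  have d: "(h has_derivative frechet_derivative h (at x)) (at x)"
    using assms by (simp add: frechet_derivative_works)
  then have lin: "linear (frechet_derivative h (at x))" by (rule has_derivative_linear)
  have "frechet_derivative h (at x) v = (\<Sum>j\<in>UNIV. v $ j * pd j h x)" for v
  proof -
    have "frechet_derivative h (at x) v = frechet_derivative h (at x) (\<Sum>j\<in>UNIV. v $ j *\<^sub>R axis j 1)"
      using basis_expansion[of v] by (simp add: scalar_mult_eq_scaleR)
    also have "\<dots> = (\<Sum>j\<in>UNIV. v $ j * frechet_derivative h (at x) (axis j 1))"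
      using lin by (simp add: linear_sum linear_scale)
    finally show ?thesis by (simp add: pd_def)
  qed
  then show ?thesis using d by presburger
qed

lemma pd_eqI: "(h has_derivative D) (at x) \<Longrightarrow> pd j h x = D (axis j 1)"
  unfolding pd_def by (simp add: frechet_derivative_at[symmetric])

lemma C1_differentiable: "C1 h \<Longrightarrow> h differentiable (at x)"
  by (simp add: C1_def)

lemma C1_has_derivative: "C1 h \<Longrightarrow> (h has_derivative (\<lambda>v. \<Sum>j\<in>UNIV. v $ j * pd j h x)) (at x)"
  by (intro has_derivative_pd C1_differentiable)

lemma C1_continuous: "C1 h \<Longrightarrow> continuous_on UNIV h"
  by (meson C1_differentiable continuous_at_imp_continuous_on differentiable_imp_continuous_within)

lemma C1_continuous_pd: "C1 h \<Longrightarrow> continuous_on UNIV (pd j h)"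
  by (simp add: C1_def)

lemma C1_measurable [measurable_dest]: "C1 h \<Longrightarrow> h \<in> borel_measurable borel"
  by (intro borel_measurable_continuous_onI C1_continuous)

lemma C1_measurable_pd [measurable_dest]: "C1 h \<Longrightarrow> pd j h \<in> borel_measurable borel"
  by (intro borel_measurable_continuous_onI C1_continuous_pd)

text \<open>To exhibit a derivative in terms of candidate partial derivatives gives both the regularity and
  the values of the partial derivatives; all the rules below are obtained in this way.\<close>
lemma C1_of_derivative:
  assumes "\<And>x. (h has_derivative (\<lambda>v. \<Sum>j\<in>UNIV. v $ j * D j x)) (at x)"
    and "\<And>j. continuous_on UNIV (D j)"
  shows "C1 h" "pd j h = D j"
proof -
  have eq: "pd j h = D j" for j
  proof
    fix x
    have "pd j h x = (\<Sum>i\<in>UNIV. axis j 1 $ i * D i x)" by (rule pd_eqI) (rule assms)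
    also have "\<dots> = (\<Sum>i\<in>UNIV. if i = j then D i x else 0)"
      by (intro sum.cong) (auto simp: axis_def)
    finally show "pd j h x = D j x" by simp
  qed
  then show "pd j h = D j" .
  show "C1 h" unfolding C1_def eq using assms by (auto simp: differentiable_def)
qed

lemma C1_const: "C1 (\<lambda>x. c)" and pd_const: "pd j (\<lambda>x. c) = (\<lambda>x. 0)"
  using C1_of_derivative[of "\<lambda>x. c" "\<lambda>j x. 0"] by (auto intro!: derivative_eq_intros)

lemma
  assumes "C1 f" "C1 g"
  shows C1_add: "C1 (\<lambda>x. f x + g x)" and pd_add: "pd j (\<lambda>x. f x + g x) = (\<lambda>x. pd j f x + pd j g x)"
proof -
  have 1: "((\<lambda>x. f x + g x) has_derivative (\<lambda>v. \<Sum>j\<in>UNIV. v $ j * (pd j f x + pd j g x))) (at x)" for x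
    by (rule has_derivative_eq_rhs[OF has_derivative_add[OF C1_has_derivative[OF assms(1)] C1_has_derivative[OF assms(2)]]])
       (simp add: sum.distrib distrib_left)
  have 2: "continuous_on UNIV (\<lambda>x. pd j f x + pd j g x)" for j
    by (intro continuous_intros C1_continuous_pd assms)
  show "C1 (\<lambda>x. f x + g x)" "pd j (\<lambda>x. f x + g x) = (\<lambda>x. pd j f x + pd j g x)"
    using C1_of_derivative[of "\<lambda>x. f x + g x" "\<lambda>j x. pd j f x + pd j g x", OF 1 2] by blast+
qed

lemma
  assumes "C1 f" "C1 g"
  shows C1_mult: "C1 (\<lambda>x. f x * g x)"
    and pd_mult: "pd j (\<lambda>x. f x * g x) = (\<lambda>x. f x * pd j g x + pd j f x * g x)"
proof -
  have 1: "((\<lambda>x. f x * g x) has_derivative (\<lambda>v. \<Sum>j\<in>UNIV. v $ j * (f x * pd j g x + pd j f x * g x))) (at x)" for x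
    by (rule has_derivative_eq_rhs[OF has_derivative_mult[OF C1_has_derivative[OF assms(1)] C1_has_derivative[OF assms(2)]]])
       (simp add: sum.distrib distrib_left sum_distrib_left sum_distrib_right mult_ac)
  have 2: "continuous_on UNIV (\<lambda>x. f x * pd j g x + pd j f x * g x)" for j
    by (intro continuous_intros C1_continuous_pd C1_continuous assms)
  show "C1 (\<lambda>x. f x * g x)" "pd j (\<lambda>x. f x * g x) = (\<lambda>x. f x * pd j g x + pd j f x * g x)"
    using C1_of_derivative[of "\<lambda>x. f x * g x" "\<lambda>j x. f x * pd j g x + pd j f x * g x", OF 1 2] by blast+
qed

lemma
  assumes "C1 f"
  shows C1_scale: "C1 (\<lambda>x. c * f x)" and pd_scale: "pd j (\<lambda>x. c * f x) = (\<lambda>x. c * pd j f x)"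
  using C1_mult[OF C1_const assms] pd_mult[OF C1_const assms] by (auto simp: pd_const)

lemma
  assumes "C1 f" "\<And>s. (\<beta> has_real_derivative \<beta>' s) (at s)" "continuous_on UNIV \<beta>'"
  shows C1_compose: "C1 (\<lambda>x. \<beta> (f x))"
    and pd_compose: "pd j (\<lambda>x. \<beta> (f x)) = (\<lambda>x. \<beta>' (f x) * pd j f x)"
proof -
  have 1: "((\<lambda>x. \<beta> (f x)) has_derivative (\<lambda>v. \<Sum>j\<in>UNIV. v $ j * (\<beta>' (f x) * pd j f x))) (at x)" for x
  proof -
    have "(\<beta> has_derivative (*) (\<beta>' (f x))) (at (f x))"
      using assms(2) by (simp add: has_field_derivative_def)
    from diff_chain_at[OF C1_has_derivative[OF assms(1)] this]
    show ?thesis by (simp add: o_def sum_distrib_left mult_ac)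
  qed
  have 2: "continuous_on UNIV (\<lambda>x. \<beta>' (f x) * pd j f x)" for j
    by (intro continuous_intros C1_continuous_pd C1_continuous assms continuous_on_compose2[OF assms(3)]) auto
  show "C1 (\<lambda>x. \<beta> (f x))" "pd j (\<lambda>x. \<beta> (f x)) = (\<lambda>x. \<beta>' (f x) * pd j f x)"
    using C1_of_derivative[of "\<lambda>x. \<beta> (f x)" "\<lambda>j x. \<beta>' (f x) * pd j f x", OF 1 2] by blast+
qed

lemma
  assumes "C1 f"
  shows C1_affine: "C1 (\<lambda>x. f (a + c *\<^sub>R x))"
    and pd_affine: "pd j (\<lambda>x. f (a + c *\<^sub>R x)) = (\<lambda>x. c * pd j f (a + c *\<^sub>R x))"
proof -
  have 1: "((\<lambda>x. f (a + c *\<^sub>R x)) has_derivative (\<lambda>v. \<Sum>j\<in>UNIV. v $ j * (c * pd j f (a + c *\<^sub>R x)))) (at x)" for x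
  proof -
    have "((\<lambda>x. a + c *\<^sub>R x) has_derivative (\<lambda>v. c *\<^sub>R v)) (at x)"
      by (auto intro!: derivative_eq_intros)
    from diff_chain_at[OF this C1_has_derivative[OF assms]]
    show ?thesis by (simp add: o_def mult_ac)
  qed
  have 2: "continuous_on UNIV (\<lambda>x. c * pd j f (a + c *\<^sub>R x))" for j
    by (intro continuous_intros continuous_on_compose2[OF C1_continuous_pd[OF assms]]) auto
  show "C1 (\<lambda>x. f (a + c *\<^sub>R x))" "pd j (\<lambda>x. f (a + c *\<^sub>R x)) = (\<lambda>x. c * pd j f (a + c *\<^sub>R x))"
    using C1_of_derivative[of "\<lambda>x. f (a + c *\<^sub>R x)" "\<lambda>j x. c * pd j f (a + c *\<^sub>R x)", OF 1 2] by blast+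
qed

lemma
  assumes "C1 f"
  shows C1_reflect: "C1 (\<lambda>y. f (x - y))"
    and pd_reflect: "pd j (\<lambda>y. f (x - y)) = (\<lambda>y. - pd j f (x - y))"
  using C1_affine[OF assms, of x "-1"] pd_affine[OF assms, of j x "-1"] by simp_all

lemma C1_MVT:
  assumes "C1 f"
  obtains s where "0 < s" "s < 1" "f (x + v) - f x = (\<Sum>j\<in>UNIV. v $ j * pd j f (x + s *\<^sub>R v))"
proof -
  have "DERIV (\<lambda>s. f (x + s *\<^sub>R v)) s :> (\<Sum>j\<in>UNIV. v $ j * pd j f (x + s *\<^sub>R v))" for s
  proof -
    have "((\<lambda>s. x + s *\<^sub>R v) has_derivative (\<lambda>t. t *\<^sub>R v)) (at s)"
      by (auto intro!: derivative_eq_intros)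
    from diff_chain_at[OF this C1_has_derivative[OF assms]]
    have "((\<lambda>s. f (x + s *\<^sub>R v)) has_derivative (\<lambda>t. \<Sum>j\<in>UNIV. (t *\<^sub>R v) $ j * pd j f (x + s *\<^sub>R v))) (at s)"
      by (simp add: o_def)
    moreover have "(\<lambda>t. \<Sum>j\<in>UNIV. (t *\<^sub>R v) $ j * pd j f (x + s *\<^sub>R v)) = (*) (\<Sum>j\<in>UNIV. v $ j * pd j f (x + s *\<^sub>R v))"
      by (auto simp: fun_eq_iff sum_distrib_left sum_distrib_right mult_ac)
    ultimately show ?thesis by (simp only: has_field_derivative_def)
  qed
  then obtain s where "0 < s" "s < 1" "f (x + 1 *\<^sub>R v) - f (x + 0 *\<^sub>R v) = (1 - 0) * (\<Sum>j\<in>UNIV. v $ j * pd j f (x + s *\<^sub>R v))"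
    using MVT2[of 0 1 "\<lambda>s. f (x + s *\<^sub>R v)" "\<lambda>s. \<Sum>j\<in>UNIV. v $ j * pd j f (x + s *\<^sub>R v)"] by auto
  with that show ?thesis by simp
qed

subsection \<open>Compact support\<close>

lemma csupp_mult: "csupp g \<Longrightarrow> csupp (\<lambda>x. f x * g x)"
  by (force simp: csupp_def)

lemma csupp_affine:
  assumes "csupp f" "c \<noteq> 0" shows "csupp (\<lambda>x. f (a + c *\<^sub>R x))"
proof -
  obtain R where R: "\<And>x. R < norm x \<Longrightarrow> f x = 0" using assms by (auto simp: csupp_def)
  have "f (a + c *\<^sub>R x) = 0" if "(R + norm a) / \<bar>c\<bar> < norm x" for x
  proof (rule R)
    have "R + norm a < norm (c *\<^sub>R x)" using that assms(2) by (simp add: field_simps)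
    also have "\<dots> \<le> norm (a + c *\<^sub>R x) + norm a" using norm_triangle_ineq4[of "a + c *\<^sub>R x" a] by simp
    finally show "R < norm (a + c *\<^sub>R x)" by simp
  qed
  then show ?thesis by (auto simp: csupp_def)
qed

lemma csupp_reflect: "csupp f \<Longrightarrow> csupp (\<lambda>y. f (x - y))"
  using csupp_affine[of f "-1" x] by simp

lemma csupp_pd:
  assumes "csupp f" shows "csupp (pd j f)"
proof -
  obtain R where R: "\<And>x. R < norm x \<Longrightarrow> f x = 0" using assms by (auto simp: csupp_def)
  have "pd j f x = 0" if x: "R < norm x" for x
  proof -
    have "((\<lambda>x. 0) has_derivative (\<lambda>v. 0)) (at x)" by simp
    then have "(f has_derivative (\<lambda>v. 0)) (at x)"
    proof (rule has_derivative_transform_within_open[where s="- cball 0 R"])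
      show "x \<in> - cball 0 R" using x by simp
      show "0 = f y" if "y \<in> - cball 0 R" for y using R[of y] that by simp
    qed (simp add: open_Compl)
    then show ?thesis using pd_eqI by blast
  qed
  then show ?thesis by (auto simp: csupp_def)
qed

lemma csupp_bounded:
  fixes f :: "'a::euclidean_space \<Rightarrow> real"
  assumes "continuous_on UNIV f" "csupp f"
  obtains B where "\<And>x. \<bar>f x\<bar> \<le> B" "0 \<le> B"
proof -
  obtain R where R: "\<And>x. R < norm x \<Longrightarrow> f x = 0" using assms by (auto simp: csupp_def)
  have "compact (f ` cball 0 R)"
    by (intro compact_continuous_image continuous_on_subset[OF assms(1)]) auto
  then obtain B where B: "\<And>y. y \<in> f ` cball 0 R \<Longrightarrow> \<bar>y\<bar> \<le> B"
    using compact_imp_bounded bounded_iff by (metis real_norm_def)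
  have "\<bar>f x\<bar> \<le> max B 0" for x
    using R[of x] B[of "f x"] by (cases "norm x \<le> R") (auto simp: le_max_iff_disj)
  then show thesis by (intro that[of "max B 0"]) auto
qed

lemma csupp_uniformly_continuous:
  fixes f :: "'a::euclidean_space \<Rightarrow> real"
  assumes "continuous_on UNIV f" "csupp f" "0 < e"
  obtains d where "0 < d" "\<And>x v. norm v < d \<Longrightarrow> \<bar>f (x + v) - f x\<bar> < e"
proof -
  obtain R where R: "\<And>x. R < norm x \<Longrightarrow> f x = 0" using assms by (auto simp: csupp_def)
  have "uniformly_continuous_on (cball 0 (R + 1)) f"
    by (intro compact_uniformly_continuous continuous_on_subset[OF assms(1)]) auto
  then obtain d where d: "0 < d" "\<And>x y. x \<in> cball 0 (R+1) \<Longrightarrow> y \<in> cball 0 (R+1) \<Longrightarrow> dist y x < d \<Longrightarrow> dist (f y) (f x) < e"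
    unfolding uniformly_continuous_on_def using assms(3) by blast
  show thesis
  proof (rule that[of "min d 1"])
    fix x v :: 'a assume v: "norm v < min d 1"
    show "\<bar>f (x + v) - f x\<bar> < e"
    proof (cases "norm x \<le> R \<or> norm (x + v) \<le> R")
      case True
      have "norm x \<le> R + 1" "norm (x + v) \<le> R + 1"
        using True v norm_triangle_ineq[of x v] norm_triangle_ineq4[of "x + v" v] by auto
      moreover have "dist (x + v) x = norm v" by (simp add: dist_norm)
      ultimately show ?thesis using d(2)[of x "x + v"] v by (simp add: dist_real_def)
    next
      case False
      then show ?thesis using R assms(3) by auto
    qed
  qed (use d in auto)
qed

lemma csupp_integrable:
  fixes f :: "'a::euclidean_space \<Rightarrow> real"
  assumes "continuous_on UNIV f" "csupp f"
  shows "integrable lborel f"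
proof -
  obtain R where R: "\<And>x. R < norm x \<Longrightarrow> f x = 0" using assms by (auto simp: csupp_def)
  have "integrable lborel (\<lambda>x. indicator (cball 0 R) x *\<^sub>R f x)"
    by (intro borel_integrable_compact continuous_on_subset[OF assms(1)]) auto
  moreover have "(\<lambda>x. indicator (cball 0 R) x *\<^sub>R f x) = f"
    using R by (auto simp: indicator_def fun_eq_iff not_le)
  ultimately show ?thesis by simp
qed

lemma csupp_L2:
  fixes f :: "'a::euclidean_space \<Rightarrow> real"
  assumes "continuous_on UNIV f" "csupp f"
  shows "L2 f"
  unfolding L2_def
proof
  show "f \<in> borel_measurable borel" by (rule borel_measurable_continuous_onI[OF assms(1)])
  show "integrable lborel (\<lambda>x. (f x)\<^sup>2)"
    unfolding power2_eq_square
    by (intro csupp_integrable continuous_intros assms csupp_mult)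
qed

text \<open>The first-order Taylor error is uniform in the base point, since the derivatives are uniformly
  continuous. This is what permits differentiation under integrals over the plane.\<close>
lemma C1_uniform_linearization:
  assumes "C1 f" "csupp f" "0 < e"
  obtains d where "0 < d"
    "\<And>x v. norm v < d \<Longrightarrow> \<bar>f (x + v) - f x - (\<Sum>j\<in>UNIV. v $ j * pd j f x)\<bar> \<le> e * norm v"
proof -
  have "\<exists>d>0. \<forall>x v. norm v < d \<longrightarrow> \<bar>pd j f (x + v) - pd j f x\<bar> < e / 2" for j
    by (rule csupp_uniformly_continuous[of "pd j f" "e/2"])
       (use assms C1_continuous_pd csupp_pd in auto)
  then obtain d where d: "\<And>j. 0 < d j"
      "\<And>j x v. norm v < d j \<Longrightarrow> \<bar>pd j f (x + v) - pd j f x\<bar> < e / 2" by metis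
  define d0 where "d0 = Min (range d)"
  have d0: "0 < d0" "\<And>j. d0 \<le> d j" using d(1) by (auto simp: d0_def)
  show thesis
  proof (rule that[OF d0(1)])
    fix x v :: "real^2" assume v: "norm v < d0"
    obtain s where s: "0 < s" "s < 1" "f (x + v) - f x = (\<Sum>j\<in>UNIV. v $ j * pd j f (x + s *\<^sub>R v))"
      by (rule C1_MVT[OF assms(1)])
    have "\<bar>f (x + v) - f x - (\<Sum>j\<in>UNIV. v $ j * pd j f x)\<bar>
        = \<bar>\<Sum>j\<in>UNIV. v $ j * (pd j f (x + s *\<^sub>R v) - pd j f x)\<bar>"
      by (simp add: s(3) sum_subtractf right_diff_distrib)
    also have "\<dots> \<le> (\<Sum>j\<in>UNIV. \<bar>v $ j * (pd j f (x + s *\<^sub>R v) - pd j f x)\<bar>)" by (rule sum_abs)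
    also have "\<dots> \<le> (\<Sum>j\<in>(UNIV::2 set). norm v * (e / 2))"
    proof (rule sum_mono)
      fix j :: 2
      have "s * norm v \<le> norm v" using s by (simp add: mult_left_le_one_le)
      then have "norm (s *\<^sub>R v) < d j" using v s d0(2)[of j] by simp
      from d(2)[OF this, of x]
      have "\<bar>v $ j\<bar> * \<bar>pd j f (x + s *\<^sub>R v) - pd j f x\<bar> \<le> norm v * (e / 2)"
        by (intro mult_mono component_le_norm_cart) auto
      then show "\<bar>v $ j * (pd j f (x + s *\<^sub>R v) - pd j f x)\<bar> \<le> norm v * (e / 2)"
        by (simp add: abs_mult)
    qed
    finally show "\<bar>f (x + v) - f x - (\<Sum>j\<in>UNIV. v $ j * pd j f x)\<bar> \<le> e * norm v"
      by (simp add: mult.commute)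
  qed
qed

subsection \<open>Change of variables\<close>

lemma integral_affine:
  fixes f :: "'a::euclidean_space \<Rightarrow> real"
  assumes [measurable]: "f \<in> borel_measurable borel" and "c \<noteq> 0"
  shows "(LINT x|lborel. f x) = \<bar>c\<bar> ^ DIM('a) * (LINT x|lborel. f (a + c *\<^sub>R x))"
  by (subst lborel_affine[OF assms(2), of a])
     (simp add: integral_density integral_distr)

lemma integrable_affine:
  fixes f :: "'a::euclidean_space \<Rightarrow> real"
  assumes "integrable lborel f" and "c \<noteq> 0"
  shows "integrable lborel (\<lambda>x. f (a + c *\<^sub>R x))"
proof -
  have [measurable]: "f \<in> borel_measurable borel" using assms(1) by (auto dest: borel_measurable_integrable)
  have "integrable (density (distr lborel borel (\<lambda>x. a + c *\<^sub>R x)) (\<lambda>_. ennreal (\<bar>c\<bar> ^ DIM('a)))) f"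
    using assms(1) by (subst lborel_affine[OF assms(2), of a, symmetric])
  then have "integrable (distr lborel borel (\<lambda>x. a + c *\<^sub>R x)) (\<lambda>x. \<bar>c\<bar> ^ DIM('a) *\<^sub>R f x)"
    by (subst (asm) integrable_density) auto
  then have "integrable lborel (\<lambda>x. \<bar>c\<bar> ^ DIM('a) *\<^sub>R f (a + c *\<^sub>R x))"
    by (subst (asm) integrable_distr_eq) auto
  then show ?thesis using assms(2) by simp
qed

lemma L2_shift:
  assumes "L2 h" shows "L2 (\<lambda>x. h (x - z))" "norm2 (\<lambda>x. h (x - z)) = norm2 h"
proof -
  have [measurable]: "h \<in> borel_measurable borel" using assms by (simp add: L2_def)
  show "L2 (\<lambda>x. h (x - z))"
    using integrable_affine[OF L2_sq_integrable[OF assms], of 1 "-z"] by (simp add: L2_def add.commute)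
  have "(norm2 (\<lambda>x. h (x - z)))\<^sup>2 = (norm2 h)\<^sup>2"
    using integral_affine[of "\<lambda>x. (h x)\<^sup>2" 1 "-z"] by (simp add: norm2_sq_integral add.commute)
  then show "norm2 (\<lambda>x. h (x - z)) = norm2 h" by simp
qed

subsection \<open>Integration by parts\<close>

text \<open>The integral of a difference quotient vanishes by translation invariance, and difference
  quotients converge to the derivative uniformly on a fixed ball.\<close>
lemma integral_pd_eq_0:
  assumes "C1 f" "csupp f" shows "(LINT x|lborel. pd j f x) = 0"
proof -
  obtain R where R: "\<And>x. R < norm x \<Longrightarrow> f x = 0" using assms by (auto simp: csupp_def)
  obtain R' where R': "\<And>x. R' < norm x \<Longrightarrow> pd j f x = 0" using csupp_pd[OF assms(2)] by (auto simp: csupp_def)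
  define K where "K = (cball 0 (max R R' + 1) :: (real^2) set)"
  have mK: "emeasure lborel K < \<infinity>" unfolding K_def by (rule emeasure_lborel_cball_finite)
  have If: "integrable lborel f" by (intro csupp_integrable C1_continuous assms)
  have Ip: "integrable lborel (pd j f)" by (intro csupp_integrable C1_continuous_pd csupp_pd assms)
  have [measurable]: "f \<in> borel_measurable borel" using assms by measurable
  have "\<bar>LINT x|lborel. pd j f x\<bar> \<le> e * measure lborel K" if e: "0 < e" for e
  proof -
    obtain d where d: "0 < d"
      "\<And>x v. norm v < d \<Longrightarrow> \<bar>f (x + v) - f x - (\<Sum>j\<in>UNIV. v $ j * pd j f x)\<bar> \<le> e * norm v"
      using C1_uniform_linearization[OF assms e] by blast
    define t where "t = min (d / 2) 1"
    have t: "0 < t" "t < d" "t \<le> 1" using d(1) by (auto simp: t_def)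
    define v where "v = t *\<^sub>R (axis j 1 :: real^2)"
    have nv: "norm v = t" using t by (simp add: v_def norm_axis_1)
    have sv: "(\<Sum>i\<in>UNIV. v $ i * pd i f x) = t * pd j f x" for x
    proof -
      have "(\<Sum>i\<in>UNIV. v $ i * pd i f x) = (\<Sum>i\<in>UNIV. if i = j then t * pd i f x else 0)"
        by (intro sum.cong) (auto simp: v_def axis_def)
      then show ?thesis by simp
    qed
    have Is: "integrable lborel (\<lambda>x. f (x + v))" 
      using integrable_affine[OF If, of 1 v] by (simp add: add.commute)
    have zero: "(LINT x|lborel. f (x + v)) = (LINT x|lborel. f x)"
      using integral_affine[of f 1 v] by (simp add: add.commute)
    have "t * \<bar>LINT x|lborel. pd j f x\<bar> = \<bar>LINT x|lborel. (f (x + v) - f x - t * pd j f x)\<bar>"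
      using If Is Ip zero t by (simp add: abs_mult)
    also have "\<dots> \<le> (LINT x|lborel. (e * t) * indicator K x)"
    proof (rule order_trans[OF integral_abs_bound], rule integral_mono)
      show "integrable lborel (\<lambda>x. \<bar>f (x + v) - f x - t * pd j f x\<bar>)"
        using If Is Ip by (intro integrable_abs Bochner_Integration.integrable_diff integrable_mult_right)
      show "integrable lborel (\<lambda>x. (e * t) * indicator K x)"
        using mK by (intro integrable_mult_right integrable_real_indicator) (auto simp: K_def)
      fix x
      show "\<bar>f (x + v) - f x - t * pd j f x\<bar> \<le> e * t * indicator K x"
      proof (cases "x \<in> K")
        case True
        then show ?thesis using d(2)[of v x] nv sv t by simp
      next
        case False
        then have "max R R' + 1 < norm x" by (simp add: K_def)
        moreover have "norm x \<le> norm (x + v) + 1" using norm_triangle_ineq4[of "x + v" v] nv t by simp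
        ultimately have "R < norm x" "R' < norm x" "R < norm (x + v)" by auto
        then show ?thesis using False R R' by simp
      qed
    qed
    also have "\<dots> = t * (e * measure lborel K)" by simp
    finally show ?thesis using t by simp
  qed
  then have "\<bar>LINT x|lborel. pd j f x\<bar> \<le> 0"
  proof -
    assume *: "\<And>e. 0 < e \<Longrightarrow> \<bar>LINT x|lborel. pd j f x\<bar> \<le> e * measure lborel K"
    have m: "0 \<le> measure lborel K" by simp
    show ?thesis
    proof (rule field_le_epsilon)
      fix e :: real assume e: "0 < e"
      have "\<bar>LINT x|lborel. pd j f x\<bar> \<le> (e / (measure lborel K + 1)) * measure lborel K"
        using e m by (intro *) (simp add: add_nonneg_pos)
      also have "\<dots> \<le> (e / (measure lborel K + 1)) * (measure lborel K + 1)"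
        using e m by (intro mult_left_mono) auto
      also have "\<dots> = e" using m by (simp add: add_nonneg_eq_0_iff)
      finally show "\<bar>LINT x|lborel. pd j f x\<bar> \<le> 0 + e" by simp
    qed
  qed
  then show ?thesis by simp
qed

lemma integral_by_parts:
  assumes "C1 f" "C1 g" "csupp g"
  shows "(LINT x|lborel. f x * pd j g x) = - (LINT x|lborel. pd j f x * g x)"
proof -
  have "0 = (LINT x|lborel. f x * pd j g x + pd j f x * g x)"
    using integral_pd_eq_0[of "\<lambda>x. f x * g x" j] C1_mult[OF assms(1,2)] csupp_mult[OF assms(3)]
    by (simp add: pd_mult[OF assms(1,2)])
  also have "\<dots> = (LINT x|lborel. f x * pd j g x) + (LINT x|lborel. pd j f x * g x)"
    by (intro Bochner_Integration.integral_add csupp_integrable continuous_intros C1_continuous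
        C1_continuous_pd csupp_mult csupp_pd assms)
  finally show ?thesis by simp
qed

section \<open>Smooth functions and mollifiers\<close>

lemma Ck_0: "Ck 0 h \<longleftrightarrow> continuous_on UNIV h"
  by (simp add: Ck.simps)

lemma Ck_continuous: "Ck k h \<Longrightarrow> continuous_on UNIV h"
proof (cases k)
  case (Suc m)
  assume "Ck k h"
  then have "\<forall>x. h differentiable (at x)" by (simp add: Suc Ck.simps)
  then show ?thesis
    by (meson continuous_at_imp_continuous_on differentiable_imp_continuous_within)
qed (simp add: Ck_0)

text \<open>Passing through \<open>C1\<close> lets the closure properties be proved by induction from the rules for
  first derivatives.\<close>
lemma Ck_Suc_iff: "Ck (Suc k) h \<longleftrightarrow> C1 h \<and> (\<forall>j. Ck k (pd j h))"
  using Ck_continuous by (auto simp: Ck.simps C1_def)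

lemma Ck_SucD: "Ck (Suc k) h \<Longrightarrow> Ck k h"
proof (induction k arbitrary: h)
  case 0
  then show ?case by (simp add: Ck_0 Ck_continuous)
next
  case (Suc k)
  then show ?case unfolding Ck_Suc_iff[of "Suc k"] by (auto simp: Ck_Suc_iff[of k])
qed

lemma Ck_add: "Ck k f \<Longrightarrow> Ck k g \<Longrightarrow> Ck k (\<lambda>x. f x + g x)"
  by (induction k arbitrary: f g) (auto simp: Ck_0 Ck_Suc_iff C1_add pd_add intro!: continuous_intros)

lemma Ck_const: "Ck k (\<lambda>x. c)"
  by (induction k arbitrary: c) (auto simp: Ck_0 Ck_Suc_iff C1_const pd_const)

lemma Ck_mult: "Ck k f \<Longrightarrow> Ck k g \<Longrightarrow> Ck k (\<lambda>x. f x * g x)"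
proof (induction k arbitrary: f g)
  case 0
  then show ?case by (auto simp: Ck_0 intro!: continuous_intros)
next
  case (Suc k)
  then have "Ck k f" "Ck k g" by (auto dest: Ck_SucD)
  with Suc show ?case by (auto simp: Ck_Suc_iff C1_mult pd_mult intro!: Ck_add)
qed

lemma Ck_scale: "Ck k f \<Longrightarrow> Ck k (\<lambda>x. c * f x)"
  by (intro Ck_mult Ck_const)

lemma Ck_affine: "Ck k f \<Longrightarrow> Ck k (\<lambda>x. f (a + c *\<^sub>R x))"
proof (induction k arbitrary: f)
  case 0
  then show ?case by (auto simp: Ck_0 intro!: continuous_on_compose2[of UNIV f] continuous_intros)
next
  case (Suc k)
  then show ?case by (auto simp: Ck_Suc_iff C1_affine pd_affine intro!: Ck_scale)
qed

lemma test_functionI: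
  assumes "\<And>k. Ck k \<phi>" "csupp \<phi>" shows "test_function \<phi>"
proof -
  obtain R where R: "\<And>x. R < norm x \<Longrightarrow> \<phi> x = 0" using assms by (auto simp: csupp_def)
  then have "{x. \<phi> x \<noteq> 0} \<subseteq> cball 0 R" by (auto simp: not_less[symmetric])
  then have "bounded {x. \<phi> x \<noteq> 0}" using bounded_cball bounded_subset by blast
  then show ?thesis using assms(1) by (simp add: test_function_def compact_closure)
qed

text \<open>The exponents \<open>n\<close> make this family closed under differentiation up to linear combinations, so
  that smoothness of \<open>flat 0\<close> follows by induction from a single derivative formula.\<close>
definition flat :: "nat \<Rightarrow> real \<Rightarrow> real" where
  "flat n t = (if 0 < t then (1 / t) ^ n * exp (- 1 / t) else 0)"

lemma flat_right_limit: "(flat n \<longlongrightarrow> 0) (at_right 0)"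
proof -
  have "((\<lambda>t. (1/t) ^ n / exp (1/t)) \<longlongrightarrow> (0::real)) (at_right 0)"
    by (rule filterlim_compose[OF tendsto_power_div_exp_0])
       (simp add: filterlim_inverse_at_top_right flip: inverse_eq_divide)
  moreover have "\<forall>\<^sub>F t in at_right 0. (1/t) ^ n / exp (1/t) = flat n t"
    unfolding eventually_at_right_field
    by (intro exI[of _ 1]) (auto simp: flat_def exp_minus inverse_eq_divide)
  ultimately show ?thesis by (rule Lim_transform_eventually)
qed

text \<open>At the origin the difference quotients from the right are the values of the next member of the
  family, which tend to zero.\<close>
lemma flat_derivative:
  "(flat n has_real_derivative (flat (n + 2) t - real n * flat (n + 1) t)) (at t)"
proof (cases t "0::real" rule: linorder_cases)
  case less
  have "((\<lambda>t. 0) has_real_derivative 0) (at t)" by simp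
  then have "(flat n has_real_derivative 0) (at t)"
    by (rule has_field_derivative_transform_within_open[where S="{..<0}"]) (use less in \<open>auto simp: flat_def\<close>)
  then show ?thesis using less by (simp add: flat_def)
next
  case greater
  have "((\<lambda>t. (1/t) ^ n * exp (- 1/t)) has_real_derivative (flat (n + 2) t - real n * flat (n + 1) t)) (at t)"
  proof (cases n)
    case 0
    show ?thesis using greater unfolding 0
      by (auto intro!: derivative_eq_intros simp: flat_def field_simps power2_eq_square)
  next
    case (Suc m)
    show ?thesis using greater unfolding Suc
      by (auto intro!: derivative_eq_intros simp: flat_def power2_eq_square divide_inverse algebra_simps simp del: power_Suc)
         (simp add: power_add power2_eq_square algebra_simps)
  qed
  then show ?thesis
    by (rule has_field_derivative_transform_within_open[where S="{0<..}"]) (use greater in \<open>auto simp: flat_def\<close>)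
next
  case equal
  have R: "((\<lambda>y. (flat n y - flat n 0) / (y - 0)) \<longlongrightarrow> 0) (at_right 0)"
  proof (rule Lim_transform_eventually[OF flat_right_limit[of "Suc n"]])
    show "\<forall>\<^sub>F t in at_right 0. flat (Suc n) t = (flat n t - flat n 0) / (t - 0)"
      unfolding eventually_at_right_field
      by (intro exI[of _ 1]) (auto simp: flat_def)
  qed
  have L: "((\<lambda>y. (flat n y - flat n 0) / (y - 0)) \<longlongrightarrow> 0) (at_left 0)"
  proof (rule Lim_transform_eventually[OF tendsto_const])
    show "\<forall>\<^sub>F t in at_left 0. 0 = (flat n t - flat n 0) / (t - 0)"
      unfolding eventually_at_left_field
      by (intro exI[of _ "-1"]) (auto simp: flat_def)
  qed
  have "(flat n has_real_derivative 0) (at 0)"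
    unfolding has_field_derivative_iff using filterlim_split_at[OF L R] by simp
  then show ?thesis using equal by (simp add: flat_def)
qed

lemma flat_continuous: "continuous_on UNIV (flat n)"
  by (rule DERIV_continuous_on[OF has_field_derivative_at_within[OF flat_derivative]])

lemma Ck_coordinate_flat: "Ck k (\<lambda>x::real^2. flat n (a + c * x $ i))"
proof (induction k arbitrary: n)
  case 0
  show ?case unfolding Ck_0
    by (intro continuous_on_compose2[OF flat_continuous] continuous_intros) auto
next
  case (Suc k)
  define D where "D j x = (if j = i then c * (flat (n + 2) (a + c * x $ i) - real n * flat (n + 1) (a + c * x $ i)) else 0)"
    for j and x :: "real^2"
  have 1: "((\<lambda>x::real^2. flat n (a + c * x $ i)) has_derivative (\<lambda>v. \<Sum>j\<in>UNIV. v $ j * D j x)) (at x)" for x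
  proof -
    have d1: "((\<lambda>x::real^2. a + c * x $ i) has_derivative (\<lambda>v. c * v $ i)) (at x)"
      by (auto intro!: derivative_eq_intros bounded_linear_imp_has_derivative bounded_linear_vec_nth)
    have d2: "(flat n has_derivative (*) (flat (n + 2) (a + c * x $ i) - real n * flat (n + 1) (a + c * x $ i))) (at (a + c * x $ i))"
      using flat_derivative by (simp add: has_field_derivative_def)
    have "((\<lambda>x. flat n (a + c * x $ i)) has_derivative
       (\<lambda>v. (flat (n + 2) (a + c * x $ i) - real n * flat (n + 1) (a + c * x $ i)) * (c * v $ i))) (at x)"
      using diff_chain_at[OF d1 d2] by (simp add: o_def)
    moreover have "(\<Sum>j\<in>UNIV. v $ j * D j x) = (flat (n + 2) (a + c * x $ i) - real n * flat (n + 1) (a + c * x $ i)) * (c * v $ i)" for v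
    proof -
      have "(\<Sum>j\<in>UNIV. v $ j * D j x) = (\<Sum>j\<in>UNIV. if j = i then v $ i * D i x else 0)"
        by (intro sum.cong) (auto simp: D_def)
      then show ?thesis by (simp add: D_def)
    qed
    ultimately show ?thesis by simp
  qed
  have ck: "Ck k (D j)" for j
  proof (cases "j = i")
    case True
    have "Ck k (\<lambda>x. c * (flat (n + 2) (a + c * x $ i) + (- real n) * flat (n + 1) (a + c * x $ i)))"
      by (intro Ck_scale Ck_add Suc)
    then show ?thesis by (simp add: D_def[abs_def] True)
  next
    case False
    then show ?thesis by (simp add: D_def[abs_def] Ck_const)
  qed
  show ?case unfolding Ck_Suc_iff
    using C1_of_derivative[of "\<lambda>x. flat n (a + c * x $ i)" D, OF 1 Ck_continuous[OF ck]] ck by auto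
qed

text \<open>For large \<open>c\<close> a smooth approximation of the indicator of the box, supported in it.\<close>
definition box_bump :: "real^2 \<Rightarrow> real^2 \<Rightarrow> real \<Rightarrow> real^2 \<Rightarrow> real" where
  "box_bump l r c x = flat 0 (c * (x $ 1 - l $ 1)) * flat 0 (c * (r $ 1 - x $ 1))
     * (flat 0 (c * (x $ 2 - l $ 2)) * flat 0 (c * (r $ 2 - x $ 2)))"

lemma flat_0_bounds: "0 \<le> flat 0 t" "flat 0 t \<le> 1"
  by (auto simp: flat_def)

lemma box_bump_bounds: "0 \<le> box_bump l r c x" "box_bump l r c x \<le> 1"
  unfolding box_bump_def by (auto intro!: mult_le_one mult_nonneg_nonneg flat_0_bounds)

lemma Ck_box_bump: "Ck k (box_bump l r c)"
proof -
  have "Ck k (\<lambda>x. flat 0 (- c * l $ 1 + c * x $ 1) * flat 0 (c * r $ 1 + (- c) * x $ 1)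
     * (flat 0 (- c * l $ 2 + c * x $ 2) * flat 0 (c * r $ 2 + (- c) * x $ 2)))"
    by (intro Ck_mult Ck_coordinate_flat)
  moreover have "box_bump l r c = (\<lambda>x. flat 0 (- c * l $ 1 + c * x $ 1) * flat 0 (c * r $ 1 + (- c) * x $ 1)
     * (flat 0 (- c * l $ 2 + c * x $ 2) * flat 0 (c * r $ 2 + (- c) * x $ 2)))"
    by (simp add: box_bump_def fun_eq_iff algebra_simps)
  ultimately show ?thesis by simp
qed

lemma box_bump_outside:
  assumes "0 < c" "x \<notin> box l r" shows "box_bump l r c x = 0"
proof -
  have "x $ 1 \<le> l $ 1 \<or> r $ 1 \<le> x $ 1 \<or> x $ 2 \<le> l $ 2 \<or> r $ 2 \<le> x $ 2"
    using assms(2) by (auto simp: mem_box_cart forall_2 not_less)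
  then show ?thesis using assms(1) by (auto simp: box_bump_def flat_def zero_less_mult_iff)
qed

lemma csupp_box_bump: "0 < c \<Longrightarrow> csupp (box_bump l r c)"
proof -
  assume c: "0 < c"
  obtain R where R: "\<forall>x\<in>box l r. norm x \<le> R" using bounded_box[of l r] unfolding bounded_iff by auto
  have "box_bump l r c x = 0" if "R < norm x" for x
  proof (rule box_bump_outside[OF c])
    show "x \<notin> box l r" using R that by (auto simp: not_le[symmetric])
  qed
  then show ?thesis by (auto simp: csupp_def)
qed

lemma box_bump_tendsto_indicator:
  "(\<lambda>n. box_bump l r (real (Suc n)) x) \<longlonglongrightarrow> indicator (box l r) x"
proof (cases "x \<in> box l r")
  case True
  have *: "(\<lambda>n. flat 0 (real (Suc n) * t)) \<longlonglongrightarrow> 1" if "0 < t" for t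
  proof -
    have "(\<lambda>n. exp (- (1 / t) * inverse (real (Suc n)))) \<longlonglongrightarrow> exp (- (1 / t) * 0)"
      by (intro tendsto_intros LIMSEQ_inverse_real_of_nat)
    then show ?thesis using that by (simp add: flat_def zero_less_mult_iff field_simps del: of_nat_Suc)
  qed
  have "(\<lambda>n. box_bump l r (real (Suc n)) x) \<longlonglongrightarrow> 1 * 1 * (1 * 1)"
    unfolding box_bump_def using True by (intro tendsto_mult *) (auto simp: mem_box_cart)
  then show ?thesis using True by simp
next
  case False
  then show ?thesis by (simp add: box_bump_outside del: of_nat_Suc)
qed

lemma loc_integrable_mult:
  assumes "locally_integrable h" "continuous_on UNIV \<phi>" "csupp \<phi>"
  shows "integrable lebesgue (\<lambda>x. h x * \<phi> x)"
proof -
  obtain R where R: "\<And>x. R < norm x \<Longrightarrow> \<phi> x = 0" using assms by (auto simp: csupp_def)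
  obtain B where B: "\<And>x. \<bar>\<phi> x\<bar> \<le> B" "0 \<le> B" using csupp_bounded[OF assms(2,3)] by blast
  have I: "integrable lebesgue (\<lambda>x. indicator (cball 0 R) x *\<^sub>R h x)"
    using assms(1) by (auto simp: locally_integrable_def set_integrable_def)
  have m: "\<phi> \<in> borel_measurable lebesgue"
    by (intro measurable_completion) (simp add: borel_measurable_continuous_onI[OF assms(2)])
  have eq: "h x * \<phi> x = (indicator (cball 0 R) x *\<^sub>R h x) * \<phi> x" for x
    using R[of x] by (auto simp: indicator_def not_le)
  show ?thesis unfolding eq
  proof (rule Bochner_Integration.integrable_bound)
    show "integrable lebesgue (\<lambda>x. B * (indicator (cball 0 R) x *\<^sub>R h x))"
      using I by simp
    show "(\<lambda>x. indicator (cball 0 R) x *\<^sub>R h x * \<phi> x) \<in> borel_measurable lebesgue"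
      using I m by (intro borel_measurable_times) (auto dest: borel_measurable_integrable)
    show "AE x in lebesgue. norm (indicator (cball 0 R) x *\<^sub>R h x * \<phi> x) \<le> norm (B * (indicator (cball 0 R) x *\<^sub>R h x))"
    proof (rule AE_I2)
      fix x
      have "\<bar>indicator (cball 0 R) x *\<^sub>R h x\<bar> * \<bar>\<phi> x\<bar> \<le> \<bar>indicator (cball 0 R) x *\<^sub>R h x\<bar> * B"
        by (intro mult_left_mono B) auto
      then show "norm (indicator (cball 0 R) x *\<^sub>R h x * \<phi> x) \<le> norm (B * (indicator (cball 0 R) x *\<^sub>R h x))"
        using B(2) by (simp add: abs_mult mult.commute)
    qed
  qed
qed

lemma AE_zero_of_AE_zero_on_boxes:
  fixes h :: "'a::euclidean_space \<Rightarrow> real"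
  assumes "\<And>N. AE x in lborel. indicator (box (- real N *\<^sub>R One) (real N *\<^sub>R One)) x * h x = 0"
  shows "AE x in lborel. h x = 0"
proof -
  have "AE x in lborel. \<forall>N. indicator (box (- real N *\<^sub>R One) (real N *\<^sub>R One)) x * h x = 0"
    unfolding AE_all_countable using assms by blast
  then show ?thesis
  proof eventually_elim
    fix x assume *: "\<forall>N. indicator (box (- real N *\<^sub>R One) (real N *\<^sub>R One)) x * h x = 0"
    have "x \<in> (\<Union>N::nat. box (- (real N *\<^sub>R One)) (real N *\<^sub>R One))"
      unfolding UN_box_eq_UNIV by simp
    then show "h x = 0" using * by (auto simp: indicator_def)
  qed
qed

text \<open>Boxes form a generator of the Borel sets that is stable under intersection, so the integrals
  over all Borel subsets of a fixed box vanish.\<close>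
lemma AE_zero_of_box_integrals:
  fixes h :: "'a::euclidean_space \<Rightarrow> real"
  assumes I: "\<And>l r. integrable lborel (\<lambda>x. indicator (box l r) x * h x)"
    and Z: "\<And>l r. (LINT x|lborel. indicator (box l r) x * h x) = 0"
  shows "AE x in lborel. h x = 0"
proof -
  have "AE x in lborel. indicator (box (- real N *\<^sub>R One) (real N *\<^sub>R One)) x * h x = 0" for N
  proof -
    define B where "B = (box (- real N *\<^sub>R One) (real N *\<^sub>R One) :: 'a set)"
    define k where "k x = indicator B x * h x" for x
    have k: "integrable lborel k" unfolding k_def B_def by (rule I)
    have "(LINT x:A|lborel. k x) = 0" if "A \<in> sets borel" for A
    proof -
      have st: "Int_stable (range (\<lambda>(a, b). box a b :: 'a set))"
        by (auto simp: Int_stable_def box_Int_box)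
      have A: "A \<in> sigma_sets UNIV (range (\<lambda>(a, b). box a b :: 'a set))"
        using that unfolding borel_eq_box by simp
      have sub: "range (\<lambda>(a, b). box a b :: 'a set) \<subseteq> Pow UNIV" by simp
      have sb: "S \<in> sets borel" if "S \<in> sigma_sets UNIV (range (\<lambda>(a, b). box a b :: 'a set))" for S
        using that unfolding borel_eq_box by simp
      have si: "set_integrable lborel S k" if "S \<in> sets borel" for S
        unfolding set_integrable_def using integrable_mult_indicator[OF _ k, of S] that by simp
      have box0: "(LINT x:box l r|lborel. k x) = 0" for l r
      proof -
        have "indicator (box l r) x *\<^sub>R k x = indicator (box l r \<inter> B) x * h x" for x
          by (simp add: k_def indicator_inter_arith mult.assoc)
        moreover obtain l' r' where "box l r \<inter> B = box l' r'" unfolding B_def box_Int_box by blast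
        ultimately show ?thesis unfolding set_lebesgue_integral_def using Z[of l' r'] by simp
      qed
      have all0: "(LINT x|lborel. k x) = 0"
        unfolding k_def B_def by (rule Z)
      show ?thesis using st sub A
      proof (induct rule: sigma_sets_induct_disjoint)
        case (basic A)
        then show ?case using box0 by auto
      next
        case empty
        then show ?case by (simp add: set_lebesgue_integral_def)
      next
        case (compl A)
        have "(LINT x:UNIV - A|lborel. k x) = (LINT x|lborel. k x - indicator A x *\<^sub>R k x)"
          unfolding set_lebesgue_integral_def
          by (intro Bochner_Integration.integral_cong) (auto simp: indicator_def)
        also have "\<dots> = (LINT x|lborel. k x) - (LINT x:A|lborel. k x)"
          using si[OF sb[OF compl(1)]] k unfolding set_lebesgue_integral_def set_integrable_def
          by (intro Bochner_Integration.integral_diff)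
        finally show ?case using all0 compl by simp
      next
        case (union A)
        have "(LINT x:(\<Union>i. A i)|lborel. k x) = (\<Sum>i. LINT x:A i|lborel. k x)"
        proof (rule lebesgue_integral_countable_add)
          show "A i \<in> sets lborel" for i using union(2) sb by auto
          then show "set_integrable lborel (\<Union>i. A i) k" by (intro si) auto
          show "A i \<inter> A j = {}" if "i \<noteq> j" for i j
            using union(1) that by (auto simp: disjoint_family_on_def)
        qed
        then show ?case using union by simp
      qed
    qed
    then have "AE x in lborel. k x = 0"
      using density_unique_real[of lborel k "\<lambda>x. 0"] k by (simp add: set_lebesgue_integral_def)
    then show ?thesis by (simp add: k_def B_def)
  qed
  then show ?thesis by (rule AE_zero_of_AE_zero_on_boxes)
qed

text \<open>Testing the difference with smooth approximations of indicators shows that its integral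
  over every box vanishes. Local integrability makes only the restrictions to boxes measurable by
  definition, and so Borel versions are chosen box by box.\<close>
lemma weak_partial_unique:
  assumes a: "has_weak_partial j f a" and d: "has_weak_partial j f d"
  shows "AE x in lebesgue. a x = d x"
proof -
  have la: "locally_integrable a" and ld: "locally_integrable d" using a d by (auto simp: has_weak_partial_def)
  define h where "h x = a x - d x" for x
  have I: "integrable lebesgue (\<lambda>x. indicator (box l r) x * h x)" for l r
  proof -
    have "set_integrable lebesgue (cbox l r) a" "set_integrable lebesgue (cbox l r) d"
      using la ld by (auto simp: locally_integrable_def)
    then have "set_integrable lebesgue (box l r) a" "set_integrable lebesgue (box l r) d"
      using set_integrable_subset[of lebesgue "cbox l r" _ "box l r"] box_subset_cbox[of l r] by auto
    then have "set_integrable lebesgue (box l r) (\<lambda>x. a x - d x)" by (rule set_integral_diff)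
    then show ?thesis by (simp add: set_integrable_def h_def)
  qed
  have T: "(LINT x|lebesgue. h x * \<phi> x) = 0" if t: "test_function \<phi>" "csupp \<phi>" for \<phi>
  proof -
    have "(LINT x|lebesgue. a x * \<phi> x) = (LINT x|lebesgue. d x * \<phi> x)"
      using a d t by (simp add: has_weak_partial_def)
    moreover have c: "continuous_on UNIV \<phi>" using t by (auto simp: test_function_def intro: Ck_continuous)
    ultimately show ?thesis
      using loc_integrable_mult[OF la c t(2)] loc_integrable_mult[OF ld c t(2)]
      by (simp add: h_def left_diff_distrib)
  qed
  have Z: "(LINT x|lebesgue. indicator (box l r) x * h x) = 0" for l r
  proof (rule LIMSEQ_unique)
    have m: "(\<lambda>x. indicator (box l r) x * h x) \<in> borel_measurable lebesgue"
      using I by (rule borel_measurable_integrable)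
    have eq: "box_bump l r (real (Suc n)) x * h x = box_bump l r (real (Suc n)) x * (indicator (box l r) x * h x)" for n x
      using box_bump_outside[of "real (Suc n)" x l r] by (cases "x \<in> box l r") auto
    have bm: "box_bump l r c \<in> borel_measurable lebesgue" for c
      by (intro measurable_completion) (simp add: borel_measurable_continuous_onI[OF Ck_continuous[OF Ck_box_bump]])
    show "(\<lambda>n. LINT x|lebesgue. box_bump l r (real (Suc n)) x * h x) \<longlonglongrightarrow> (LINT x|lebesgue. indicator (box l r) x * h x)"
    proof (rule integral_dominated_convergence)
      show "integrable lebesgue (\<lambda>x. \<bar>indicator (box l r) x * h x\<bar>)" using I by (rule integrable_abs)
      show "(\<lambda>x. box_bump l r (real (Suc n)) x * h x) \<in> borel_measurable lebesgue" for n
        unfolding eq by (intro borel_measurable_times bm m)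
      show "AE x in lebesgue. (\<lambda>n. box_bump l r (real (Suc n)) x * h x) \<longlonglongrightarrow> indicator (box l r) x * h x"
        by (intro AE_I2 tendsto_mult box_bump_tendsto_indicator tendsto_const)
      show "AE x in lebesgue. norm (box_bump l r (real (Suc n)) x * h x) \<le> \<bar>indicator (box l r) x * h x\<bar>" for n
        unfolding eq using box_bump_bounds[of l r "real (Suc n)"]
        by (intro AE_I2) (simp add: abs_mult mult_left_le_one_le)
    qed fact
    show "(\<lambda>n. LINT x|lebesgue. box_bump l r (real (Suc n)) x * h x) \<longlonglongrightarrow> 0"
      using T[OF test_functionI[OF Ck_box_bump csupp_box_bump] csupp_box_bump]
      by (simp add: mult.commute del: of_nat_Suc)
  qed
  have "\<exists>h'. \<forall>N. h' N \<in> borel_measurable lborel \<and> (AE x in lborel. indicator (box (- real N *\<^sub>R One) (real N *\<^sub>R One)) x * h x = h' N x)"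
    by (intro choice allI) (use completion_ex_borel_measurable_real[OF borel_measurable_integrable[OF I]] in blast)
  then obtain h' where h': "\<And>N. h' N \<in> borel_measurable lborel"
     "\<And>N. AE x in lborel. indicator (box (- real N *\<^sub>R One) (real N *\<^sub>R One)) x * h x = h' N x" by blast
  have "AE x in lborel. h' N x = 0" for N
  proof (rule AE_zero_of_box_integrals)
    fix l r :: "real^2"
    obtain l' r' where lr: "box l r \<inter> box (- real N *\<^sub>R One) (real N *\<^sub>R One) = box l' r'" unfolding box_Int_box by blast
    have ae: "AE x in lebesgue. indicator (box l' r') x * h x = indicator (box l r) x * h' N x"
      using AE_completion[OF h'(2)[of N]] by eventually_elim (simp flip: lr add: indicator_inter_arith)
    have m[measurable]: "(\<lambda>x. indicator (box l r) x * h' N x) \<in> borel_measurable lborel"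
      using h'(1)[of N] by measurable
    have "integrable lebesgue (\<lambda>x. indicator (box l r) x * h' N x)"
      by (rule integrable_cong_AE_imp[OF I[of l' r']]) (use ae m in \<open>auto intro: measurable_completion\<close>)
    then show "integrable lborel (\<lambda>x. indicator (box l r) x * h' N x)"
      using integrable_completion[OF m] by simp
    have "(LINT x|lborel. indicator (box l r) x * h' N x) = (LINT x|lebesgue. indicator (box l r) x * h' N x)"
      using integral_completion[OF m] by simp
    also have "\<dots> = (LINT x|lebesgue. indicator (box l' r') x * h x)"
      by (rule integral_cong_AE) (use ae m borel_measurable_integrable[OF I[of l' r']] in \<open>auto intro: measurable_completion elim: eventually_mono\<close>)
    finally show "(LINT x|lborel. indicator (box l r) x * h' N x) = 0" using Z by simp
  qed
  then have "AE x in lborel. indicator (box (- real N *\<^sub>R One) (real N *\<^sub>R One)) x * h x = 0" for N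
  proof -
    assume "\<And>N. AE x in lborel. h' N x = 0"
    from h'(2)[of N] this[of N] show ?thesis by eventually_elim simp
  qed
  then have "AE x in lborel. h x = 0" by (rule AE_zero_of_AE_zero_on_boxes)
  then show ?thesis by (intro AE_completion) (simp add: h_def)
qed


subsection \<open>The mollifying kernel\<close>

definition unit_bump :: "real^2 \<Rightarrow> real" where
  "unit_bump = box_bump (\<chi> i. -1) (\<chi> i. 1) 1"

text \<open>The scaling by \<open>\<delta>\<^sup>2\<close> fits two space dimensions and keeps the integral equal to one.\<close>
definition moll :: "real \<Rightarrow> real^2 \<Rightarrow> real" where
  "moll \<delta> x = (1 / (\<delta>\<^sup>2 * (LINT y|lborel. unit_bump y))) * unit_bump ((1 / \<delta>) *\<^sub>R x)"

lemma unit_bump_continuous: "continuous_on UNIV unit_bump"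
  unfolding unit_bump_def by (rule Ck_continuous[OF Ck_box_bump])

lemma unit_bump_nonneg: "0 \<le> unit_bump x"
  by (simp add: unit_bump_def box_bump_bounds)

lemma unit_bump_outside: "2 < norm x \<Longrightarrow> unit_bump x = 0"
proof -
  assume n: "2 < norm x"
  have "x \<notin> box (\<chi> i. -1) (\<chi> i. 1)"
  proof
    assume "x \<in> box (\<chi> i. -1) (\<chi> i. 1)"
    then have "\<bar>x $ 1\<bar> < 1" "\<bar>x $ 2\<bar> < 1" by (auto simp: mem_box_cart abs_less_iff minus_less_iff)
    then show False using n norm_le_l1_cart[of x] by (simp add: sum_2)
  qed
  then show "unit_bump x = 0" unfolding unit_bump_def by (intro box_bump_outside) auto
qed

lemma csupp_unit_bump: "csupp unit_bump"
  using unit_bump_outside by (auto simp: csupp_def)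

lemma unit_bump_integral_pos: "0 < (LINT y|lborel. unit_bump y)"
proof -
  have p: "0 < unit_bump 0" by (simp add: unit_bump_def box_bump_def flat_def)
  have "isCont unit_bump 0" using unit_bump_continuous by (simp add: continuous_on_eq_continuous_at)
  then have "\<forall>e>0. \<exists>d>0. \<forall>x. norm x < d \<longrightarrow> \<bar>unit_bump x - unit_bump 0\<bar> < e"
    unfolding continuous_at_eps_delta by (simp add: dist_norm)
  then have "\<exists>d>0. \<forall>x. norm x < d \<longrightarrow> \<bar>unit_bump x - unit_bump 0\<bar> < unit_bump 0 / 2"
    using p half_gt_zero by blast
  then obtain d where d: "0 < d" "\<And>x. norm x < d \<Longrightarrow> \<bar>unit_bump x - unit_bump 0\<bar> < unit_bump 0 / 2"
    by blast
  have "0 < (LINT y|lborel. (unit_bump 0 / 2) * indicator (ball (0::real^2) d) y)"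
    using p d(1) content_ball_pos[of d "0::real^2"] by simp
  also have "\<dots> \<le> (LINT y|lborel. unit_bump y)"
  proof (rule integral_mono)
    show "integrable lborel (\<lambda>y. (unit_bump 0 / 2) * indicator (ball (0::real^2) d) y)"
      using emeasure_lborel_ball_finite[of "0::real^2" d]
      by (intro integrable_mult_right integrable_real_indicator) auto
    show "integrable lborel unit_bump" by (intro csupp_integrable unit_bump_continuous csupp_unit_bump)
    show "(unit_bump 0 / 2) * indicator (ball 0 d) y \<le> unit_bump y" for y
    proof (cases "norm y < d")
      case True
      have "unit_bump 0 / 2 \<le> unit_bump y" using d(2)[OF True] by arith
      then show ?thesis using True by simp
    next
      case False
      then show ?thesis using unit_bump_nonneg[of y] by simp
    qed
  qed
  finally show ?thesis .
qed

lemma Ck_moll: "Ck k (moll \<delta>)"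
proof -
  have "Ck k (\<lambda>x. (1 / (\<delta>\<^sup>2 * (LINT y|lborel. unit_bump y))) * unit_bump (0 + (1 / \<delta>) *\<^sub>R x))"
    unfolding unit_bump_def by (intro Ck_scale Ck_affine Ck_box_bump)
  then show ?thesis by (simp add: moll_def[abs_def])
qed

lemma C1_moll: "C1 (moll \<delta>)"
  using Ck_moll[of 1] by (simp only: Ck_1_iff)

lemma C1_pd_moll: "C1 (pd j (moll \<delta>))"
  using Ck_moll[of "Suc 1" \<delta>] unfolding Ck_Suc_iff[of 1] Ck_1_iff by blast

lemma moll_nonneg: "0 \<le> moll \<delta> x"
  using unit_bump_integral_pos by (auto simp: moll_def unit_bump_nonneg intro!: divide_nonneg_nonneg)

lemma moll_even: "moll \<delta> (- x) = moll \<delta> x"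
  by (simp add: moll_def unit_bump_def box_bump_def mult_ac add.commute)

lemma moll_outside: "0 < \<delta> \<Longrightarrow> 2 * \<delta> < norm x \<Longrightarrow> moll \<delta> x = 0"
  by (simp add: moll_def unit_bump_outside field_simps)

lemma csupp_moll: "0 < \<delta> \<Longrightarrow> csupp (moll \<delta>)"
  using moll_outside by (auto simp: csupp_def)

lemma moll_scaling: "moll \<delta> x = (1 / \<delta>\<^sup>2) * moll 1 (0 + (1 / \<delta>) *\<^sub>R x)"
  by (simp add: moll_def)

lemma pd_moll_scaling: "pd j (moll \<delta>) x = (1 / \<delta>^3) * pd j (moll 1) ((1 / \<delta>) *\<^sub>R x)"
proof -
  have "moll \<delta> = (\<lambda>x. (1 / \<delta>\<^sup>2) * moll 1 (0 + (1 / \<delta>) *\<^sub>R x))" using moll_scaling by blast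
  then have "pd j (moll \<delta>) = pd j (\<lambda>x. (1 / \<delta>\<^sup>2) * moll 1 (0 + (1 / \<delta>) *\<^sub>R x))" by simp
  also have "\<dots> = (\<lambda>x. (1 / \<delta>\<^sup>2) * ((1 / \<delta>) * pd j (moll 1) (0 + (1 / \<delta>) *\<^sub>R x)))"
    by (simp only: pd_scale[OF C1_affine[OF C1_moll]] pd_affine[OF C1_moll])
  finally show ?thesis by (simp add: power3_eq_cube power2_eq_square)
qed

lemma moll_measurable [measurable]: "moll \<delta> \<in> borel_measurable borel" "pd j (moll \<delta>) \<in> borel_measurable borel"
  using C1_moll by measurable

lemma integrable_moll: "0 < \<delta> \<Longrightarrow> integrable lborel (moll \<delta>)"
  by (intro csupp_integrable C1_continuous C1_moll csupp_moll)

lemma integral_moll: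
  assumes "0 < \<delta>" shows "(LINT x|lborel. moll \<delta> x) = 1"
proof -
  have "(LINT x|lborel. moll \<delta> x) = \<bar>\<delta>\<bar> ^ DIM(real^2) * (LINT x|lborel. moll \<delta> (0 + \<delta> *\<^sub>R x))"
    by (rule integral_affine) (use assms in auto)
  also have "\<dots> = 1" using assms unit_bump_integral_pos by (simp add: moll_def)
  finally show ?thesis .
qed

text \<open>The first moment of a derivative of the kernel is the same at every scale: the factor lost by
  the derivative is regained from the size of the support. This is the reason why commutators stay
  bounded.\<close>
definition moll_moment :: "2 \<Rightarrow> real" where
  "moll_moment j = (LINT z|lborel. norm z * \<bar>pd j (moll 1) z\<bar>)"

lemma moll_moment_nonneg: "0 \<le> moll_moment j"
  by (simp add: moll_moment_def)

lemma pd_moll_moment: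
  assumes "0 < \<delta>" shows "(LINT z|lborel. norm z * \<bar>pd j (moll \<delta>) z\<bar>) = moll_moment j"
proof -
  have "(LINT z|lborel. norm z * \<bar>pd j (moll \<delta>) z\<bar>)
     = \<bar>\<delta>\<bar> ^ DIM(real^2) * (LINT z|lborel. norm (0 + \<delta> *\<^sub>R z) * \<bar>pd j (moll \<delta>) (0 + \<delta> *\<^sub>R z)\<bar>)"
    by (rule integral_affine) (use assms in auto)
  also have "(\<lambda>z. norm (0 + \<delta> *\<^sub>R z) * \<bar>pd j (moll \<delta>) (0 + \<delta> *\<^sub>R z)\<bar>) = (\<lambda>z. (1 / \<delta>\<^sup>2) * (norm z * \<bar>pd j (moll 1) z\<bar>))"
    using assms by (subst pd_moll_scaling) (simp add: fun_eq_iff abs_mult power3_eq_cube power2_eq_square)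
  finally show ?thesis using assms by (simp add: moll_moment_def)
qed

lemma moll_first_moment:
  assumes "0 < \<delta>" shows "(LINT z|lborel. norm z * \<bar>moll \<delta> z\<bar>) \<le> 2 * \<delta>"
proof -
  have "(LINT z|lborel. norm z * \<bar>moll \<delta> z\<bar>) \<le> (LINT z|lborel. 2 * \<delta> * moll \<delta> z)"
  proof (rule integral_mono)
    show "integrable lborel (\<lambda>z. norm z * \<bar>moll \<delta> z\<bar>)"
    proof (rule csupp_integrable)
      show "continuous_on UNIV (\<lambda>z. norm z * \<bar>moll \<delta> z\<bar>)"
        by (intro continuous_intros C1_continuous C1_moll)
      show "csupp (\<lambda>z. norm z * \<bar>moll \<delta> z\<bar>)"
        using csupp_moll[OF assms] by (auto simp: csupp_def)
    qed
    show "integrable lborel (\<lambda>z. 2 * \<delta> * moll \<delta> z)" using integrable_moll[OF assms] by simp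
    show "norm z * \<bar>moll \<delta> z\<bar> \<le> 2 * \<delta> * moll \<delta> z" for z
      using moll_outside[OF assms, of z] moll_nonneg[of \<delta> z]
      by (cases "norm z \<le> 2 * \<delta>") (auto intro: mult_right_mono)
  qed
  then show ?thesis using integral_moll[OF assms] by simp
qed

section \<open>Averages, convolutions and translations in L2\<close>

lemma norm2_bounded_support:
  fixes f :: "'a::euclidean_space \<Rightarrow> real"
  assumes [measurable]: "f \<in> borel_measurable borel" and "0 \<le> e"
    and "\<And>x. \<bar>f x\<bar> \<le> e * indicator (cball 0 R) x"
  shows "L2 f" "norm2 f \<le> e * sqrt (measure lborel (cball 0 R :: 'a set))"
proof -
  let ?i = "indicator (cball 0 R) :: 'a \<Rightarrow> real"
  have sq: "(?i x)\<^sup>2 = ?i x" for x by (simp add: indicator_def)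
  have i: "L2 ?i"
    unfolding L2_def sq using emeasure_lborel_cball_finite[of "0::'a" R]
    by (intro conjI integrable_real_indicator borel_measurable_indicator) auto
  have le: "\<bar>f x\<bar> \<le> e * \<bar>?i x\<bar>" for x using assms(3)[of x] by simp
  show "L2 f" by (rule L2_bound[OF i assms(1) le])
  have "norm2 f \<le> e * norm2 ?i" by (rule norm2_mono[OF i assms(1) le assms(2)])
  also have "norm2 ?i = sqrt (measure lborel (cball 0 R :: 'a set))"
    by (simp add: norm2_def ip2_def flip: power2_eq_square) (simp add: sq)
  finally show "norm2 f \<le> e * sqrt (measure lborel (cball 0 R :: 'a set))" .
qed

text \<open>Minkowski's integral inequality for averages, from the Cauchy-Schwarz inequality with the
  weight split into two square roots, followed by Tonelli's theorem.\<close>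
lemma norm2_weighted_average:
  fixes F :: "'a::euclidean_space \<Rightarrow> 'b::euclidean_space \<Rightarrow> real"
  assumes [measurable]: "(\<lambda>p. F (fst p) (snd p)) \<in> borel_measurable (borel \<Otimes>\<^sub>M borel)"
    and K: "integrable lborel K" "\<And>t. 0 \<le> K t" "(LINT t|lborel. K t) = 1"
    and F: "\<And>t. K t \<noteq> 0 \<Longrightarrow> L2 (\<lambda>x. F x t)" "\<And>t. K t \<noteq> 0 \<Longrightarrow> norm2 (\<lambda>x. F x t) \<le> C"
    and C: "0 \<le> C"
  shows "L2 (\<lambda>x. LINT t|lborel. K t * F x t)" "norm2 (\<lambda>x. LINT t|lborel. K t * F x t) \<le> C"
proof -
  have [measurable]: "K \<in> borel_measurable borel" using borel_measurable_integrable[OF K(1)] by simp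
  define G where "G x = (LINT t|lborel. K t * F x t)" for x
  have Gm[measurable]: "G \<in> borel_measurable borel" unfolding G_def by measurable
  have pt: "ennreal ((G x)\<^sup>2) \<le> (\<integral>\<^sup>+t. ennreal (K t * (F x t)\<^sup>2) \<partial>lborel)" for x
  proof (cases "(\<integral>\<^sup>+t. ennreal (K t * (F x t)\<^sup>2) \<partial>lborel) = \<infinity>")
    case True
    then show ?thesis by simp
  next
    case False
    have "(\<lambda>t. (x, t)) \<in> borel \<rightarrow>\<^sub>M (borel \<Otimes>\<^sub>M borel)" by measurable
    from measurable_compose[OF this assms(1)] have [measurable]: "F x \<in> borel_measurable borel" by simp
    have i: "integrable lborel (\<lambda>t. K t * (F x t)\<^sup>2)"
      by (rule integrableI_nonneg) (use False K(2) in \<open>auto simp: less_top\<close>)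
    have 1: "L2 (\<lambda>t. sqrt (K t))" using K by (simp add: L2_def)
    have 2: "L2 (\<lambda>t. sqrt (K t) * F x t)"
      using i K(2) by (simp add: L2_def power_mult_distrib)
    have "G x = ip2 (\<lambda>t. sqrt (K t)) (\<lambda>t. sqrt (K t) * F x t)"
      unfolding G_def ip2_def using K(2) by (simp flip: mult.assoc)
    then have "\<bar>G x\<bar> \<le> norm2 (\<lambda>t. sqrt (K t)) * norm2 (\<lambda>t. sqrt (K t) * F x t)"
      using Cauchy_Schwarz_L2[OF 1 2] by simp
    also have "norm2 (\<lambda>t. sqrt (K t)) = 1"
      unfolding norm2_def ip2_def using K by simp
    finally have "\<bar>G x\<bar>\<^sup>2 \<le> (norm2 (\<lambda>t. sqrt (K t) * F x t))\<^sup>2"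
      by (intro power_mono) auto
    also have "\<dots> = (LINT t|lborel. K t * (F x t)\<^sup>2)"
      unfolding norm2_sq_integral using K(2) by (simp add: power_mult_distrib)
    finally have "ennreal ((G x)\<^sup>2) \<le> ennreal (LINT t|lborel. K t * (F x t)\<^sup>2)" by (simp add: ennreal_leI)
    then show ?thesis using nn_integral_eq_integral[OF i] K(2) by simp
  qed
  have "(\<integral>\<^sup>+x. ennreal ((G x)\<^sup>2) \<partial>lborel) \<le> (\<integral>\<^sup>+x. \<integral>\<^sup>+t. ennreal (K t * (F x t)\<^sup>2) \<partial>lborel \<partial>lborel)"
    by (intro nn_integral_mono pt)
  also have "\<dots> = (\<integral>\<^sup>+t. \<integral>\<^sup>+x. ennreal (K t * (F x t)\<^sup>2) \<partial>lborel \<partial>lborel)"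
    by (rule lborel_pair.Fubini'[symmetric]) measurable
  also have "\<dots> \<le> (\<integral>\<^sup>+t. ennreal (K t * C\<^sup>2) \<partial>lborel)"
  proof (rule nn_integral_mono)
    fix t
    show "(\<integral>\<^sup>+x. ennreal (K t * (F x t)\<^sup>2) \<partial>lborel) \<le> ennreal (K t * C\<^sup>2)"
    proof (cases "K t = 0")
      case False
      have [measurable]: "(\<lambda>x. F x t) \<in> borel_measurable borel" using F(1)[OF False] by (simp add: L2_def)
      have "(\<integral>\<^sup>+x. ennreal (K t * (F x t)\<^sup>2) \<partial>lborel) = ennreal (K t) * ennreal ((norm2 (\<lambda>x. F x t))\<^sup>2)"
        using K(2) nn_integral_norm2[OF F(1)[OF False]] by (simp add: ennreal_mult nn_integral_cmult)
      also have "\<dots> \<le> ennreal (K t) * ennreal (C\<^sup>2)"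
        using F(2)[OF False] by (intro mult_left_mono ennreal_leI power_mono) auto
      finally show ?thesis using K(2) by (simp add: ennreal_mult)
    qed simp
  qed
  also have "\<dots> = ennreal (LINT t|lborel. K t * C\<^sup>2)"
    using K by (intro nn_integral_eq_integral) auto
  also have "\<dots> = ennreal (C\<^sup>2)" using K(3) by simp
  finally have "(\<integral>\<^sup>+x. ennreal ((G x)\<^sup>2) \<partial>lborel) \<le> ennreal (C\<^sup>2)" .
  from L2_norm2_of_nn_integral[OF Gm this C]
  show "L2 (\<lambda>x. LINT t|lborel. K t * F x t)" "norm2 (\<lambda>x. LINT t|lborel. K t * F x t) \<le> C"
    unfolding G_def by auto
qed

lemma L2_reflect:
  assumes "L2 h" shows "L2 (\<lambda>y. h (x - y))" "norm2 (\<lambda>y. h (x - y)) = norm2 h"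
proof -
  have [measurable]: "h \<in> borel_measurable borel" using assms by (simp add: L2_def)
  show "L2 (\<lambda>y. h (x - y))"
    using integrable_affine[OF L2_sq_integrable[OF assms], of "-1" x] by (simp add: L2_def)
  have "(norm2 (\<lambda>y. h (x - y)))\<^sup>2 = (norm2 h)\<^sup>2"
    using integral_affine[of "\<lambda>y. (h y)\<^sup>2" "-1" x] by (simp add: norm2_sq_integral)
  then show "norm2 (\<lambda>y. h (x - y)) = norm2 h" by simp
qed

definition conv :: "('a::euclidean_space \<Rightarrow> real) \<Rightarrow> ('a \<Rightarrow> real) \<Rightarrow> 'a \<Rightarrow> real" where
  "conv h \<kappa> x = (LINT y|lborel. h y * \<kappa> (x - y))"

lemma conv_ip2: "conv h \<kappa> x = ip2 h (\<lambda>y. \<kappa> (x - y))"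
  by (simp add: conv_def ip2_def)

lemma conv_commute:
  assumes [measurable]: "h \<in> borel_measurable borel" "\<kappa> \<in> borel_measurable borel"
  shows "conv h \<kappa> x = (LINT z|lborel. \<kappa> z * h (x - z))"
  unfolding conv_def using integral_affine[of "\<lambda>y. h y * \<kappa> (x - y)" "-1" x]
  by (simp add: mult.commute)

lemma conv_bound:
  assumes "L2 h" "L2 \<kappa>" shows "\<bar>conv h \<kappa> x\<bar> \<le> norm2 h * norm2 \<kappa>"
  using Cauchy_Schwarz_L2[OF assms(1) L2_reflect(1)[OF assms(2)]] L2_reflect(2)[OF assms(2)]
  by (simp add: conv_ip2)

text \<open>The increments of the kernel are small in the supremum norm on a fixed ball, hence small in
  \<open>L\<^sup>2\<close>; they are paired with \<open>h\<close>.\<close>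
lemma conv_continuous:
  fixes h :: "'a::euclidean_space \<Rightarrow> real"
  assumes h: "L2 h" and k: "continuous_on UNIV \<kappa>" "csupp \<kappa>"
  shows "continuous_on UNIV (conv h \<kappa>)"
proof -
  obtain R where R: "\<And>x. R < norm x \<Longrightarrow> \<kappa> x = 0" using k by (auto simp: csupp_def)
  have [measurable]: "\<kappa> \<in> borel_measurable borel" by (rule borel_measurable_continuous_onI[OF k(1)])
  define V where "V = sqrt (measure lborel (cball 0 (R + 1) :: 'a set))"
  have V: "0 \<le> V" by (simp add: V_def)
  note kL = csupp_L2[OF k]
  have "isCont (conv h \<kappa>) x" for x
    unfolding continuous_at_eps_delta
  proof (intro allI impI)
    fix \<epsilon> :: real assume e: "0 < \<epsilon>"
    \<comment> \<open>The added one avoids a division by zero when the first factor vanishes.\<close>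
    define e where "e = \<epsilon> / (norm2 h * V + 1)"
    have nV: "0 \<le> norm2 h * V" using V by simp
    have e0: "0 < e" using e nV by (simp add: e_def add_nonneg_pos)
    obtain d where d: "0 < d" "\<And>x v. norm v < d \<Longrightarrow> \<bar>\<kappa> (x + v) - \<kappa> x\<bar> < e"
      using csupp_uniformly_continuous[OF k e0] by blast
    show "\<exists>d>0. \<forall>x'. dist x' x < d \<longrightarrow> dist (conv h \<kappa> x') (conv h \<kappa> x) < \<epsilon>"
    proof (intro exI[of _ "min d 1"] conjI allI impI)
      fix x' assume x': "dist x' x < min d 1"
      define v where "v = x' - x"
      have v: "norm v < d" "norm v < 1" using x' by (auto simp: v_def dist_norm)
      define F where "F w = \<kappa> (w + v) - \<kappa> w" for w
      have F: "\<bar>F w\<bar> \<le> e * indicator (cball 0 (R + 1)) w" for w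
      proof (cases "norm w \<le> R + 1")
        case True
        then show ?thesis using d(2)[OF v(1), of w] by (simp add: F_def)
      next
        case False
        have "norm w \<le> norm (w + v) + norm v" using norm_triangle_ineq4[of "w + v" v] by simp
        then show ?thesis using False R[of w] R[of "w + v"] v by (simp add: F_def)
      qed
      have Fm: "F \<in> borel_measurable borel" unfolding F_def by measurable
      note FL = norm2_bounded_support[OF Fm _ F, folded V_def]
      have "conv h \<kappa> x' - conv h \<kappa> x = ip2 h (\<lambda>y. F (x - y))"
        unfolding conv_ip2 F_def v_def
        using ip2_diff_right[OF L2_reflect(1)[OF kL] L2_reflect(1)[OF kL] h, of x' x] by (simp add: algebra_simps)
      also have "\<bar>ip2 h (\<lambda>y. F (x - y))\<bar> \<le> norm2 h * norm2 F"
        using conv_bound[OF h FL(1)] e0 by (simp add: conv_ip2)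
      also have "\<dots> \<le> norm2 h * (e * V)" using FL(2) e0 by (intro mult_left_mono) auto
      also have "\<dots> < e * (norm2 h * V + 1)" using e0 by (simp add: algebra_simps)
      also have "\<dots> = \<epsilon>" using nV by (simp add: e_def add_nonneg_eq_0_iff)
      finally show "dist (conv h \<kappa> x') (conv h \<kappa> x) < \<epsilon>" by (simp add: dist_real_def)
    qed (use d in auto)
  qed
  then show ?thesis by (simp add: continuous_at_imp_continuous_on)
qed

text \<open>As for continuity, but with the Taylor errors of the kernel in place of its increments.\<close>
lemma
  assumes h: "L2 h" and k: "C1 \<kappa>" "csupp \<kappa>"
  shows C1_conv: "C1 (conv h \<kappa>)" and pd_conv: "pd j (conv h \<kappa>) = conv h (pd j \<kappa>)"
proof -
  obtain R where R: "\<And>x. R < norm x \<Longrightarrow> \<kappa> x = 0" using k by (auto simp: csupp_def)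
  have "\<exists>R. \<forall>x. R < norm x \<longrightarrow> pd j \<kappa> x = 0" for j using csupp_pd[OF k(2)] by (auto simp: csupp_def)
  then obtain S where S: "\<And>j x. S j < norm x \<Longrightarrow> pd j \<kappa> x = 0" by metis
  define T where "T = max R (Max (range S))"
  have T: "R \<le> T" "S j \<le> T" for j by (auto simp: T_def le_max_iff_disj)
  have [measurable]: "\<kappa> \<in> borel_measurable borel" "pd j \<kappa> \<in> borel_measurable borel" for j
    using k(1) by measurable
  define V where "V = sqrt (measure lborel (cball 0 (T + 1) :: (real^2) set))"
  have V: "0 \<le> V" by (simp add: V_def)
  note kL = csupp_L2[OF C1_continuous[OF k(1)] k(2)]
  note pL = csupp_L2[OF C1_continuous_pd[OF k(1)] csupp_pd[OF k(2)]]
  have cont: "continuous_on UNIV (conv h (pd j \<kappa>))" for j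
    by (intro conv_continuous h C1_continuous_pd csupp_pd k)
  have "(conv h \<kappa> has_derivative (\<lambda>v. \<Sum>j\<in>UNIV. v $ j * conv h (pd j \<kappa>) x)) (at x)" for x
    unfolding has_derivative_at_alt
  proof (intro conjI allI impI)
    show "bounded_linear (\<lambda>v::real^2. \<Sum>j\<in>UNIV. v $ j * conv h (pd j \<kappa>) x)"
      by (intro bounded_linear_sum bounded_linear_mult_const bounded_linear_vec_nth)
    fix \<epsilon> :: real assume e: "0 < \<epsilon>"
    define e where "e = \<epsilon> / (norm2 h * V + 1)"
    have nV: "0 \<le> norm2 h * V" using V by simp
    have e0: "0 < e" using e nV by (simp add: e_def add_nonneg_pos)
    obtain d where d: "0 < d" "\<And>x v. norm v < d \<Longrightarrow> \<bar>\<kappa> (x + v) - \<kappa> x - (\<Sum>j\<in>UNIV. v $ j * pd j \<kappa> x)\<bar> \<le> e * norm v"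
      using C1_uniform_linearization[OF k e0] by blast
    show "\<exists>d>0. \<forall>y. norm (y - x) < d \<longrightarrow>
        norm (conv h \<kappa> y - conv h \<kappa> x - (\<Sum>j\<in>UNIV. (y - x) $ j * conv h (pd j \<kappa>) x)) \<le> \<epsilon> * norm (y - x)"
    proof (intro exI[of _ "min d 1"] conjI allI impI)
      fix x' :: "real^2" assume x': "norm (x' - x) < min d 1"
      define v where "v = x' - x"
      have v: "norm v < d" "norm v < 1" using x' by (auto simp: v_def)
      define F where "F w = \<kappa> (w + v) - \<kappa> w - (\<Sum>j\<in>UNIV. v $ j * pd j \<kappa> w)" for w
      have F: "\<bar>F w\<bar> \<le> (e * norm v) * indicator (cball 0 (T + 1)) w" for w
      proof (cases "norm w \<le> T + 1")
        case True
        then show ?thesis using d(2)[OF v(1), of w] by (simp add: F_def)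
      next
        case False
        have "norm w \<le> norm (w + v) + norm v" using norm_triangle_ineq4[of "w + v" v] by simp
        then have TT: "T < norm w" "T < norm (w + v)" using False v by auto
        have "R < norm w" "R < norm (w + v)" "S j < norm w" for j
          using le_less_trans[OF T(1) TT(1)] le_less_trans[OF T(1) TT(2)] le_less_trans[OF T(2) TT(1)] by auto
        then show ?thesis using R S False by (simp add: F_def)
      qed
      have Fm: "F \<in> borel_measurable borel" unfolding F_def by measurable
      note FL = norm2_bounded_support[OF Fm _ F, folded V_def]
      have "ip2 h (\<lambda>y. F (x - y)) = ip2 h (\<lambda>y. \<kappa> (x' - y)) - ip2 h (\<lambda>y. \<kappa> (x - y))
          - (v $ 1 * ip2 h (\<lambda>y. pd 1 \<kappa> (x - y)) + v $ 2 * ip2 h (\<lambda>y. pd 2 \<kappa> (x - y)))"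
      proof -
        have "(\<lambda>y. F (x - y)) = (\<lambda>y. (\<kappa> (x' - y) - \<kappa> (x - y)) - (v $ 1 * pd 1 \<kappa> (x - y) + v $ 2 * pd 2 \<kappa> (x - y)))"
          by (simp add: F_def v_def fun_eq_iff sum_2 algebra_simps)
        then show ?thesis
          using L2_reflect(1)[OF kL] L2_reflect(1)[OF pL] h
          by (simp add: ip2_diff_right ip2_add_right ip2_scale_right L2_diff L2_add L2_scale)
      qed
      then have "conv h \<kappa> x' - conv h \<kappa> x - (\<Sum>j\<in>UNIV. v $ j * conv h (pd j \<kappa>) x) = ip2 h (\<lambda>y. F (x - y))"
        by (simp add: conv_ip2 sum_2)
      also have "\<bar>ip2 h (\<lambda>y. F (x - y))\<bar> \<le> norm2 h * norm2 F"
        using conv_bound[OF h FL(1)] e0 by (simp add: conv_ip2)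
      also have "\<dots> \<le> norm2 h * ((e * norm v) * V)" using FL(2) e0 by (intro mult_left_mono) auto
      also have "\<dots> \<le> (e * (norm2 h * V + 1)) * norm v" using e0 by (simp add: algebra_simps)
      also have "\<dots> = \<epsilon> * norm v" using nV by (simp add: e_def add_nonneg_eq_0_iff)
      finally show "norm (conv h \<kappa> x' - conv h \<kappa> x - (\<Sum>j\<in>UNIV. (x' - x) $ j * conv h (pd j \<kappa>) x)) \<le> \<epsilon> * norm (x' - x)"
        by (simp add: v_def)
    qed (use d in auto)
  qed
  from C1_of_derivative[of "conv h \<kappa>" "\<lambda>j. conv h (pd j \<kappa>)", OF this cont]
  show "C1 (conv h \<kappa>)" "pd j (conv h \<kappa>) = conv h (pd j \<kappa>)" by blast+
qed

lemma conv_diff: "L2 f \<Longrightarrow> L2 g \<Longrightarrow> L2 \<kappa> \<Longrightarrow> conv (\<lambda>x. f x - g x) \<kappa> x = conv f \<kappa> x - conv g \<kappa> x"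
  by (simp add: conv_ip2 ip2_diff L2_reflect)

lemma moll_L2: "0 < \<delta> \<Longrightarrow> L2 (moll \<delta>)"
  by (intro csupp_L2 C1_continuous csupp_moll C1_moll)

lemma norm2_conv_moll:
  assumes h: "L2 h" and d: "0 < \<delta>"
  shows "L2 (conv h (moll \<delta>))" "norm2 (conv h (moll \<delta>)) \<le> norm2 h"
proof -
  have [measurable]: "h \<in> borel_measurable borel" using h by (simp add: L2_def)
  have eq: "conv h (moll \<delta>) = (\<lambda>x. LINT z|lborel. moll \<delta> z * h (x - z))"
    by (intro ext conv_commute) measurable
  show "L2 (conv h (moll \<delta>))" "norm2 (conv h (moll \<delta>)) \<le> norm2 h"
    unfolding eq
    by (rule norm2_weighted_average[where C="norm2 h"];
        use d in \<open>simp add: integrable_moll integral_moll moll_nonneg L2_shift[OF h]\<close>)+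
qed

text \<open>A quantitative substitute for a weak gradient in \<open>L\<^sup>2\<close> of norm \<open>L\<close>; it is an inequality between
  norms of differences and hence passes to weak limits.\<close>
definition trans_bound :: "real \<Rightarrow> (real^2 \<Rightarrow> real) \<Rightarrow> bool" where
  "trans_bound L h \<longleftrightarrow> (\<forall>z. norm2 (\<lambda>x. h (x - z) - h x) \<le> L * norm z)"

lemma norm2_conv_moll_diff:
  assumes h: "L2 h" and d: "0 < \<delta>" and t: "trans_bound L h" and L: "0 \<le> L"
  shows "norm2 (\<lambda>x. conv h (moll \<delta>) x - h x) \<le> 2 * L * \<delta>"
proof -
  have [measurable]: "h \<in> borel_measurable borel" using h by (simp add: L2_def)
  have eq: "conv h (moll \<delta>) x - h x = (LINT z|lborel. moll \<delta> z * (h (x - z) - h x))" for x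
  proof -
    have "(LINT z|lborel. moll \<delta> z * (h (x - z) - h x)) = (LINT z|lborel. moll \<delta> z * h (x - z)) - (LINT z|lborel. moll \<delta> z * h x)"
      using L2_mult_integrable[OF moll_L2[OF d] L2_reflect(1)[OF h, of x]] integrable_moll[OF d]
      by (simp add: right_diff_distrib)
    then show ?thesis using conv_commute[of h "moll \<delta>" x] integral_moll[OF d] by simp
  qed
  show ?thesis unfolding eq
  proof (rule norm2_weighted_average)
    fix z assume "moll \<delta> z \<noteq> 0"
    then have "norm z \<le> 2 * \<delta>" using moll_outside[OF d, of z] by (meson not_le)
    then have "L * norm z \<le> L * (2 * \<delta>)" using L by (intro mult_left_mono)
    then show "norm2 (\<lambda>x. h (x - z) - h x) \<le> 2 * L * \<delta>" using t by (auto simp: trans_bound_def intro: order_trans)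
  qed (use d L in \<open>simp_all add: integrable_moll integral_moll moll_nonneg L2_shift[OF h] L2_diff h\<close>)
qed

text \<open>The increment is the average over the segment of the derivative in its direction.\<close>
lemma trans_bound_C1:
  assumes h: "C1 h" "L2 h" and p: "\<And>j. L2 (pd j h)"
  shows "trans_bound (\<Sum>j\<in>UNIV. norm2 (pd j h)) h"
  unfolding trans_bound_def
proof
  fix z :: "real^2"
  define F where "F x t = (\<Sum>j\<in>UNIV. (- z) $ j * pd j h (x + t *\<^sub>R (- z)))" for x and t :: real
  have [measurable]: "pd j h \<in> borel_measurable borel" for j using h by measurable
  have eq: "h (x - z) - h x = (LINT t|lborel. indicator {0..1} t * F x t)" for x
  proof -
    have d: "DERIV (\<lambda>t. h (x + t *\<^sub>R (- z))) t :> F x t" for t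
    proof -
      have "((\<lambda>t. x + t *\<^sub>R (- z)) has_derivative (\<lambda>s. s *\<^sub>R (- z))) (at t)"
        by (auto intro!: derivative_eq_intros)
      from diff_chain_at[OF this C1_has_derivative[OF h(1)]]
      have "((\<lambda>t. h (x + t *\<^sub>R (- z))) has_derivative (\<lambda>s. \<Sum>j\<in>UNIV. (s *\<^sub>R (- z)) $ j * pd j h (x + t *\<^sub>R (- z)))) (at t)"
        by (simp add: o_def)
      moreover have "(\<lambda>s. \<Sum>j\<in>UNIV. (s *\<^sub>R (- z)) $ j * pd j h (x + t *\<^sub>R (- z))) = (*) (F x t)"
        by (auto simp: fun_eq_iff F_def sum_distrib_left sum_distrib_right mult_ac)
      ultimately show ?thesis by (simp only: has_field_derivative_def)
    qed
    have c: "isCont (F x) t" for t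
    proof -
      have "continuous_on UNIV (F x)" unfolding F_def
        by (intro continuous_intros continuous_on_compose2[OF C1_continuous_pd[OF h(1)]]) auto
      then show ?thesis by (simp add: continuous_on_eq_continuous_at)
    qed
    have "(LINT t|lborel. F x t * indicator {0..1} t) = h (x + 1 *\<^sub>R (- z)) - h (x + 0 *\<^sub>R (- z))"
      by (rule integral_FTC_Icc_real) (use d c in auto)
    then show ?thesis by (simp add: mult.commute)
  qed
  have sh: "L2 (\<lambda>x. pd j h (x + w))" "norm2 (\<lambda>x. pd j h (x + w)) = norm2 (pd j h)" for j w
    using L2_shift[OF p, of j "- w"] by simp_all
  have FL: "L2 (\<lambda>x. F x t)" for t
    unfolding F_def by (intro L2_sum L2_scale sh)
  have Fn: "norm2 (\<lambda>x. F x t) \<le> (\<Sum>j\<in>UNIV. norm2 (pd j h)) * norm z" for t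
  proof -
    have "norm2 (\<lambda>x. F x t) \<le> norm2 (\<lambda>x. (- z) $ 1 * pd 1 h (x + t *\<^sub>R (- z))) + norm2 (\<lambda>x. (- z) $ 2 * pd 2 h (x + t *\<^sub>R (- z)))"
      unfolding F_def sum_2 by (intro norm2_triangle L2_scale sh)
    also have "\<dots> = \<bar>z $ 1\<bar> * norm2 (pd 1 h) + \<bar>z $ 2\<bar> * norm2 (pd 2 h)"
      unfolding norm2_scale sh by simp
    also have "\<dots> \<le> norm z * norm2 (pd 1 h) + norm z * norm2 (pd 2 h)"
      by (intro add_mono mult_right_mono component_le_norm_cart norm2_nonneg)
    finally show ?thesis by (simp add: sum_2 algebra_simps)
  qed
  show "norm2 (\<lambda>x. h (x - z) - h x) \<le> (\<Sum>j\<in>UNIV. norm2 (pd j h)) * norm z"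
    unfolding eq
  proof (rule norm2_weighted_average(2))
    show "(\<lambda>p. F (fst p) (snd p)) \<in> borel_measurable (borel \<Otimes>\<^sub>M borel)"
      unfolding F_def by measurable
    show "0 \<le> (\<Sum>j\<in>UNIV. norm2 (pd j h)) * norm z" by (intro mult_nonneg_nonneg sum_nonneg) auto
  qed (use FL Fn in auto)
qed

section \<open>Weak limits\<close>

lemma weak_L2_norm_le:
  assumes "weak_L2 h H" "\<And>n. L2 (h n)" "L2 H" "\<And>n. norm2 (h n) \<le> B"
  shows "norm2 H \<le> B"
proof -
  have "ip2 H H \<le> B * norm2 H"
  proof (rule LIMSEQ_le_const2[OF weak_L2_D[OF assms(1,3)]], intro exI allI impI)
    fix n
    have "ip2 (h n) H \<le> norm2 (h n) * norm2 H" using Cauchy_Schwarz_L2[OF assms(2,3)] abs_le_D1 by blast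
    also have "\<dots> \<le> B * norm2 H" by (intro mult_right_mono assms norm2_nonneg)
    finally show "ip2 (h n) H \<le> B * norm2 H" .
  qed
  then have "norm2 H * norm2 H \<le> B * norm2 H" by (simp add: norm2_sq[symmetric] power2_eq_square)
  moreover have "0 \<le> B" using assms(4)[of 0] norm2_nonneg order_trans by blast
  ultimately show ?thesis by (auto simp: mult_le_cancel_right less_le)
qed

lemma trans_bound_weak_limit:
  assumes w: "weak_L2 h H" and L: "\<And>n. L2 (h n)" "L2 H" and t: "\<And>n. trans_bound M (h n)"
  shows "trans_bound M H"
  unfolding trans_bound_def
proof
  fix z :: "real^2"
  have shift: "ip2 (\<lambda>x. f (x - z)) \<phi> = ip2 f (\<lambda>x. \<phi> (x + z))" if "L2 f" "L2 \<phi>" for f \<phi> :: "real^2 \<Rightarrow> real"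
  proof -
    have [measurable]: "f \<in> borel_measurable borel" "\<phi> \<in> borel_measurable borel" using that by (auto simp: L2_def)
    show ?thesis using integral_affine[of "\<lambda>x. f (x - z) * \<phi> x" 1 z] by (simp add: ip2_def add.commute)
  qed
  show "norm2 (\<lambda>x. H (x - z) - H x) \<le> M * norm z"
  proof (rule weak_L2_norm_le)
    show "weak_L2 (\<lambda>n x. h n (x - z) - h n x) (\<lambda>x. H (x - z) - H x)"
      unfolding weak_L2_def
    proof (intro allI impI)
      fix \<phi> :: "real^2 \<Rightarrow> real" assume p: "L2 \<phi>"
      have ps: "L2 (\<lambda>x. \<phi> (x + z))" using L2_shift(1)[OF p, of "- z"] by simp
      have eq: "ip2 (\<lambda>x. f (x - z) - f x) \<phi> = ip2 f (\<lambda>x. \<phi> (x + z)) - ip2 f \<phi>" if "L2 f" for f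
        using that p by (simp add: ip2_diff L2_shift shift)
      show "(\<lambda>n. ip2 (\<lambda>x. h n (x - z) - h n x) \<phi>) \<longlonglongrightarrow> ip2 (\<lambda>x. H (x - z) - H x) \<phi>"
        unfolding eq[OF L(1)] eq[OF L(2)] by (intro tendsto_diff weak_L2_D[OF w] p ps)
    qed
    show "L2 (\<lambda>x. h n (x - z) - h n x)" "L2 (\<lambda>x. H (x - z) - H x)" for n
      by (intro L2_diff L2_shift L)+
  qed (use t in \<open>auto simp: trans_bound_def\<close>)
qed

text \<open>For a fixed scale the mollified functions are bounded and converge pointwise, since they are inner
  products with translates of the kernel; on the support of \<open>\<kappa>\<close> dominated convergence applies.
  The mollification error is small uniformly in the sequence, by the translation estimate.\<close>
theorem Rellich_local:
  assumes w: "weak_L2 h H" and L: "\<And>n. L2 (h n)" "L2 H" and B: "\<And>n. norm2 (h n) \<le> B"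
    and t: "\<And>n. trans_bound M (h n)" "0 \<le> M" and k: "continuous_on UNIV \<kappa>" "csupp \<kappa>"
  shows "(\<lambda>n. norm2 (\<lambda>x. (h n x - H x) * \<kappa> x)) \<longlonglongrightarrow> 0"
proof (rule LIMSEQ_I)
  fix \<epsilon> :: real assume e: "0 < \<epsilon>"
  have tH: "trans_bound M H" by (rule trans_bound_weak_limit[OF w L t(1)])
  obtain b where b: "\<And>x. \<bar>\<kappa> x\<bar> \<le> b" "0 \<le> b" using csupp_bounded[OF k] by blast
  have [measurable]: "\<kappa> \<in> borel_measurable borel" by (rule borel_measurable_continuous_onI[OF k(1)])
  have [measurable]: "H \<in> borel_measurable borel" "h n \<in> borel_measurable borel" for n using L by (auto simp: L2_def)
  \<comment> \<open>The scale at which the two mollification errors together take up half of the tolerance.\<close>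
  define \<delta> where "\<delta> = \<epsilon> / (8 * (b * M + 1))"
  have bM: "0 \<le> b * M" using b t by simp
  have d: "0 < \<delta>" using e bM by (simp add: \<delta>_def add_nonneg_pos)
  have small: "2 * (b * (2 * M * \<delta>)) \<le> \<epsilon> / 2"
  proof -
    have "2 * (b * (2 * M * \<delta>)) = 4 * \<delta> * (b * M)" by simp
    also have "\<dots> \<le> 4 * \<delta> * (b * M + 1)" using d by (intro mult_left_mono) auto
    also have "\<dots> = \<epsilon> / 2" using bM by (simp add: \<delta>_def add_nonneg_eq_0_iff field_simps)
    finally show ?thesis .
  qed
  define A where "A f = conv f (moll \<delta>)" for f :: "real^2 \<Rightarrow> real"
  have AL: "L2 (A f)" if "L2 f" for f unfolding A_def using norm2_conv_moll[OF that d] by simp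
  have mult_b: "norm2 (\<lambda>x. f x * \<kappa> x) \<le> b * norm2 f" if f: "L2 f" for f
  proof (rule norm2_mono[OF f _ _ b(2)])
    show "(\<lambda>x. f x * \<kappa> x) \<in> borel_measurable borel" using f by (auto simp: L2_def)
    show "\<bar>f x * \<kappa> x\<bar> \<le> b * \<bar>f x\<bar>" for x
      using mult_right_mono[OF b(1)[of x], of "\<bar>f x\<bar>"] by (simp add: abs_mult mult.commute)
  qed
  have Lk: "L2 (\<lambda>x. f x * \<kappa> x)" if "L2 f" for f
    by (rule L2_bounded_mult[OF that _ b(1)]) measurable
  have err: "norm2 (\<lambda>x. (A f x - f x) * \<kappa> x) \<le> b * (2 * M * \<delta>)" if f: "L2 f" "trans_bound M f" for f
    by (rule order_trans[OF mult_b[OF L2_diff[OF AL[OF f(1)] f(1)]]])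
       (unfold A_def, intro mult_left_mono norm2_conv_moll_diff f d t b)
  have B0: "0 \<le> B" using B[of 0] norm2_nonneg order_trans by blast
  have HB: "norm2 H \<le> B" by (rule weak_L2_norm_le[OF w L B])
  have lim: "(\<lambda>n. norm2 (\<lambda>x. (A (h n) x - A H x) * \<kappa> x)) \<longlonglongrightarrow> 0"
  proof -
    define c where "c = 2 * B * norm2 (moll \<delta>)"
    have bd: "\<bar>A f x\<bar> \<le> B * norm2 (moll \<delta>)" if "L2 f" "norm2 f \<le> B" for f x
      unfolding A_def
      by (rule order_trans[OF conv_bound[OF that(1) moll_L2[OF d]]]) (intro mult_right_mono that norm2_nonneg)
    have cb: "\<bar>A (h n) x - A H x\<bar> \<le> c" for n x
      using bd[OF L(1) B, of n x] bd[OF L(2) HB, of x] unfolding c_def by linarith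
    have "(\<lambda>n. LINT x|lborel. ((A (h n) x - A H x) * \<kappa> x)\<^sup>2) \<longlonglongrightarrow> (LINT x::real^2|lborel. (0::real))"
    proof (rule integral_dominated_convergence)
      show "integrable lborel (\<lambda>x. c\<^sup>2 * (\<kappa> x)\<^sup>2)" using csupp_L2[OF k] by (simp add: L2_def)
      have [measurable]: "A H \<in> borel_measurable borel" "A (h n) \<in> borel_measurable borel" for n
        using AL L by (auto simp: L2_def)
      show "(\<lambda>x. ((A (h n) x - A H x) * \<kappa> x)\<^sup>2) \<in> borel_measurable lborel" for n by measurable
      show "AE x in lborel. (\<lambda>n. ((A (h n) x - A H x) * \<kappa> x)\<^sup>2) \<longlonglongrightarrow> 0"
      proof (rule AE_I2)
        fix x
        have "(\<lambda>n. A (h n) x) \<longlonglongrightarrow> A H x"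
          unfolding A_def conv_ip2 by (intro weak_L2_D[OF w] L2_reflect moll_L2 d)
        then have "(\<lambda>n. ((A (h n) x - A H x) * \<kappa> x)\<^sup>2) \<longlonglongrightarrow> ((A H x - A H x) * \<kappa> x)\<^sup>2"
          by (intro tendsto_intros)
        then show "(\<lambda>n. ((A (h n) x - A H x) * \<kappa> x)\<^sup>2) \<longlonglongrightarrow> 0" by simp
      qed
      show "AE x in lborel. norm (((A (h n) x - A H x) * \<kappa> x)\<^sup>2) \<le> c\<^sup>2 * (\<kappa> x)\<^sup>2" for n
      proof (rule AE_I2)
        fix x
        have "\<bar>A (h n) x - A H x\<bar>\<^sup>2 \<le> c\<^sup>2" by (intro power_mono cb) auto
        then show "norm (((A (h n) x - A H x) * \<kappa> x)\<^sup>2) \<le> c\<^sup>2 * (\<kappa> x)\<^sup>2"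
          by (simp add: power_mult_distrib mult_right_mono)
      qed
    qed simp
    then have "(\<lambda>n. sqrt (LINT x|lborel. ((A (h n) x - A H x) * \<kappa> x)\<^sup>2)) \<longlonglongrightarrow> sqrt 0"
      by (intro tendsto_real_sqrt) simp
    then show ?thesis by (simp add: norm2_def ip2_def power2_eq_square)
  qed
  obtain N where N: "\<And>n. n \<ge> N \<Longrightarrow> norm2 (\<lambda>x. (A (h n) x - A H x) * \<kappa> x) < \<epsilon> / 2"
    using LIMSEQ_D[OF lim, of "\<epsilon> / 2"] e by auto
  show "\<exists>N. \<forall>n\<ge>N. norm (norm2 (\<lambda>x. (h n x - H x) * \<kappa> x) - 0) < \<epsilon>"
  proof (intro exI[of _ N] allI impI)
    fix n assume n: "n \<ge> N"
    define f1 f2 f3 where "f1 = (\<lambda>x. (A (h n) x - h n x) * \<kappa> x)"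
      and "f2 = (\<lambda>x. (A (h n) x - A H x) * \<kappa> x)" and "f3 = (\<lambda>x. (A H x - H x) * \<kappa> x)"
    have FL: "L2 f1" "L2 f2" "L2 f3"
      unfolding f1_def f2_def f3_def
      by (intro Lk L2_diff AL L)+
    have "(\<lambda>x. (h n x - H x) * \<kappa> x) = (\<lambda>x. (f2 x + f3 x) - f1 x)"
      by (auto simp: f1_def f2_def f3_def algebra_simps)
    then have "norm2 (\<lambda>x. (h n x - H x) * \<kappa> x) \<le> norm2 (\<lambda>x. f2 x + f3 x) + norm2 f1"
      using norm2_triangle_diff[OF L2_add[OF FL(2,3)] L2_zero FL(1)] norm2_minus_commute[of "\<lambda>x. 0" f1]
      by simp
    also have "\<dots> \<le> norm2 f2 + norm2 f3 + norm2 f1" using norm2_triangle[OF FL(2,3)] by simp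
    also have "\<dots> < \<epsilon> / 2 + b * (2 * M * \<delta>) + b * (2 * M * \<delta>)"
      using N[OF n] err[OF L(1) t(1), of n] err[OF L(2) tH]
      unfolding f1_def f2_def f3_def by linarith
    also have "\<dots> \<le> \<epsilon>" using small by linarith
    finally show "norm (norm2 (\<lambda>x. (h n x - H x) * \<kappa> x) - 0) < \<epsilon>" by simp
  qed
qed

lemma weak_strong_product:
  assumes w: "weak_L2 w W" "\<And>n. L2 (w n)" "\<And>n. norm2 (w n) \<le> B"
    and u: "\<And>n. L2 (u n)" "L2 U" "(\<lambda>n. norm2 (\<lambda>x. (u n x - U x) * \<kappa> x)) \<longlonglongrightarrow> 0"
    and k: "continuous_on UNIV \<kappa>" "csupp \<kappa>"
  shows "(\<lambda>n. LINT x|lborel. w n x * u n x * \<kappa> x) \<longlonglongrightarrow> (LINT x|lborel. W x * U x * \<kappa> x)"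
proof -
  obtain b where b: "\<And>x. \<bar>\<kappa> x\<bar> \<le> b" "0 \<le> b" using csupp_bounded[OF k] by blast
  have km: "\<kappa> \<in> borel_measurable borel" by (rule borel_measurable_continuous_onI[OF k(1)])
  have L: "L2 (\<lambda>x. f x * \<kappa> x)" if "L2 f" for f by (rule L2_bounded_mult[OF that km b(1)])
  have "(\<lambda>n. ip2 (w n) (\<lambda>x. (u n x - U x) * \<kappa> x)) \<longlonglongrightarrow> 0"
  proof (rule Lim_null_comparison[OF _ tendsto_mult_right_zero[OF u(3), of B]], intro always_eventually allI)
    fix n
    show "norm (ip2 (w n) (\<lambda>x. (u n x - U x) * \<kappa> x)) \<le> B * norm2 (\<lambda>x. (u n x - U x) * \<kappa> x)"
      using Cauchy_Schwarz_L2[OF w(2) L[OF L2_diff[OF u(1,2)]], of n n]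
        mult_right_mono[OF w(3)[of n] norm2_nonneg[of "\<lambda>x. (u n x - U x) * \<kappa> x"]] by simp
  qed
  then have "(\<lambda>n. ip2 (w n) (\<lambda>x. (u n x - U x) * \<kappa> x) + ip2 (w n) (\<lambda>x. U x * \<kappa> x)) \<longlonglongrightarrow> 0 + ip2 W (\<lambda>x. U x * \<kappa> x)"
    by (intro tendsto_add weak_L2_D[OF w(1)] L u)
  moreover have "ip2 (w n) (\<lambda>x. (u n x - U x) * \<kappa> x) + ip2 (w n) (\<lambda>x. U x * \<kappa> x) = (LINT x|lborel. w n x * u n x * \<kappa> x)" for n
    using ip2_add_right[OF L[OF L2_diff[OF u(1,2)]] L[OF u(2)] w(2), of n n]
    by (simp add: ip2_def algebra_simps)
  ultimately show ?thesis by (simp add: ip2_def mult.assoc)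
qed

section \<open>The commutator\<close>

lemma nn_integral_abs_product:
  assumes f: "L2 f" and g: "L2 g"
  shows "(\<integral>\<^sup>+x. ennreal \<bar>f x * g x\<bar> \<partial>lborel) \<le> ennreal (norm2 f * norm2 g)"
proof -
  have [measurable]: "f \<in> borel_measurable borel" "g \<in> borel_measurable borel" using f g by (auto simp: L2_def)
  have a: "L2 (\<lambda>x. \<bar>f x\<bar>)" "L2 (\<lambda>x. \<bar>g x\<bar>)" using f g by (auto simp: L2_def)
  have n: "norm2 (\<lambda>x. \<bar>f x\<bar>) = norm2 f" "norm2 (\<lambda>x. \<bar>g x\<bar>) = norm2 g" by (simp_all add: norm2_def ip2_def)
  have "(\<integral>\<^sup>+x. ennreal \<bar>f x * g x\<bar> \<partial>lborel) = ennreal (LINT x|lborel. \<bar>f x * g x\<bar>)"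
    by (intro nn_integral_eq_integral integrable_abs L2_mult_integrable f g) auto
  also have "(LINT x|lborel. \<bar>f x * g x\<bar>) = ip2 (\<lambda>x. \<bar>f x\<bar>) (\<lambda>x. \<bar>g x\<bar>)"
    by (simp add: ip2_def abs_mult)
  finally show ?thesis using Cauchy_Schwarz_L2[OF a] unfolding n by (simp add: ennreal_leI)
qed

lemma csupp_moment_integrable:
  fixes \<kappa> :: "'a::euclidean_space \<Rightarrow> real"
  assumes k: "continuous_on UNIV \<kappa>" "csupp \<kappa>"
  shows "integrable lborel (\<lambda>z. norm z * \<bar>\<kappa> z\<bar>)"
proof (rule csupp_integrable)
  show "continuous_on UNIV (\<lambda>z. norm z * \<bar>\<kappa> z\<bar>)" by (intro continuous_intros k)
  show "csupp (\<lambda>z. norm z * \<bar>\<kappa> z\<bar>)" using k(2) by (auto simp: csupp_def)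
qed

text \<open>The basic commutator estimate: for fixed displacement \<open>z\<close> the Cauchy-Schwarz inequality gives
  the bound \<open>\<parallel>a\<parallel> L |z|\<close>, which is then averaged with the kernel.\<close>
lemma difference_average_L1:
  assumes a: "L2 a" and U: "L2 U" "trans_bound L U" "0 \<le> L"
    and k: "continuous_on UNIV \<kappa>" "csupp \<kappa>"
  defines "G \<equiv> \<lambda>x. LINT z|lborel. a (x - z) * (U (x - z) - U x) * \<kappa> z"
  shows "integrable lborel G" "(LINT x|lborel. \<bar>G x\<bar>) \<le> norm2 a * L * (LINT z|lborel. norm z * \<bar>\<kappa> z\<bar>)"
proof -
  have [measurable]: "a \<in> borel_measurable borel" "U \<in> borel_measurable borel" using a U by (auto simp: L2_def)
  have [measurable]: "\<kappa> \<in> borel_measurable borel" by (rule borel_measurable_continuous_onI[OF k(1)])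
  have Gm[measurable]: "G \<in> borel_measurable borel" unfolding G_def by measurable
  define M where "M = (LINT z|lborel. norm z * \<bar>\<kappa> z\<bar>)"
  have M0: "0 \<le> M" by (simp add: M_def)
  let ?P = "\<lambda>x z. a (x - z) * (U (x - z) - U x) * \<kappa> z"
  have pt: "ennreal \<bar>G x\<bar> \<le> (\<integral>\<^sup>+z. ennreal \<bar>?P x z\<bar> \<partial>lborel)" for x
  proof (cases "integrable lborel (?P x)")
    case True
    then show ?thesis using integral_norm_bound_ennreal[OF True] by (simp add: G_def)
  next
    case False
    then show ?thesis by (simp add: G_def not_integrable_integral_eq)
  qed
  have "(\<integral>\<^sup>+x. ennreal \<bar>G x\<bar> \<partial>lborel) \<le> (\<integral>\<^sup>+x. \<integral>\<^sup>+z. ennreal \<bar>?P x z\<bar> \<partial>lborel \<partial>lborel)"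
    by (intro nn_integral_mono pt)
  also have "\<dots> = (\<integral>\<^sup>+z. \<integral>\<^sup>+x. ennreal \<bar>?P x z\<bar> \<partial>lborel \<partial>lborel)"
    by (rule lborel_pair.Fubini'[symmetric]) measurable
  also have "\<dots> \<le> (\<integral>\<^sup>+z. ennreal (norm2 a * L * (norm z * \<bar>\<kappa> z\<bar>)) \<partial>lborel)"
  proof (rule nn_integral_mono)
    fix z :: "real^2"
    note LL = L2_shift(1)[OF a, of z] L2_diff[OF L2_shift(1)[OF U(1), of z] U(1)]
    have "(\<integral>\<^sup>+x. ennreal \<bar>?P x z\<bar> \<partial>lborel) = ennreal \<bar>\<kappa> z\<bar> * (\<integral>\<^sup>+x. ennreal \<bar>a (x - z) * (U (x - z) - U x)\<bar> \<partial>lborel)"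
      by (subst nn_integral_cmult[symmetric]) (auto simp: abs_mult ennreal_mult mult_ac)
    also have "\<dots> \<le> ennreal \<bar>\<kappa> z\<bar> * ennreal (norm2 a * norm2 (\<lambda>x. U (x - z) - U x))"
      using nn_integral_abs_product[OF LL] L2_shift(2)[OF a, of z] by (intro mult_left_mono) auto
    also have "\<dots> \<le> ennreal \<bar>\<kappa> z\<bar> * ennreal (norm2 a * (L * norm z))"
      using U(2) by (intro mult_left_mono ennreal_leI) (auto simp: trans_bound_def)
    also have "\<dots> = ennreal (norm2 a * L * (norm z * \<bar>\<kappa> z\<bar>))"
      using U(3) by (subst ennreal_mult[symmetric]) (auto simp: mult_ac)
    finally show "(\<integral>\<^sup>+x. ennreal \<bar>?P x z\<bar> \<partial>lborel) \<le> ennreal (norm2 a * L * (norm z * \<bar>\<kappa> z\<bar>))" .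
  qed
  also have "\<dots> = ennreal (norm2 a * L * M)"
  proof -
    have "(\<integral>\<^sup>+z. ennreal (norm2 a * L * (norm z * \<bar>\<kappa> z\<bar>)) \<partial>lborel) = ennreal (LINT z|lborel. norm2 a * L * (norm z * \<bar>\<kappa> z\<bar>))"
      using U(3) by (intro nn_integral_eq_integral integrable_mult_right csupp_moment_integrable k) auto
    then show ?thesis by (simp add: M_def)
  qed
  finally have le: "(\<integral>\<^sup>+x. ennreal \<bar>G x\<bar> \<partial>lborel) \<le> ennreal (norm2 a * L * M)" .
  show I: "integrable lborel G"
    using le by (intro integrableI_bounded) (auto intro: le_less_trans)
  have "ennreal (LINT x|lborel. \<bar>G x\<bar>) = (\<integral>\<^sup>+x. ennreal \<bar>G x\<bar> \<partial>lborel)"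
    by (rule nn_integral_eq_integral[symmetric]) (use I in auto)
  with le have "ennreal (LINT x|lborel. \<bar>G x\<bar>) \<le> ennreal (norm2 a * L * M)" by (simp only:)
  moreover have "0 \<le> norm2 a * L * M" using U(3) M0 by simp
  ultimately show "(LINT x|lborel. \<bar>G x\<bar>) \<le> norm2 a * L * (LINT z|lborel. norm z * \<bar>\<kappa> z\<bar>)"
    unfolding M_def[symmetric] by (simp only: ennreal_le_iff)
qed

text \<open>Mollification of \<open>div (U W)\<close> minus \<open>U\<close> times the gradient of the mollified \<open>W\<close>, with the
  derivatives thrown onto the kernel.\<close>
definition commutator :: "(real^2 \<Rightarrow> real) \<Rightarrow> (2 \<Rightarrow> real^2 \<Rightarrow> real) \<Rightarrow> (real^2 \<Rightarrow> real) \<Rightarrow> real^2 \<Rightarrow> real" where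
  "commutator W U \<kappa> x = (\<Sum>j\<in>UNIV. conv (\<lambda>y. W y * U j y) (pd j \<kappa>) x - U j x * conv W (pd j \<kappa>) x)"

definition weakly_div_free :: "(2 \<Rightarrow> real^2 \<Rightarrow> real) \<Rightarrow> bool" where
  "weakly_div_free U \<longleftrightarrow> (\<forall>\<psi>. C1 \<psi> \<longrightarrow> csupp \<psi> \<longrightarrow> (\<Sum>j\<in>UNIV. LINT x|lborel. U j x * pd j \<psi> x) = 0)"

lemma L2_mult_csupp:
  assumes "L2 U" "continuous_on UNIV \<kappa>" "csupp \<kappa>"
  shows "L2 (\<lambda>x. U x * \<kappa> x)"
proof -
  obtain b where "\<And>x. \<bar>\<kappa> x\<bar> \<le> b" using csupp_bounded[OF assms(2,3)] by blast
  then show ?thesis by (intro L2_bounded_mult[OF assms(1) borel_measurable_continuous_onI[OF assms(2)]])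
qed

lemma reflect_cont: "continuous_on UNIV \<kappa> \<Longrightarrow> continuous_on UNIV (\<lambda>y. \<kappa> (x - y :: 'a::euclidean_space))"
  by (rule continuous_on_compose2[of UNIV \<kappa> UNIV "\<lambda>y. x - y"]) (auto intro!: continuous_intros)

lemma product_conv_integrable:
  fixes \<kappa> :: "real^2 \<Rightarrow> real"
  assumes "L2 W" "L2 U" "continuous_on UNIV \<kappa>" "csupp \<kappa>"
  shows "integrable lborel (\<lambda>y. W y * U y * \<kappa> (x - y))"
  using L2_mult_integrable[OF assms(1) L2_mult_csupp[OF assms(2) reflect_cont[OF assms(3)] csupp_reflect[OF assms(4)]], of x]
  by (simp add: mult.assoc)

lemma conv_integrable:
  fixes \<kappa> :: "real^2 \<Rightarrow> real"
  assumes "L2 W" "continuous_on UNIV \<kappa>" "csupp \<kappa>"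
  shows "integrable lborel (\<lambda>y. W y * \<kappa> (x - y))"
  by (intro L2_mult_integrable assms L2_reflect csupp_L2)

lemma difference_average_eq:
  fixes \<kappa> :: "real^2 \<Rightarrow> real"
  assumes W: "L2 W" and U: "L2 U" and k: "continuous_on UNIV \<kappa>" "csupp \<kappa>"
  shows "conv (\<lambda>y. W y * U y) \<kappa> x - U x * conv W \<kappa> x = (LINT z|lborel. W (x - z) * (U (x - z) - U x) * \<kappa> z)"
proof -
  have [measurable]: "W \<in> borel_measurable borel" "U \<in> borel_measurable borel" using W U by (auto simp: L2_def)
  have [measurable]: "\<kappa> \<in> borel_measurable borel" by (rule borel_measurable_continuous_onI[OF k(1)])
  have "conv (\<lambda>y. W y * U y) \<kappa> x - U x * conv W \<kappa> x = (LINT y|lborel. W y * U y * \<kappa> (x - y) - U x * (W y * \<kappa> (x - y)))"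
    unfolding conv_def using product_conv_integrable[OF W U k, of x] conv_integrable[OF W k, of x] by simp
  also have "\<dots> = (LINT y|lborel. W y * (U y - U x) * \<kappa> (x - y))"
    by (simp add: algebra_simps)
  also have "\<dots> = (LINT z|lborel. W (x - z) * (U (x - z) - U x) * \<kappa> z)"
    using integral_affine[of "\<lambda>y. W y * (U y - U x) * \<kappa> (x - y)" "-1" x] by simp
  finally show ?thesis .
qed

lemma commutator_diff:
  assumes W: "L2 W" and v: "L2 v" and U: "\<And>j. L2 (U j)" and k: "C1 \<kappa>" "csupp \<kappa>"
  shows "commutator (\<lambda>x. W x - v x) U \<kappa> x = commutator W U \<kappa> x - commutator v U \<kappa> x"
proof -
  note kk = C1_continuous_pd[OF k(1)] csupp_pd[OF k(2)]
  have I: "integrable lborel (\<lambda>y. W y * U j y * pd j \<kappa> (x - y))" "integrable lborel (\<lambda>y. v y * U j y * pd j \<kappa> (x - y))" for j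
    by (intro product_conv_integrable W v U kk)+
  have c1: "conv (\<lambda>y. (W y - v y) * U j y) (pd j \<kappa>) x = conv (\<lambda>y. W y * U j y) (pd j \<kappa>) x - conv (\<lambda>y. v y * U j y) (pd j \<kappa>) x" for j
    unfolding conv_def using I[of j] by (simp add: left_diff_distrib)
  have c2: "conv (\<lambda>x. W x - v x) (pd j \<kappa>) x = conv W (pd j \<kappa>) x - conv v (pd j \<kappa>) x" for j
    by (intro conv_diff W v csupp_L2 kk)
  show ?thesis unfolding commutator_def c1 c2 by (simp add: sum_2 algebra_simps)
qed

text \<open>When the transported function is differentiable the derivative can be moved back from the kernel,
  using that \<open>U\<close> is divergence free. Then the kernel itself, whose first moment is of the
  order of the scale, replaces its derivative.\<close>
lemma commutator_C1:
  assumes v: "C1 v" "L2 v" "\<And>j. L2 (pd j v)" and U: "\<And>j. L2 (U j)" "weakly_div_free U"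
    and k: "C1 \<kappa>" "csupp \<kappa>"
  shows "commutator v U \<kappa> x = (\<Sum>j\<in>UNIV. conv (\<lambda>y. pd j v y * U j y) \<kappa> x - U j x * conv (pd j v) \<kappa> x)"
proof -
  note kk = C1_continuous[OF k(1)] C1_continuous_pd[OF k(1)] csupp_pd[OF k(2)]
  let ?r = "\<lambda>y. \<kappa> (x - y)"
  note r = C1_reflect[OF k(1), of x] csupp_reflect[OF k(2), of x] pd_reflect[OF k(1), of _ x]
  have 1: "conv v (pd j \<kappa>) x = conv (pd j v) \<kappa> x" for j
    using integral_by_parts[OF v(1) r(1,2), of j] by (simp add: r(3) conv_def)
  have "(\<Sum>j\<in>UNIV. LINT y|lborel. U j y * pd j (\<lambda>y. v y * ?r y) y) = 0"
    using U(2) C1_mult[OF v(1) r(1)] csupp_mult[OF r(2), of v] by (simp add: weakly_div_free_def)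
  moreover have "(LINT y|lborel. U j y * pd j (\<lambda>y. v y * ?r y) y)
      = conv (\<lambda>y. pd j v y * U j y) \<kappa> x - conv (\<lambda>y. v y * U j y) (pd j \<kappa>) x" for j
  proof -
    have "(\<lambda>y. U j y * pd j (\<lambda>y. v y * ?r y) y) = (\<lambda>y. pd j v y * U j y * \<kappa> (x - y) - v y * U j y * pd j \<kappa> (x - y))"
      by (simp add: pd_mult[OF v(1) r(1)] r(3) fun_eq_iff algebra_simps)
    moreover have "integrable lborel (\<lambda>y. pd j v y * U j y * \<kappa> (x - y))" "integrable lborel (\<lambda>y. v y * U j y * pd j \<kappa> (x - y))"
      by (intro product_conv_integrable v U kk k)+
    ultimately show ?thesis unfolding conv_def by simp
  qed
  ultimately have "(\<Sum>j\<in>UNIV. conv (\<lambda>y. v y * U j y) (pd j \<kappa>) x) = (\<Sum>j\<in>UNIV. conv (\<lambda>y. pd j v y * U j y) \<kappa> x)"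
    by (simp add: sum_subtractf)
  then show ?thesis by (simp add: commutator_def sum_subtractf 1)
qed

text \<open>A density property that weak limits of smooth functions have by their construction as limits of
  linear combinations; the regularity of the approximants makes mollification converge at a rate.\<close>
definition C1_approximable :: "(real^2 \<Rightarrow> real) \<Rightarrow> bool" where
  "C1_approximable W \<longleftrightarrow> (\<forall>e>0. \<exists>v. C1 v \<and> L2 v \<and> (\<forall>j. L2 (pd j v)) \<and> norm2 (\<lambda>x. W x - v x) \<le> e)"

lemma sum_of_L1:
  fixes G :: "2 \<Rightarrow> real^2 \<Rightarrow> real"
  assumes "\<And>j. integrable lborel (G j)" "\<And>j. (LINT x|lborel. \<bar>G j x\<bar>) \<le> B j"
  shows "integrable lborel (\<lambda>x. \<Sum>j\<in>UNIV. G j x)" "(LINT x|lborel. \<bar>\<Sum>j\<in>UNIV. G j x\<bar>) \<le> (\<Sum>j\<in>UNIV. B j)"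
proof -
  show I: "integrable lborel (\<lambda>x. \<Sum>j\<in>UNIV. G j x)" using assms(1) by simp
  have "(LINT x|lborel. \<bar>\<Sum>j\<in>UNIV. G j x\<bar>) \<le> (LINT x|lborel. (\<Sum>j\<in>UNIV. \<bar>G j x\<bar>))"
    using assms(1) I by (intro integral_mono integrable_abs Bochner_Integration.integrable_sum sum_abs)
  also have "\<dots> = (\<Sum>j\<in>UNIV. (LINT x|lborel. \<bar>G j x\<bar>))" using assms(1) by simp
  also have "\<dots> \<le> (\<Sum>j\<in>UNIV. B j)" by (intro sum_mono assms)
  finally show "(LINT x|lborel. \<bar>\<Sum>j\<in>UNIV. G j x\<bar>) \<le> (\<Sum>j\<in>UNIV. B j)" .
qed

text \<open>Splitting off the smooth part \<open>v\<close>: the rest is small because of its norm, the smooth part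
  because of the scale.\<close>
lemma commutator_L1:
  assumes W: "L2 W" and v: "C1 v" "L2 v" "\<And>j. L2 (pd j v)"
    and U: "\<And>j. L2 (U j)" "\<And>j. trans_bound L (U j)" "0 \<le> L" "weakly_div_free U" and d: "0 < \<delta>"
  shows "integrable lborel (commutator W U (moll \<delta>))"
    "(LINT x|lborel. \<bar>commutator W U (moll \<delta>) x\<bar>)
      \<le> norm2 (\<lambda>x. W x - v x) * (L * (\<Sum>j\<in>UNIV. moll_moment j)) + (\<Sum>j\<in>UNIV. norm2 (pd j v)) * L * (2 * \<delta>)"
proof -
  note k = C1_moll[of \<delta>] csupp_moll[OF d]
  note kk = C1_continuous[OF k(1)] C1_continuous_pd[OF k(1)] csupp_pd[OF k(2)]
  define w where "w x = W x - v x" for x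
  have w: "L2 w" unfolding w_def by (intro L2_diff W v)
  let ?A = "\<lambda>x. commutator w U (moll \<delta>) x" and ?B = "\<lambda>x. commutator v U (moll \<delta>) x"
  have A: "integrable lborel ?A" "(LINT x|lborel. \<bar>?A x\<bar>) \<le> (\<Sum>j\<in>UNIV. norm2 w * L * moll_moment j)"
    unfolding commutator_def difference_average_eq[OF w U(1) kk(2,3)]
    using sum_of_L1[OF difference_average_L1[OF w U(1,2,3) kk(2,3)]] by (simp_all add: pd_moll_moment[OF d])
  have B: "integrable lborel ?B" "(LINT x|lborel. \<bar>?B x\<bar>) \<le> (\<Sum>j\<in>UNIV. norm2 (pd j v) * L * (LINT z|lborel. norm z * \<bar>moll \<delta> z\<bar>))"
    unfolding commutator_C1[OF v U(1,4) k] difference_average_eq[OF v(3) U(1) kk(1) k(2)]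
    using sum_of_L1[OF difference_average_L1[OF v(3) U(1,2,3) kk(1) k(2)]] by simp_all
  have eq: "commutator W U (moll \<delta>) = (\<lambda>x. ?A x + ?B x)"
    unfolding w_def by (rule ext) (simp add: commutator_diff[OF W v(2) U(1) k])
  show "integrable lborel (commutator W U (moll \<delta>))"
    unfolding eq using A(1) B(1) by (rule Bochner_Integration.integrable_add)
  have "(LINT x|lborel. \<bar>commutator W U (moll \<delta>) x\<bar>) \<le> (LINT x|lborel. \<bar>?A x\<bar> + \<bar>?B x\<bar>)"
    unfolding eq using A(1) B(1) by (intro integral_mono) auto
  also have "\<dots> = (LINT x|lborel. \<bar>?A x\<bar>) + (LINT x|lborel. \<bar>?B x\<bar>)" using A(1) B(1) by simp
  also have "\<dots> \<le> (\<Sum>j\<in>UNIV. norm2 w * L * moll_moment j) + (\<Sum>j\<in>UNIV. norm2 (pd j v) * L * (2 * \<delta>))"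
    using U(3) by (intro add_mono order_trans[OF A(2)] order_trans[OF B(2)] sum_mono mult_left_mono moll_first_moment d mult_nonneg_nonneg) auto
  also have "\<dots> = norm2 w * (L * (\<Sum>j\<in>UNIV. moll_moment j)) + (\<Sum>j\<in>UNIV. norm2 (pd j v)) * L * (2 * \<delta>)"
    by (simp add: sum_distrib_left sum_distrib_right mult.assoc)
  finally show "(LINT x|lborel. \<bar>commutator W U (moll \<delta>) x\<bar>)
      \<le> norm2 (\<lambda>x. W x - v x) * (L * (\<Sum>j\<in>UNIV. moll_moment j)) + (\<Sum>j\<in>UNIV. norm2 (pd j v)) * L * (2 * \<delta>)"
    by (simp only: w_def[abs_def])
qed

text \<open>A sequence of scales; the same sequence serves for mollification, for the inverse radius of
  cutoffs and for the renormalisation parameter.\<close>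
definition mesh :: "nat \<Rightarrow> real" where "mesh n = inverse (real (Suc n))"

lemma mesh_pos: "0 < mesh n" and mesh_tendsto: "mesh \<longlonglongrightarrow> 0"
  unfolding mesh_def by (simp, rule LIMSEQ_inverse_real_of_nat)

lemma tendsto_0_by_splitting:
  fixes f :: "nat \<Rightarrow> real"
  assumes "0 \<le> C" "\<And>n. 0 \<le> f n" "\<And>e. 0 < e \<Longrightarrow> \<exists>K. \<forall>n. f n \<le> C * e + K * mesh n"
  shows "f \<longlonglongrightarrow> 0"
proof (rule LIMSEQ_I)
  fix r :: real assume r: "0 < r"
  define e where "e = r / (2 * (C + 1))"
  have e: "0 < e" using r assms(1) by (simp add: e_def)
  have Ce: "C * e \<le> r / 2"
  proof -
    have "C * e \<le> (C + 1) * e" using e by (intro mult_right_mono) auto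
    also have "\<dots> = r / 2" using assms(1) by (simp add: e_def field_simps add_nonneg_eq_0_iff)
    finally show ?thesis .
  qed
  obtain K where K: "\<And>n. f n \<le> C * e + K * mesh n" using assms(3)[OF e] by blast
  have "(\<lambda>n. K * mesh n) \<longlonglongrightarrow> K * 0" by (intro tendsto_intros mesh_tendsto)
  then obtain N where N: "\<And>n. n \<ge> N \<Longrightarrow> \<bar>K * mesh n\<bar> < r / 2"
    using LIMSEQ_D[of "\<lambda>n. K * mesh n" "K * 0" "r/2"] r by auto
  have "f n < r" if "n \<ge> N" for n using K[of n] N[OF that] Ce by linarith
  then show "\<exists>N. \<forall>n\<ge>N. norm (f n - 0) < r" using assms(2) by auto
qed

theorem commutator_tendsto_0:
  assumes W: "L2 W" "C1_approximable W"
    and U: "\<And>j. L2 (U j)" "\<And>j. trans_bound L (U j)" "0 \<le> L" "weakly_div_free U"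
  shows "(\<lambda>n. LINT x|lborel. \<bar>commutator W U (moll (mesh n)) x\<bar>) \<longlonglongrightarrow> 0"
proof (rule tendsto_0_by_splitting)
  define C where "C = L * (\<Sum>j\<in>UNIV. moll_moment j)"
  show C0: "0 \<le> C" unfolding C_def using U(3) by (intro mult_nonneg_nonneg sum_nonneg moll_moment_nonneg)
  fix e :: real assume e: "0 < e"
  then obtain v where v: "C1 v" "L2 v" "\<And>j. L2 (pd j v)" "norm2 (\<lambda>x. W x - v x) \<le> e"
    using W(2) unfolding C1_approximable_def by blast
  show "\<exists>K. \<forall>n. (LINT x|lborel. \<bar>commutator W U (moll (mesh n)) x\<bar>) \<le> C * e + K * mesh n"
  proof (intro exI allI)
    fix n
    have "(LINT x|lborel. \<bar>commutator W U (moll (mesh n)) x\<bar>)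
      \<le> norm2 (\<lambda>x. W x - v x) * C + (\<Sum>j\<in>UNIV. norm2 (pd j v)) * L * (2 * mesh n)"
      unfolding C_def by (rule commutator_L1(2)[OF W(1) v(1-3) U mesh_pos])
    also have "\<dots> \<le> C * e + ((\<Sum>j\<in>UNIV. norm2 (pd j v)) * L * 2) * mesh n"
      using mult_right_mono[OF v(4) C0] by (simp add: mult_ac)
    finally show "(LINT x|lborel. \<bar>commutator W U (moll (mesh n)) x\<bar>) \<le> C * e + ((\<Sum>j\<in>UNIV. norm2 (pd j v)) * L * 2) * mesh n" .
  qed
qed simp

lemma conv_moll_tendsto:
  assumes W: "L2 W" "C1_approximable W"
  shows "(\<lambda>n. norm2 (\<lambda>x. conv W (moll (mesh n)) x - W x)) \<longlonglongrightarrow> 0"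
proof (rule tendsto_0_by_splitting)
  show "(0::real) \<le> 2" by simp
  fix e :: real assume e: "0 < e"
  then obtain v where v: "C1 v" "L2 v" "\<And>j. L2 (pd j v)" "norm2 (\<lambda>x. W x - v x) \<le> e"
    using W(2) unfolding C1_approximable_def by blast
  define M where "M = (\<Sum>j\<in>UNIV. norm2 (pd j v))"
  have M: "trans_bound M v" "0 \<le> M" unfolding M_def using trans_bound_C1[OF v(1-3)] by (auto intro: sum_nonneg)
  show "\<exists>K. \<forall>n. norm2 (\<lambda>x. conv W (moll (mesh n)) x - W x) \<le> 2 * e + K * mesh n"
  proof (intro exI allI)
    fix n
    let ?k = "moll (mesh n)"
    note d = mesh_pos[of n]
    have Wv: "L2 (\<lambda>x. W x - v x)" by (intro L2_diff W v)
    have cd: "(\<lambda>x. conv W ?k x - conv v ?k x) = conv (\<lambda>x. W x - v x) ?k"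
      using conv_diff[OF W(1) v(2) moll_L2[OF d]] by auto
    note L = norm2_conv_moll(1)[OF W(1) d] norm2_conv_moll(1)[OF v(2) d]
    have "norm2 (\<lambda>x. conv W ?k x - W x) \<le> norm2 (\<lambda>x. conv W ?k x - conv v ?k x) + norm2 (\<lambda>x. conv v ?k x - W x)"
      by (intro norm2_triangle_diff L W)
    also have "norm2 (\<lambda>x. conv v ?k x - W x) \<le> norm2 (\<lambda>x. conv v ?k x - v x) + norm2 (\<lambda>x. v x - W x)"
      by (intro norm2_triangle_diff L W v)
    also have "norm2 (\<lambda>x. conv W ?k x - conv v ?k x) \<le> e"
      unfolding cd using norm2_conv_moll(2)[OF Wv d] v(4) by simp
    also have "norm2 (\<lambda>x. conv v ?k x - v x) \<le> 2 * M * mesh n"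
      by (rule norm2_conv_moll_diff[OF v(2) d M])
    also have "norm2 (\<lambda>x. v x - W x) \<le> e" using v(4) norm2_minus_commute[of v W] by simp
    finally show "norm2 (\<lambda>x. conv W ?k x - W x) \<le> 2 * e + (2 * M) * mesh n" by simp
  qed
qed simp

section \<open>Renormalisation\<close>

text \<open>The bounded multiplier that replaces the vorticity; it approaches the identity as \<open>e\<close> tends to
  zero.\<close>
definition damp :: "real \<Rightarrow> real \<Rightarrow> real" where
  "damp e s = s / (1 + e * s\<^sup>2)"

definition damp_primitive :: "real \<Rightarrow> real \<Rightarrow> real" where
  "damp_primitive e s = ln (1 + e * s\<^sup>2) / (2 * e)"

lemma damp_le: "0 < e \<Longrightarrow> \<bar>damp e s\<bar> \<le> \<bar>s\<bar>"
proof -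
  assume e: "0 < e"
  have "1 \<le> 1 + e * s\<^sup>2" using e by simp
  then have "\<bar>s\<bar> * 1 \<le> \<bar>s\<bar> * (1 + e * s\<^sup>2)" by (intro mult_left_mono) auto
  then show ?thesis using e by (simp add: damp_def abs_mult pos_divide_le_eq add_pos_nonneg)
qed

text \<open>The bound is not sharp; any bound depending only on \<open>e\<close> suffices.\<close>
lemma damp_bounded: "0 < e \<Longrightarrow> e \<le> 1 \<Longrightarrow> \<bar>damp e s\<bar> \<le> 1 / e"
proof -
  assume e: "0 < e" "e \<le> 1"
  have p: "0 < 1 + e * s\<^sup>2" using e by (simp add: add_pos_nonneg)
  have "\<bar>s\<bar> \<le> 1 + s\<^sup>2" using sum_squares_bound[of "\<bar>s\<bar>" 1] zero_le_power2[of s] by (simp add: abs_if split: if_splits)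
  then have "e * \<bar>s\<bar> \<le> e * (1 + s\<^sup>2)" using e by simp
  also have "\<dots> \<le> 1 + e * s\<^sup>2" using e by (simp add: algebra_simps)
  finally have "e * \<bar>s\<bar> \<le> 1 + e * s\<^sup>2" .
  then show ?thesis using e p by (simp add: damp_def abs_mult field_simps)
qed

lemma damp_Lipschitz: "0 < e \<Longrightarrow> \<bar>damp e a - damp e b\<bar> \<le> \<bar>a - b\<bar>"
proof -
  assume e: "0 < e"
  define A B where "A = 1 + e * a\<^sup>2" and "B = 1 + e * b\<^sup>2"
  have AB: "0 < A" "0 < B" using e by (auto simp: A_def B_def add_pos_nonneg)
  have "damp e a - damp e b = (a * B - b * A) / (A * B)"
    using AB by (simp add: damp_def A_def[symmetric] B_def[symmetric] field_simps)
  also have "a * B - b * A = (a - b) * (1 - e * a * b)"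
    by (simp add: A_def B_def algebra_simps power2_eq_square)
  finally have eq: "damp e a - damp e b = (a - b) * (1 - e * a * b) / (A * B)" .
  have "\<bar>1 - e * a * b\<bar> \<le> A * B"
  proof -
    have "2 * \<bar>a * b\<bar> \<le> a\<^sup>2 + b\<^sup>2" using sum_squares_bound[of "\<bar>a\<bar>" "\<bar>b\<bar>"] by (simp add: abs_mult)
    then have "e * (2 * \<bar>a * b\<bar>) \<le> e * (a\<^sup>2 + b\<^sup>2)" using e by simp
    moreover have "0 \<le> e * \<bar>a * b\<bar>" using e by simp
    moreover have "\<bar>e * a * b\<bar> = e * \<bar>a * b\<bar>" using e by (simp add: abs_mult)
    moreover have "A * B = 1 + e * (a\<^sup>2 + b\<^sup>2) + e\<^sup>2 * (a\<^sup>2 * b\<^sup>2)" by (simp add: A_def B_def algebra_simps power2_eq_square)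
    moreover have "0 \<le> e\<^sup>2 * (a\<^sup>2 * b\<^sup>2)" by simp
    ultimately show ?thesis by linarith
  qed
  then have "\<bar>a - b\<bar> * \<bar>1 - e * a * b\<bar> \<le> \<bar>a - b\<bar> * (A * B)" by (intro mult_left_mono) auto
  then show ?thesis unfolding eq using AB by (simp add: abs_mult pos_divide_le_eq)
qed

definition damp_deriv :: "real \<Rightarrow> real \<Rightarrow> real" where
  "damp_deriv e s = (1 - e * s\<^sup>2) / (1 + e * s\<^sup>2)\<^sup>2"

lemma damp_has_derivative: "0 < e \<Longrightarrow> (damp e has_real_derivative damp_deriv e s) (at s)"
proof -
  assume e: "0 < e"
  have p: "1 + e * s\<^sup>2 \<noteq> 0" using e by (smt (verit) mult_nonneg_nonneg zero_le_power2)
  show ?thesis unfolding damp_def[abs_def] damp_deriv_def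
    by (rule derivative_eq_intros refl | use p in \<open>simp add: power2_eq_square algebra_simps\<close>)+
qed

lemma damp_deriv_bound: "0 < e \<Longrightarrow> \<bar>damp_deriv e s\<bar> \<le> 1"
proof -
  assume e: "0 < e"
  define A where "A = e * s\<^sup>2"
  have A: "0 \<le> A" using e by (simp add: A_def)
  have "\<bar>1 - A\<bar> \<le> (1 + A)\<^sup>2" using A by (simp add: power2_sum abs_le_iff)
  then show ?thesis using A by (simp add: damp_deriv_def A_def[symmetric] divide_le_eq)
qed

lemma damp_continuous: "0 < e \<Longrightarrow> continuous_on UNIV (damp e)"
  by (rule DERIV_continuous_on[OF has_field_derivative_at_within[OF damp_has_derivative]])

lemma damp_deriv_continuous: "0 < e \<Longrightarrow> continuous_on UNIV (damp_deriv e)"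
proof -
  assume e: "0 < e"
  have p: "(1 + e * s\<^sup>2)\<^sup>2 \<noteq> 0" for s using e by (smt (verit) mult_nonneg_nonneg zero_le_power2 zero_less_power2)
  show ?thesis unfolding damp_deriv_def[abs_def] by (intro continuous_intros) (use p in auto)
qed

lemma damp_primitive_has_derivative: "0 < e \<Longrightarrow> (damp_primitive e has_real_derivative damp e s) (at s)"
proof -
  assume e: "0 < e"
  have p: "0 < 1 + e * s\<^sup>2" using e by (simp add: add_pos_nonneg)
  have d: "((\<lambda>s. 1 + e * s\<^sup>2) has_real_derivative e * (2 * s)) (at s)"
    by (auto intro!: derivative_eq_intros)
  have "((\<lambda>s. ln (1 + e * s\<^sup>2) / (2 * e)) has_real_derivative inverse (1 + e * s\<^sup>2) * (e * (2 * s)) / (2 * e)) (at s)"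
    by (rule DERIV_cdivide[OF DERIV_chain2[OF DERIV_ln[OF p] d]])
  moreover have "inverse A * (e * (2 * s)) / (2 * e) = s / A" for A
    using e by (cases "A = 0") (simp_all add: field_simps)
  ultimately show ?thesis by (simp only: damp_primitive_def[abs_def] damp_def)
qed

lemma damp_primitive_bound: "0 < e \<Longrightarrow> \<bar>damp_primitive e s\<bar> \<le> \<bar>s\<bar> * \<bar>s\<bar>"
proof -
  assume e: "0 < e"
  have "0 \<le> ln (1 + e * s\<^sup>2)" "ln (1 + e * s\<^sup>2) \<le> e * s\<^sup>2" using e by (auto intro: ln_add_one_self_le_self)
  then have "0 \<le> damp_primitive e s" "damp_primitive e s \<le> e * s\<^sup>2 / (2 * e)"
    unfolding damp_primitive_def using e by (intro divide_nonneg_pos divide_right_mono; simp)+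
  then have "\<bar>damp_primitive e s\<bar> \<le> e * s\<^sup>2 / (2 * e)" by simp
  also have "\<dots> \<le> s\<^sup>2" using e by simp
  finally show ?thesis by (simp add: power2_eq_square abs_mult_self_eq)
qed

lemma damp_measurable: "0 < e \<Longrightarrow> damp e \<in> borel_measurable borel"
  by (intro borel_measurable_continuous_onI damp_continuous)

lemma L2_damp:
  assumes "0 < e" "L2 w" shows "L2 (\<lambda>x. damp e (w x))"
proof (rule L2_bound[OF assms(2), where C=1])
  show "(\<lambda>x. damp e (w x)) \<in> borel_measurable borel"
    using measurable_compose[OF L2_measurable[OF assms(2)] damp_measurable[OF assms(1)]] by simp
qed (simp add: damp_le assms(1))

lemma norm2_damp_diff:
  assumes "0 < e" "L2 w" "L2 v"
  shows "norm2 (\<lambda>x. damp e (w x) - damp e (v x)) \<le> norm2 (\<lambda>x. w x - v x)"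
proof -
  have "norm2 (\<lambda>x. damp e (w x) - damp e (v x)) \<le> 1 * norm2 (\<lambda>x. w x - v x)"
    by (rule norm2_mono[OF L2_diff[OF assms(2,3)] L2_measurable[OF L2_diff[OF L2_damp L2_damp]]])
       (use assms damp_Lipschitz in auto)
  then show ?thesis by simp
qed

text \<open>The multiplier is Lipschitz with constant one, and so composition with it does not enlarge the
  approximation error or the gradient of the approximants.\<close>
lemma C1_approximable_damp:
  assumes e: "0 < e" and W: "L2 W" "C1_approximable W"
  shows "C1_approximable (\<lambda>x. damp e (W x))"
  unfolding C1_approximable_def
proof (intro allI impI)
  fix r :: real assume "0 < r"
  then obtain v where v: "C1 v" "L2 v" "\<And>j. L2 (pd j v)" "norm2 (\<lambda>x. W x - v x) \<le> r"
    using W(2) unfolding C1_approximable_def by blast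
  show "\<exists>v. C1 v \<and> L2 v \<and> (\<forall>j. L2 (pd j v)) \<and> norm2 (\<lambda>x. damp e (W x) - v x) \<le> r"
  proof (intro exI[of _ "\<lambda>x. damp e (v x)"] conjI allI)
    note c = v(1) damp_has_derivative[OF e] damp_deriv_continuous[OF e]
    show C: "C1 (\<lambda>x. damp e (v x))" by (rule C1_compose[OF c])
    show "L2 (\<lambda>x. damp e (v x))" by (rule L2_damp[OF e v(2)])
    show "norm2 (\<lambda>x. damp e (W x) - damp e (v x)) \<le> r"
      using norm2_damp_diff[OF e W(1) v(2)] v(4) by simp
    show "L2 (pd j (\<lambda>x. damp e (v x)))" for j
    proof (rule L2_bound[OF v(3)[of j], where C=1])
      show "pd j (\<lambda>x. damp e (v x)) \<in> borel_measurable borel" by (rule C1_measurable_pd[OF C])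
      show "\<bar>pd j (\<lambda>x. damp e (v x)) x\<bar> \<le> 1 * \<bar>pd j v x\<bar>" for x
        using mult_right_mono[OF damp_deriv_bound[OF e, of "v x"] abs_ge_zero[of "pd j v x"]]
        by (simp add: pd_compose[OF c] abs_mult)
    qed
  qed
qed

definition cutoff :: "nat \<Rightarrow> real^2 \<Rightarrow> real" where
  "cutoff n x = moll 1 (mesh n *\<^sub>R x) / moll 1 0"

lemma moll_0_pos: "0 < moll 1 0"
  using unit_bump_integral_pos by (simp add: moll_def unit_bump_def box_bump_def flat_def)

lemma C1_cutoff: "C1 (cutoff n)" and pd_cutoff: "pd j (cutoff n) x = mesh n * (pd j (moll 1) (mesh n *\<^sub>R x) / moll 1 0)"
proof -
  have eq: "cutoff n = (\<lambda>x. (1 / moll 1 0) * moll 1 (0 + mesh n *\<^sub>R x))" by (simp add: cutoff_def fun_eq_iff)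
  show "C1 (cutoff n)" unfolding eq by (intro C1_scale C1_affine C1_moll)
  show "pd j (cutoff n) x = mesh n * (pd j (moll 1) (mesh n *\<^sub>R x) / moll 1 0)"
    unfolding eq by (simp only: pd_scale[OF C1_affine[OF C1_moll]] pd_affine[OF C1_moll]) simp
qed

lemma csupp_cutoff: "csupp (cutoff n)"
  using csupp_mult[OF csupp_affine[OF csupp_moll[of 1], of "mesh n" 0], of "\<lambda>x. 1 / moll 1 0"] mesh_pos[of n]
  by (simp add: cutoff_def[abs_def])

lemma cutoff_bounds:
  obtains B where "\<And>n x. \<bar>cutoff n x\<bar> \<le> B" "\<And>n j x. \<bar>pd j (cutoff n) x\<bar> \<le> B * mesh n" "0 \<le> B"
proof -
  obtain b where b: "\<And>x. \<bar>moll 1 x\<bar> \<le> b" "0 \<le> b" using csupp_bounded[OF C1_continuous[OF C1_moll] csupp_moll[of 1]] by auto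
  have "\<exists>b\<ge>0. \<forall>x. \<bar>pd j (moll 1) x\<bar> \<le> b" for j
  proof -
    obtain b where "\<And>x. \<bar>pd j (moll 1) x\<bar> \<le> b" "0 \<le> b"
      using csupp_bounded[OF C1_continuous_pd[OF C1_moll[of 1], of j] csupp_pd[OF csupp_moll[of 1], of j]] by auto
    then show ?thesis by blast
  qed
  then obtain c where c: "\<And>j. 0 \<le> c j" "\<And>j x. \<bar>pd j (moll 1) x\<bar> \<le> c j" by metis
  define d where "d = b + (\<Sum>j\<in>UNIV. c j)"
  have d: "b \<le> d" "0 \<le> d" using c(1) b(2) by (auto simp: d_def intro: sum_nonneg add_nonneg_nonneg)
  have cd: "c j \<le> d" for j
    using member_le_sum[of j UNIV c] c(1) b(2) unfolding d_def by simp
  show thesis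
  proof (rule that[of "d / moll 1 0"])
    show "\<bar>cutoff n x\<bar> \<le> d / moll 1 0" for n x
      using b(1)[of "mesh n *\<^sub>R x"] d(1) moll_0_pos by (simp add: cutoff_def divide_right_mono)
    show "\<bar>pd j (cutoff n) x\<bar> \<le> d / moll 1 0 * mesh n" for n j x
    proof -
      have "\<bar>pd j (moll 1) (mesh n *\<^sub>R x)\<bar> / moll 1 0 \<le> d / moll 1 0"
        using c(2)[of j "mesh n *\<^sub>R x"] cd[of j] moll_0_pos by (intro divide_right_mono) auto
      then have "mesh n * (\<bar>pd j (moll 1) (mesh n *\<^sub>R x)\<bar> / moll 1 0) \<le> mesh n * (d / moll 1 0)"
        using mesh_pos[of n] by (intro mult_left_mono) auto
      moreover have "\<bar>pd j (cutoff n) x\<bar> = mesh n * (\<bar>pd j (moll 1) (mesh n *\<^sub>R x)\<bar> / moll 1 0)"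
        unfolding pd_cutoff using mesh_pos[of n] moll_0_pos by (simp only: abs_mult abs_divide abs_of_pos)
      ultimately show ?thesis by (simp only: mult.commute)
    qed
    show "0 \<le> d / moll 1 0" using d moll_0_pos by simp
  qed
qed

lemma cutoff_tendsto: "(\<lambda>n. cutoff n x) \<longlonglongrightarrow> 1"
proof -
  have "isCont (moll 1) 0" using C1_continuous[OF C1_moll] by (simp add: continuous_on_eq_continuous_at)
  moreover have "(\<lambda>n. mesh n *\<^sub>R x) \<longlonglongrightarrow> 0 *\<^sub>R x" by (intro tendsto_intros mesh_tendsto)
  ultimately have "(\<lambda>n. moll 1 (mesh n *\<^sub>R x)) \<longlonglongrightarrow> moll 1 0"
    using isCont_tendsto_compose[of 0 "moll 1" "\<lambda>n. mesh n *\<^sub>R x" sequentially] by simp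
  then have "(\<lambda>n. moll 1 (mesh n *\<^sub>R x) / moll 1 0) \<longlonglongrightarrow> moll 1 0 / moll 1 0"
    by (intro tendsto_intros) (use moll_0_pos in auto)
  then show ?thesis using moll_0_pos by (simp add: cutoff_def)
qed

lemma cutoff_integral_tendsto:
  assumes "integrable lborel f"
  shows "(\<lambda>n. LINT x|lborel. f x * cutoff n x) \<longlonglongrightarrow> (LINT x|lborel. f x)"
proof -
  obtain B where B: "\<And>n x. \<bar>cutoff n x\<bar> \<le> B" using cutoff_bounds by metis
  have [measurable]: "f \<in> borel_measurable borel" using borel_measurable_integrable[OF assms] by simp
  have [measurable]: "cutoff n \<in> borel_measurable borel" for n using C1_cutoff by measurable
  show ?thesis
  proof (rule integral_dominated_convergence)
    show "integrable lborel (\<lambda>x. B * \<bar>f x\<bar>)" using assms by simp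
    show "AE x in lborel. (\<lambda>n. f x * cutoff n x) \<longlonglongrightarrow> f x"
      using tendsto_mult[OF tendsto_const cutoff_tendsto] by (intro AE_I2) simp
    show "AE x in lborel. norm (f x * cutoff n x) \<le> B * \<bar>f x\<bar>" for n
      using mult_right_mono[OF B abs_ge_zero] by (intro AE_I2) (simp add: abs_mult mult.commute)
  qed measurable
qed

lemma L2_mult_csupp_integrable:
  fixes f \<kappa> :: "'a::euclidean_space \<Rightarrow> real"
  assumes "L2 f" "continuous_on UNIV \<kappa>" "csupp \<kappa>"
  shows "integrable lborel (\<lambda>x. f x * \<kappa> x)"
  by (intro L2_mult_integrable csupp_L2 assms)

lemma integrable_mult_bounded:
  fixes f h :: "'a::euclidean_space \<Rightarrow> real"
  assumes "integrable lborel f" "h \<in> borel_measurable borel" "\<And>x. \<bar>h x\<bar> \<le> C"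
  shows "integrable lborel (\<lambda>x. f x * h x)"
proof (rule Bochner_Integration.integrable_bound)
  show "integrable lborel (\<lambda>x. C * f x)" using assms by simp
  show "(\<lambda>x. f x * h x) \<in> borel_measurable lborel"
    using assms(2) borel_measurable_integrable[OF assms(1)] by simp
  show "AE x in lborel. norm (f x * h x) \<le> norm (C * f x)"
  proof (rule AE_I2)
    fix x
    have "\<bar>h x\<bar> \<le> \<bar>C\<bar>" using assms(3)[of x] by linarith
    then show "norm (f x * h x) \<le> norm (C * f x)"
      using mult_right_mono[of "\<bar>h x\<bar>" "\<bar>C\<bar>" "\<bar>f x\<bar>"] by (simp add: abs_mult mult.commute)
  qed
qed

text \<open>The derivative of the cutoff is of the order of the inverse radius, so that boundary terms at
  infinity disappear for products of square integrable functions.\<close>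
lemma cutoff_pd_integral_tendsto:
  assumes "L2 f" "L2 h"
  shows "(\<lambda>n. LINT x|lborel. f x * h x * pd j (cutoff n) x) \<longlonglongrightarrow> 0"
proof -
  obtain B where B: "\<And>n j x. \<bar>pd j (cutoff n) x\<bar> \<le> B * mesh n" "0 \<le> B" using cutoff_bounds by metis
  have i: "integrable lborel (\<lambda>x. f x * h x)" by (rule L2_mult_integrable[OF assms])
  define I where "I = (LINT x|lborel. \<bar>f x * h x\<bar>)"
  have le: "norm (LINT x|lborel. f x * h x * pd j (cutoff n) x) \<le> (B * I) * mesh n" for n
  proof -
    have m: "pd j (cutoff n) \<in> borel_measurable borel" by (rule C1_measurable_pd[OF C1_cutoff])
    have "\<bar>LINT x|lborel. f x * h x * pd j (cutoff n) x\<bar> \<le> (LINT x|lborel. \<bar>f x * h x * pd j (cutoff n) x\<bar>)"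
      by (rule integral_abs_bound)
    also have "\<dots> \<le> (LINT x|lborel. (B * mesh n) * \<bar>f x * h x\<bar>)"
    proof (rule integral_mono)
      show "integrable lborel (\<lambda>x. \<bar>f x * h x * pd j (cutoff n) x\<bar>)"
        by (intro integrable_abs integrable_mult_bounded[OF i m B(1)])
      show "integrable lborel (\<lambda>x. (B * mesh n) * \<bar>f x * h x\<bar>)" using i by simp
      show "\<bar>f x * h x * pd j (cutoff n) x\<bar> \<le> (B * mesh n) * \<bar>f x * h x\<bar>" for x
      proof -
        have "\<bar>f x * h x * pd j (cutoff n) x\<bar> = \<bar>pd j (cutoff n) x\<bar> * \<bar>f x * h x\<bar>"
          by (simp add: abs_mult)
        then show ?thesis
          using mult_right_mono[OF B(1)[of j n x] abs_ge_zero[of "f x * h x"]] by (simp only:)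
      qed
    qed
    also have "\<dots> = (B * I) * mesh n" by (simp add: I_def)
    finally show ?thesis by simp
  qed
  have "(\<lambda>n. (B * I) * mesh n) \<longlonglongrightarrow> 0"
    using tendsto_mult[OF tendsto_const mesh_tendsto, of "B * I"] by simp
  then show ?thesis by (rule Lim_null_comparison[OF always_eventually[OF allI[OF le]]])
qed

text \<open>The mollified function \<open>w\<close> is differentiable and satisfies a transport equation with the
  commutator as an additional source. Multiplied by \<open>damp e w\<close> the transport term becomes
  \<open>U\<close> times the gradient of \<open>damp_primitive e w\<close>, whose integral vanishes since \<open>U\<close> is divergence
  free; the cutoff makes this an admissible test function.\<close>
theorem renormalized_identity:
  assumes W: "L2 W" and U: "\<And>j. L2 (U j)" "weakly_div_free U" and g: "L2 g"
    and k: "C1 \<kappa>" "csupp \<kappa>"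
    and E: "\<And>x. \<gamma> * conv W \<kappa> x + (\<Sum>j\<in>UNIV. conv (\<lambda>y. W y * U j y) (pd j \<kappa>) x) = conv g \<kappa> x"
    and wL: "L2 (conv W \<kappa>)" "L2 (conv g \<kappa>)"
    and c: "integrable lborel (commutator W U \<kappa>)"
    and e: "0 < e" "e \<le> 1"
  shows "\<gamma> * ip2 (conv W \<kappa>) (\<lambda>x. damp e (conv W \<kappa> x))
     + (LINT x|lborel. commutator W U \<kappa> x * damp e (conv W \<kappa> x))
     = ip2 (conv g \<kappa>) (\<lambda>x. damp e (conv W \<kappa> x))"
proof -
  define w where "w = conv W \<kappa>"
  have w: "C1 w" "L2 w" unfolding w_def by (intro C1_conv W k) (rule wL)
  have pw: "pd j w = conv W (pd j \<kappa>)" for j unfolding w_def by (rule pd_conv[OF W k])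
  define T where "T x = damp e (w x)" for x
  define \<beta> where "\<beta> x = damp_primitive e (w x)" for x
  have TL: "L2 T" unfolding T_def by (rule L2_damp[OF e(1) w(2)])
  have Tc: "continuous_on UNIV T" unfolding T_def
    by (rule continuous_on_compose2[OF damp_continuous[OF e(1)] C1_continuous[OF w(1)]]) auto
  note bc = w(1) damp_primitive_has_derivative[OF e(1)] damp_continuous[OF e(1)]
  have b: "C1 \<beta>" unfolding \<beta>_def by (rule C1_compose[OF bc])
  have pb: "pd j \<beta> = (\<lambda>x. T x * pd j w x)" for j unfolding \<beta>_def T_def by (rule pd_compose[OF bc])
  have Tb: "\<bar>T x\<bar> \<le> 1 / e" for x unfolding T_def by (rule damp_bounded[OF e])
  define S where "S = norm2 W * norm2 \<kappa>"
  have wS: "\<bar>w x\<bar> \<le> S" for x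
    unfolding w_def S_def by (rule conv_bound[OF W csupp_L2[OF C1_continuous[OF k(1)] k(2)]])
  \<comment> \<open>At fixed scale the mollified function is bounded, so its primitive, of quadratic growth, is square integrable.\<close>
  have bL: "L2 \<beta>"
  proof (rule L2_bound[OF w(2) C1_measurable[OF b], where C=S])
    fix x
    have "\<bar>\<beta> x\<bar> \<le> \<bar>w x\<bar> * \<bar>w x\<bar>" unfolding \<beta>_def by (rule damp_primitive_bound[OF e(1)])
    also have "\<dots> \<le> S * \<bar>w x\<bar>" by (intro mult_right_mono wS) auto
    finally show "\<bar>\<beta> x\<bar> \<le> S * \<bar>w x\<bar>" .
  qed
  have cT: "integrable lborel (\<lambda>x. commutator W U \<kappa> x * T x)"
    by (rule integrable_mult_bounded[OF c borel_measurable_continuous_onI[OF Tc] Tb])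
  have pt: "\<gamma> * w x + (\<Sum>j\<in>UNIV. U j x * pd j w x) + commutator W U \<kappa> x = conv g \<kappa> x" for x
    unfolding E[symmetric] commutator_def pw by (simp add: w_def sum_2)
  have level: "\<gamma> * (LINT x|lborel. (w x * T x) * cutoff n x) + (LINT x|lborel. (commutator W U \<kappa> x * T x) * cutoff n x)
      - (\<Sum>j\<in>UNIV. (LINT x|lborel. U j x * \<beta> x * pd j (cutoff n) x)) = (LINT x|lborel. (conv g \<kappa> x * T x) * cutoff n x)" for n
  proof -
    note cc = C1_cutoff[of n] csupp_cutoff[of n]
    have cm: "cutoff n \<in> borel_measurable borel" using cc(1) by (rule C1_measurable)
    obtain B where B: "\<And>x. \<bar>cutoff n x\<bar> \<le> B" using csupp_bounded[OF C1_continuous[OF cc(1)] cc(2)] by blast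
    have i1: "integrable lborel (\<lambda>x. (w x * T x) * cutoff n x)"
      by (rule integrable_mult_bounded[OF L2_mult_integrable[OF w(2) TL] cm B])
    have i2: "integrable lborel (\<lambda>x. (commutator W U \<kappa> x * T x) * cutoff n x)"
      by (rule integrable_mult_bounded[OF cT cm B])
    have i3: "integrable lborel (\<lambda>x. U j x * (T x * pd j w x * cutoff n x))" for j
      by (intro L2_mult_csupp_integrable U continuous_intros Tc C1_continuous_pd[OF w(1)] C1_continuous cc csupp_mult)
    have i4: "integrable lborel (\<lambda>x. U j x * (\<beta> x * pd j (cutoff n) x))" for j
      by (intro L2_mult_csupp_integrable U continuous_intros C1_continuous b C1_continuous_pd cc csupp_mult csupp_pd)
    have "(\<Sum>j\<in>UNIV. LINT x|lborel. U j x * pd j (\<lambda>x. \<beta> x * cutoff n x) x) = 0"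
      using U(2) C1_mult[OF b cc(1)] csupp_mult[OF cc(2)] by (simp add: weakly_div_free_def)
    moreover have "(LINT x|lborel. U j x * pd j (\<lambda>x. \<beta> x * cutoff n x) x)
        = (LINT x|lborel. U j x * (T x * pd j w x * cutoff n x)) + (LINT x|lborel. U j x * (\<beta> x * pd j (cutoff n) x))" for j
      using i3[of j] i4[of j] by (simp add: pd_mult[OF b cc(1)] pb distrib_left add.commute)
    ultimately have z: "(\<Sum>j\<in>UNIV. (LINT x|lborel. U j x * (T x * pd j w x * cutoff n x)))
        = - (\<Sum>j\<in>UNIV. (LINT x|lborel. U j x * (\<beta> x * pd j (cutoff n) x)))"
      by (simp add: sum.distrib add_eq_0_iff2)
    have "(LINT x|lborel. (conv g \<kappa> x * T x) * cutoff n x)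
       = (LINT x|lborel. \<gamma> * ((w x * T x) * cutoff n x) + (commutator W U \<kappa> x * T x) * cutoff n x
            + (\<Sum>j\<in>UNIV. U j x * (T x * pd j w x * cutoff n x)))"
      unfolding pt[symmetric] by (intro Bochner_Integration.integral_cong) (auto simp: sum_2 algebra_simps)
    also have "\<dots> = \<gamma> * (LINT x|lborel. (w x * T x) * cutoff n x) + (LINT x|lborel. (commutator W U \<kappa> x * T x) * cutoff n x)
            + (\<Sum>j\<in>UNIV. (LINT x|lborel. U j x * (T x * pd j w x * cutoff n x)))"
      using i1 i2 i3 by simp
    finally show ?thesis unfolding z by (simp add: mult.assoc)
  qed
  have lim3: "(\<lambda>n. LINT x|lborel. U j x * \<beta> x * pd j (cutoff n) x) \<longlonglongrightarrow> 0" for j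
    by (rule cutoff_pd_integral_tendsto[OF U(1) bL])
  have "(\<lambda>n. \<gamma> * (LINT x|lborel. (w x * T x) * cutoff n x) + (LINT x|lborel. (commutator W U \<kappa> x * T x) * cutoff n x)
      - (\<Sum>j\<in>UNIV. (LINT x|lborel. U j x * \<beta> x * pd j (cutoff n) x)))
    \<longlonglongrightarrow> \<gamma> * (LINT x|lborel. w x * T x) + (LINT x|lborel. commutator W U \<kappa> x * T x) - (\<Sum>j\<in>(UNIV::2 set). 0)"
    by (intro tendsto_intros cutoff_integral_tendsto L2_mult_integrable w TL cT lim3)
  moreover have "(\<lambda>n. LINT x|lborel. (conv g \<kappa> x * T x) * cutoff n x) \<longlonglongrightarrow> (LINT x|lborel. conv g \<kappa> x * T x)"
    by (intro cutoff_integral_tendsto L2_mult_integrable wL TL)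
  ultimately have "\<gamma> * (LINT x|lborel. w x * T x) + (LINT x|lborel. commutator W U \<kappa> x * T x) - (\<Sum>j\<in>(UNIV::2 set). 0)
     = (LINT x|lborel. conv g \<kappa> x * T x)"
    unfolding level by (rule LIMSEQ_unique)
  then show ?thesis by (simp add: ip2_def w_def T_def)
qed

lemma ip2_tendsto:
  assumes "\<And>n. L2 (f n)" "L2 F" "\<And>n. L2 (h n)" "L2 H"
    and "(\<lambda>n. norm2 (\<lambda>x. f n x - F x)) \<longlonglongrightarrow> 0" "(\<lambda>n. norm2 (\<lambda>x. h n x - H x)) \<longlonglongrightarrow> 0"
  shows "(\<lambda>n. ip2 (f n) (h n)) \<longlonglongrightarrow> ip2 F H"
proof -
  have eq: "ip2 (f n) (h n) - ip2 F H = ip2 (\<lambda>x. f n x - F x) (\<lambda>x. h n x - H x) + ip2 (\<lambda>x. f n x - F x) H + ip2 F (\<lambda>x. h n x - H x)" for n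
    using assms(1-4) by (simp add: ip2_diff ip2_diff_right L2_diff)
  have le: "norm (ip2 (f n) (h n) - ip2 F H) \<le> norm2 (\<lambda>x. f n x - F x) * norm2 (\<lambda>x. h n x - H x) + norm2 (\<lambda>x. f n x - F x) * norm2 H
      + norm2 F * norm2 (\<lambda>x. h n x - H x)" for n
    unfolding eq
    using Cauchy_Schwarz_L2[OF L2_diff[OF assms(1,2)] L2_diff[OF assms(3,4)], of n n]
      Cauchy_Schwarz_L2[OF L2_diff[OF assms(1,2)] assms(4), of n] Cauchy_Schwarz_L2[OF assms(2) L2_diff[OF assms(3,4)], of n]
    unfolding real_norm_def by linarith
  have "(\<lambda>n. norm2 (\<lambda>x. f n x - F x) * norm2 (\<lambda>x. h n x - H x) + norm2 (\<lambda>x. f n x - F x) * norm2 H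
      + norm2 F * norm2 (\<lambda>x. h n x - H x)) \<longlonglongrightarrow> 0 * 0 + 0 * norm2 H + norm2 F * 0"
    by (intro tendsto_intros assms)
  then have "(\<lambda>n. norm2 (\<lambda>x. f n x - F x) * norm2 (\<lambda>x. h n x - H x) + norm2 (\<lambda>x. f n x - F x) * norm2 H
      + norm2 F * norm2 (\<lambda>x. h n x - H x)) \<longlonglongrightarrow> 0" by simp
  then have "(\<lambda>n. ip2 (f n) (h n) - ip2 F H) \<longlonglongrightarrow> 0"
    by (rule Lim_null_comparison[OF always_eventually[OF allI[OF le]]])
  then show ?thesis by (simp add: LIM_zero_iff)
qed

text \<open>Fubini's theorem and the symmetry of the kernel. It moves the mollification from the source
  term to the multiplier, for which convergence of the mollified functions is known.\<close>
lemma conv_moll_self_adjoint: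
  assumes f: "L2 f" and h: "L2 h" and d: "0 < \<delta>"
  shows "ip2 (conv f (moll \<delta>)) h = ip2 f (conv h (moll \<delta>))"
proof -
  have [measurable]: "f \<in> borel_measurable borel" "h \<in> borel_measurable borel" using f h by (auto simp: L2_def)
  let ?P = "\<lambda>x y. f y * moll \<delta> (x - y) * h x"
  have fa: "L2 (\<lambda>x. \<bar>f x\<bar>)" using f by (auto simp: L2_def)
  have "integrable (lborel \<Otimes>\<^sub>M lborel) (\<lambda>(x, y). ?P x y)"
  proof (rule integrableI_bounded)
    show "(\<lambda>(x, y). ?P x y) \<in> borel_measurable (lborel \<Otimes>\<^sub>M lborel)" by measurable
    have "(\<integral>\<^sup>+p. ennreal (norm (case p of (x, y) \<Rightarrow> ?P x y)) \<partial>(lborel \<Otimes>\<^sub>M lborel))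
        = (\<integral>\<^sup>+x. \<integral>\<^sup>+y. ennreal \<bar>?P x y\<bar> \<partial>lborel \<partial>lborel)"
      by (subst lborel.nn_integral_fst[symmetric]) auto
    also have "\<dots> = (\<integral>\<^sup>+x. ennreal \<bar>conv (\<lambda>x. \<bar>f x\<bar>) (moll \<delta>) x * h x\<bar> \<partial>lborel)"
    proof (rule nn_integral_cong)
      fix x
      have "(\<integral>\<^sup>+y. ennreal \<bar>?P x y\<bar> \<partial>lborel) = (\<integral>\<^sup>+y. ennreal (\<bar>h x\<bar> * (\<bar>f y\<bar> * moll \<delta> (x - y))) \<partial>lborel)"
        by (intro nn_integral_cong) (simp add: abs_mult moll_nonneg mult_ac)
      also have "\<dots> = ennreal (LINT y|lborel. \<bar>h x\<bar> * (\<bar>f y\<bar> * moll \<delta> (x - y)))"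
        by (intro nn_integral_eq_integral integrable_mult_right conv_integrable fa C1_continuous C1_moll csupp_moll d)
           (simp add: moll_nonneg)
      also have "(LINT y|lborel. \<bar>h x\<bar> * (\<bar>f y\<bar> * moll \<delta> (x - y))) = \<bar>h x\<bar> * conv (\<lambda>x. \<bar>f x\<bar>) (moll \<delta>) x"
        by (simp add: conv_def)
      also have "\<dots> = \<bar>conv (\<lambda>x. \<bar>f x\<bar>) (moll \<delta>) x * h x\<bar>"
      proof -
        have "0 \<le> conv (\<lambda>x. \<bar>f x\<bar>) (moll \<delta>) x" unfolding conv_def by (simp add: moll_nonneg)
        then show ?thesis by (simp add: abs_mult mult.commute)
      qed
      finally show "(\<integral>\<^sup>+y. ennreal \<bar>?P x y\<bar> \<partial>lborel) = ennreal \<bar>conv (\<lambda>x. \<bar>f x\<bar>) (moll \<delta>) x * h x\<bar>" .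
    qed
    also have "\<dots> < \<infinity>"
      by (rule le_less_trans[OF nn_integral_abs_product[OF norm2_conv_moll(1)[OF fa d] h]]) simp
    finally show "(\<integral>\<^sup>+p. ennreal (norm (case p of (x, y) \<Rightarrow> ?P x y)) \<partial>(lborel \<Otimes>\<^sub>M lborel)) < \<infinity>" .
  qed
  then have "(LINT y|lborel. LINT x|lborel. ?P x y) = (LINT x|lborel. LINT y|lborel. ?P x y)"
    by (rule lborel_pair.Fubini_integral)
  moreover have "(LINT y|lborel. ?P x y) = conv f (moll \<delta>) x * h x" for x
    by (simp add: conv_def)
  moreover have "(LINT x|lborel. ?P x y) = f y * conv h (moll \<delta>) y" for y
  proof -
    have "moll \<delta> (x - y) = moll \<delta> (y - x)" for x using moll_even[of \<delta> "x - y"] by simp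
    then have "(\<lambda>x. ?P x y) = (\<lambda>x. f y * (h x * moll \<delta> (y - x)))" by (simp add: fun_eq_iff)
    then show ?thesis by (simp only: conv_def integral_mult_right_zero)
  qed
  ultimately show ?thesis by (simp only: ip2_def)
qed

text \<open>The commutator is paired with a function bounded by \<open>1 / e\<close> and drops out as the scale tends to
  zero, all other terms converge by strong convergence; then \<open>e\<close> tends to zero by dominated
  convergence.\<close>
theorem limit_enstrophy:
  assumes W: "L2 W" "C1_approximable W"
    and U: "\<And>j. L2 (U j)" "\<And>j. trans_bound L (U j)" "0 \<le> L" "weakly_div_free U" and g: "L2 g"
    and E: "\<And>\<delta> x. 0 < \<delta> \<Longrightarrow> \<gamma> * conv W (moll \<delta>) x + (\<Sum>j\<in>UNIV. conv (\<lambda>y. W y * U j y) (pd j (moll \<delta>)) x) = conv g (moll \<delta>) x"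
  shows "\<gamma> * ip2 W W = ip2 g W"
proof -
  have damped: "\<gamma> * ip2 W (\<lambda>x. damp e (W x)) = ip2 g (\<lambda>x. damp e (W x))" if e: "0 < e" "e \<le> 1" for e
  proof -
    define w where "w n = conv W (moll (mesh n))" for n
    define T where "T n x = damp e (w n x)" for n x
    define TW where "TW x = damp e (W x)" for x
    have wL: "L2 (w n)" for n unfolding w_def by (rule norm2_conv_moll(1)[OF W(1) mesh_pos])
    have TL: "L2 (T n)" for n unfolding T_def by (rule L2_damp[OF e(1) wL])
    have TWL: "L2 TW" unfolding TW_def by (rule L2_damp[OF e(1) W(1)])
    have TWA: "C1_approximable TW" unfolding TW_def by (rule C1_approximable_damp[OF e(1) W])
    have wW: "(\<lambda>n. norm2 (\<lambda>x. w n x - W x)) \<longlonglongrightarrow> 0" unfolding w_def by (rule conv_moll_tendsto[OF W])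
    have TT: "norm2 (\<lambda>x. T n x - TW x) \<le> norm2 (\<lambda>x. w n x - W x)" for n
      unfolding T_def TW_def by (rule norm2_damp_diff[OF e(1) wL W(1)])
    have TWlim: "(\<lambda>n. norm2 (\<lambda>x. T n x - TW x)) \<longlonglongrightarrow> 0"
      by (rule Lim_null_comparison[OF _ wW]) (use TT in auto)
    define cT where "cT n = conv (T n) (moll (mesh n))" for n
    have cTL: "L2 (cT n)" for n unfolding cT_def by (rule norm2_conv_moll(1)[OF TL mesh_pos])
    have cTlim: "(\<lambda>n. norm2 (\<lambda>x. cT n x - TW x)) \<longlonglongrightarrow> 0"
    proof (rule Lim_null_comparison)
      have "norm2 (\<lambda>x. cT n x - TW x) \<le> norm2 (\<lambda>x. T n x - TW x) + norm2 (\<lambda>x. conv TW (moll (mesh n)) x - TW x)" for n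
      proof -
        note d = mesh_pos[of n]
        have "norm2 (\<lambda>x. cT n x - TW x) \<le> norm2 (\<lambda>x. cT n x - conv TW (moll (mesh n)) x) + norm2 (\<lambda>x. conv TW (moll (mesh n)) x - TW x)"
          by (intro norm2_triangle_diff cTL TWL norm2_conv_moll(1) d)
        moreover have "(\<lambda>x. cT n x - conv TW (moll (mesh n)) x) = conv (\<lambda>x. T n x - TW x) (moll (mesh n))"
          unfolding cT_def using conv_diff[OF TL TWL moll_L2[OF d]] by auto
        moreover have "norm2 (conv (\<lambda>x. T n x - TW x) (moll (mesh n))) \<le> norm2 (\<lambda>x. T n x - TW x)"
          by (intro norm2_conv_moll(2) L2_diff TL TWL d)
        ultimately show ?thesis by simp
      qed
      then show "\<forall>\<^sub>F n in sequentially. norm (norm2 (\<lambda>x. cT n x - TW x)) \<le> norm2 (\<lambda>x. T n x - TW x) + norm2 (\<lambda>x. conv TW (moll (mesh n)) x - TW x)"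
        by simp
      show "(\<lambda>n. norm2 (\<lambda>x. T n x - TW x) + norm2 (\<lambda>x. conv TW (moll (mesh n)) x - TW x)) \<longlonglongrightarrow> 0"
        using tendsto_add[OF TWlim conv_moll_tendsto[OF TWL TWA]] by simp
    qed
    obtain v where v: "C1 v" "L2 v" "\<And>j. L2 (pd j v)" using W(2) unfolding C1_approximable_def by (metis zero_less_one)
    define R where "R n = (LINT x|lborel. commutator W U (moll (mesh n)) x * T n x)" for n
    have ci: "integrable lborel (commutator W U (moll (mesh n)))" for n
      by (rule commutator_L1(1)[OF W(1) v U mesh_pos])
    have id: "\<gamma> * ip2 (w n) (T n) + R n = ip2 g (cT n)" for n
      using renormalized_identity[OF W(1) U(1,4) g C1_moll csupp_moll[OF mesh_pos] E[OF mesh_pos]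
          norm2_conv_moll(1)[OF W(1) mesh_pos] norm2_conv_moll(1)[OF g mesh_pos] ci e, of n]
        conv_moll_self_adjoint[OF g TL mesh_pos, of n n]
      by (simp add: w_def T_def[abs_def] R_def cT_def)
    have "R \<longlonglongrightarrow> 0"
    proof (rule Lim_null_comparison)
      have "\<bar>R n\<bar> \<le> (1 / e) * (LINT x|lborel. \<bar>commutator W U (moll (mesh n)) x\<bar>)" for n
      proof -
        have m: "T n \<in> borel_measurable borel" by (rule L2_measurable[OF TL])
        have Tb: "\<bar>T n x\<bar> \<le> 1 / e" for x unfolding T_def by (rule damp_bounded[OF e])
        have "\<bar>R n\<bar> \<le> (LINT x|lborel. \<bar>commutator W U (moll (mesh n)) x * T n x\<bar>)"
          unfolding R_def by (rule integral_abs_bound)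
        also have "\<dots> \<le> (LINT x|lborel. (1 / e) * \<bar>commutator W U (moll (mesh n)) x\<bar>)"
        proof (rule integral_mono)
          show "integrable lborel (\<lambda>x. \<bar>commutator W U (moll (mesh n)) x * T n x\<bar>)"
            by (intro integrable_abs integrable_mult_bounded[OF ci m Tb])
          show "integrable lborel (\<lambda>x. (1 / e) * \<bar>commutator W U (moll (mesh n)) x\<bar>)"
            by (intro integrable_mult_right integrable_abs ci)
          show "\<bar>commutator W U (moll (mesh n)) x * T n x\<bar> \<le> (1 / e) * \<bar>commutator W U (moll (mesh n)) x\<bar>" for x
            using mult_right_mono[OF Tb[of x] abs_ge_zero[of "commutator W U (moll (mesh n)) x"]]
            by (simp only: abs_mult mult.commute)
        qed
        finally show ?thesis by simp
      qed
      then show "\<forall>\<^sub>F n in sequentially. norm (R n) \<le> (1 / e) * (LINT x|lborel. \<bar>commutator W U (moll (mesh n)) x\<bar>)"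
        by simp
      show "(\<lambda>n. (1 / e) * (LINT x|lborel. \<bar>commutator W U (moll (mesh n)) x\<bar>)) \<longlonglongrightarrow> 0"
        using tendsto_mult[OF tendsto_const commutator_tendsto_0[OF W U], of "1 / e"] by simp
    qed
    then have "(\<lambda>n. \<gamma> * ip2 (w n) (T n) + R n) \<longlonglongrightarrow> \<gamma> * ip2 W TW + 0"
      by (intro tendsto_intros ip2_tendsto wL TL W TWL wW TWlim)
    moreover have "(\<lambda>n. ip2 g (cT n)) \<longlonglongrightarrow> ip2 g TW"
      by (rule ip2_tendsto[OF g g cTL TWL _ cTlim]) (simp add: norm2_def ip2_def)
    ultimately show ?thesis unfolding id TW_def using LIMSEQ_unique by fastforce
  qed
  have lim: "(\<lambda>n. ip2 f (\<lambda>x. damp (mesh n) (W x))) \<longlonglongrightarrow> ip2 f W" if f: "L2 f" for f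
    unfolding ip2_def
  proof (rule integral_dominated_convergence)
    have [measurable]: "f \<in> borel_measurable borel" "W \<in> borel_measurable borel" using f W by (auto simp: L2_def)
    show "(\<lambda>x. f x * W x) \<in> borel_measurable lborel" by measurable
    show "(\<lambda>x. f x * damp (mesh n) (W x)) \<in> borel_measurable lborel" for n
      using L2_measurable[OF L2_damp[OF mesh_pos W(1)]] by measurable
    show "integrable lborel (\<lambda>x. \<bar>f x * W x\<bar>)" by (intro integrable_abs L2_mult_integrable f W)
    show "AE x in lborel. (\<lambda>n. f x * damp (mesh n) (W x)) \<longlonglongrightarrow> f x * W x"
    proof (rule AE_I2)
      fix x
      have "(\<lambda>n. f x * (W x / (1 + mesh n * (W x)\<^sup>2))) \<longlonglongrightarrow> f x * (W x / (1 + 0 * (W x)\<^sup>2))"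
        by (intro tendsto_intros mesh_tendsto) simp
      then show "(\<lambda>n. f x * damp (mesh n) (W x)) \<longlonglongrightarrow> f x * W x" by (simp add: damp_def)
    qed
    show "AE x in lborel. norm (f x * damp (mesh n) (W x)) \<le> \<bar>f x * W x\<bar>" for n
      using mult_left_mono[OF damp_le[OF mesh_pos] abs_ge_zero] by (intro AE_I2) (simp add: abs_mult)
  qed
  have m1: "mesh n \<le> 1" for n by (simp add: mesh_def inverse_le_1_iff)
  have "(\<lambda>n. \<gamma> * ip2 W (\<lambda>x. damp (mesh n) (W x))) \<longlonglongrightarrow> \<gamma> * ip2 W W" by (intro tendsto_intros lim W)
  moreover have "(\<lambda>n. ip2 g (\<lambda>x. damp (mesh n) (W x))) \<longlonglongrightarrow> ip2 g W" by (rule lim[OF g])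
  ultimately show ?thesis unfolding damped[OF mesh_pos m1] by (rule LIMSEQ_unique)
qed

section \<open>Velocity gradient and vorticity\<close>

text \<open>The mean value theorem applied twice. The left-hand side is symmetric in the two directions,
  which yields the symmetry of second derivatives.\<close>
lemma double_difference:
  assumes h: "C1 h" "C1 (pd i h)" and t: "0 < t"
  obtains p where "norm (p - x) \<le> 2 * t"
    "h (x + t *\<^sub>R axis i 1 + t *\<^sub>R axis j 1) - h (x + t *\<^sub>R axis i 1) - h (x + t *\<^sub>R axis j 1) + h x
      = t\<^sup>2 * pd j (pd i h) p"
proof -
  have dir: "(\<Sum>k\<in>UNIV. (t *\<^sub>R axis l 1 :: real^2) $ k * c k) = t * c l" for l and c :: "2 \<Rightarrow> real"
  proof -
    have "(\<Sum>k\<in>UNIV. (t *\<^sub>R axis l 1 :: real^2) $ k * c k) = (\<Sum>k\<in>UNIV. if k = l then t * c k else 0)"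
      by (intro sum.cong) (auto simp: axis_def)
    then show ?thesis by simp
  qed
  define f where "f y = h (t *\<^sub>R axis j 1 + 1 *\<^sub>R y) + (-1) * h y" for y
  note c = C1_affine[OF h(1), of "t *\<^sub>R axis j 1" 1] C1_scale[OF h(1), of "-1"]
  have f: "C1 f" unfolding f_def by (rule C1_add[OF c])
  have pf: "pd i f y = pd i h (t *\<^sub>R axis j 1 + y) - pd i h y" for y
  proof -
    have "pd i f = (\<lambda>y. 1 * pd i h (t *\<^sub>R axis j 1 + 1 *\<^sub>R y) + (-1) * pd i h y)"
      unfolding f_def pd_add[OF c] pd_scale[OF h(1)] pd_affine[OF h(1)] by simp
    then show ?thesis by simp
  qed
  obtain s where s: "0 < s" "s < 1" "f (x + t *\<^sub>R axis i 1) - f x = t * pd i f (x + s *\<^sub>R (t *\<^sub>R axis i 1))"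
    by (rule C1_MVT[OF f, of x "t *\<^sub>R axis i 1"]) (simp only: dir)
  define y where "y = x + s *\<^sub>R (t *\<^sub>R axis i 1)"
  obtain r where r: "0 < r" "r < 1" "pd i h (y + t *\<^sub>R axis j 1) - pd i h y = t * pd j (pd i h) (y + r *\<^sub>R (t *\<^sub>R axis j 1))"
    by (rule C1_MVT[OF h(2), of y "t *\<^sub>R axis j 1"]) (simp only: dir)
  show thesis
  proof (rule that[of "y + r *\<^sub>R (t *\<^sub>R axis j 1)"])
    have "norm (y + r *\<^sub>R (t *\<^sub>R axis j 1) - x) \<le> norm (s *\<^sub>R (t *\<^sub>R axis i 1 :: real^2)) + norm (r *\<^sub>R (t *\<^sub>R axis j 1 :: real^2))"
      unfolding y_def using norm_triangle_ineq[of "s *\<^sub>R (t *\<^sub>R axis i 1 :: real^2)" "r *\<^sub>R (t *\<^sub>R axis j 1)"] by (simp add: add.commute)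
    also have "\<dots> = s * t + r * t" using s r t by (simp add: norm_axis_1)
    also have "\<dots> \<le> 1 * t + 1 * t" using s r t by (intro add_mono mult_right_mono) auto
    finally show "norm (y + r *\<^sub>R (t *\<^sub>R axis j 1) - x) \<le> 2 * t" by simp
    have "h (x + t *\<^sub>R axis i 1 + t *\<^sub>R axis j 1) - h (x + t *\<^sub>R axis i 1) - h (x + t *\<^sub>R axis j 1) + h x
        = f (x + t *\<^sub>R axis i 1) - f x" by (simp add: f_def add_ac)
    also have "\<dots> = t * (pd i h (y + t *\<^sub>R axis j 1) - pd i h y)" unfolding s(3) pf y_def by (simp add: add_ac)
    also have "\<dots> = t\<^sup>2 * pd j (pd i h) (y + r *\<^sub>R (t *\<^sub>R axis j 1))" unfolding r(3) by (simp add: power2_eq_square)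
    finally show "h (x + t *\<^sub>R axis i 1 + t *\<^sub>R axis j 1) - h (x + t *\<^sub>R axis i 1) - h (x + t *\<^sub>R axis j 1) + h x
      = t\<^sup>2 * pd j (pd i h) (y + r *\<^sub>R (t *\<^sub>R axis j 1))" .
  qed
qed

lemma mixed_partials_commute:
  assumes h: "C1 h" "\<And>i. C1 (pd i h)"
  shows "pd j (pd i h) x = pd i (pd j h) x"
proof -
  have "\<exists>p. norm (p - x) \<le> 2 * mesh n \<and>
     h (x + mesh n *\<^sub>R axis i 1 + mesh n *\<^sub>R axis j 1) - h (x + mesh n *\<^sub>R axis i 1) - h (x + mesh n *\<^sub>R axis j 1) + h x
      = (mesh n)\<^sup>2 * pd j (pd i h) p" for n i j
    using double_difference[OF h(1) h(2)[of i] mesh_pos[of n], of x j] by blast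
  then obtain p where p: "\<And>n i j. norm (p n i j - x) \<le> 2 * mesh n"
     "\<And>n i j. h (x + mesh n *\<^sub>R axis i 1 + mesh n *\<^sub>R axis j 1) - h (x + mesh n *\<^sub>R axis i 1) - h (x + mesh n *\<^sub>R axis j 1) + h x
      = (mesh n)\<^sup>2 * pd j (pd i h) (p n i j)" by metis
  have lim: "(\<lambda>n. pd j (pd i h) (p n i j)) \<longlonglongrightarrow> pd j (pd i h) x" for i j
  proof -
    have m: "(\<lambda>n. 2 * mesh n) \<longlonglongrightarrow> 0" using tendsto_mult[OF tendsto_const mesh_tendsto, of 2] by simp
    have "(\<lambda>n. p n i j - x) \<longlonglongrightarrow> 0"
      by (rule Lim_null_comparison[OF always_eventually[OF allI[OF p(1)]] m])
    then have "(\<lambda>n. p n i j) \<longlonglongrightarrow> x" by (simp add: LIM_zero_iff)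
    moreover have "isCont (pd j (pd i h)) x"
      using C1_continuous_pd[OF h(2)] by (simp add: continuous_on_eq_continuous_at)
    ultimately show ?thesis by (intro isCont_tendsto_compose[of x "pd j (pd i h)"])
  qed
  have "pd j (pd i h) (p n i j) = pd i (pd j h) (p n j i)" for n
  proof -
    have "(mesh n)\<^sup>2 * pd j (pd i h) (p n i j) = (mesh n)\<^sup>2 * pd i (pd j h) (p n j i)"
      unfolding p(2)[symmetric] by (simp add: add_ac)
    then show ?thesis using mesh_pos[of n] by simp
  qed
  then have "(\<lambda>n. pd i (pd j h) (p n j i)) \<longlonglongrightarrow> pd j (pd i h) x" using lim[of j i] by simp
  then show ?thesis using lim[of i j] LIMSEQ_unique by blast
qed

text \<open>The Jacobian determinant is a divergence: integrating by parts, the second derivatives cancel and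
  only terms with derivatives of the cutoff remain.\<close>
lemma integral_Jacobian_eq_0:
  assumes a: "C1 a" "L2 a" "\<And>j. L2 (pd j a)" and b: "C1 b" "\<And>j. C1 (pd j b)" "\<And>j. L2 (pd j b)"
  shows "(LINT x|lborel. pd 1 a x * pd 2 b x - pd 2 a x * pd 1 b x) = 0"
proof (rule LIMSEQ_unique)
  define J where "J x = pd 1 a x * pd 2 b x - pd 2 a x * pd 1 b x" for x
  have Ji: "integrable lborel J" unfolding J_def
    by (intro Bochner_Integration.integrable_diff L2_mult_integrable a b)
  show "(\<lambda>n. LINT x|lborel. J x * cutoff n x) \<longlonglongrightarrow> (LINT x|lborel. pd 1 a x * pd 2 b x - pd 2 a x * pd 1 b x)"
    using cutoff_integral_tendsto[OF Ji] by (simp add: J_def)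
  have level: "(LINT x|lborel. J x * cutoff n x)
     = (LINT x|lborel. a x * pd 1 b x * pd 2 (cutoff n) x) - (LINT x|lborel. a x * pd 2 b x * pd 1 (cutoff n) x)" for n
  proof -
    note c = C1_cutoff[of n] csupp_cutoff[of n]
    have I: "integrable lborel (\<lambda>x. F x * cutoff n x)" if "continuous_on UNIV F" for F
      by (intro csupp_integrable continuous_intros that C1_continuous c csupp_mult)
    have I': "integrable lborel (\<lambda>x. F x * pd j (cutoff n) x)" if "continuous_on UNIV F" for F j
      by (intro csupp_integrable continuous_intros that C1_continuous_pd c csupp_mult csupp_pd)
    have e: "(LINT x|lborel. pd i a x * (pd j b x * cutoff n x))
       = - (LINT x|lborel. a x * pd j b x * pd i (cutoff n) x) - (LINT x|lborel. a x * pd i (pd j b) x * cutoff n x)" for i j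
    proof -
      have "(LINT x|lborel. a x * pd i (\<lambda>x. pd j b x * cutoff n x) x) = - (LINT x|lborel. pd i a x * (pd j b x * cutoff n x))"
        by (intro integral_by_parts a C1_mult b c csupp_mult)
      moreover have "(\<lambda>x. a x * pd i (\<lambda>x. pd j b x * cutoff n x) x) = (\<lambda>x. a x * pd j b x * pd i (cutoff n) x + a x * pd i (pd j b) x * cutoff n x)"
        by (simp only: pd_mult[OF b(2) c(1)]) (simp add: fun_eq_iff algebra_simps)
      moreover have "integrable lborel (\<lambda>x. a x * pd j b x * pd i (cutoff n) x)" "integrable lborel (\<lambda>x. a x * pd i (pd j b) x * cutoff n x)"
        by (intro I I' continuous_intros C1_continuous C1_continuous_pd a b)+
      ultimately show ?thesis by simp
    qed
    have "(LINT x|lborel. J x * cutoff n x) = (LINT x|lborel. pd 1 a x * (pd 2 b x * cutoff n x) - pd 2 a x * (pd 1 b x * cutoff n x))"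
      by (simp add: J_def algebra_simps)
    also have "\<dots> = (LINT x|lborel. pd 1 a x * (pd 2 b x * cutoff n x)) - (LINT x|lborel. pd 2 a x * (pd 1 b x * cutoff n x))"
    proof (rule Bochner_Integration.integral_diff)
      have "integrable lborel (\<lambda>x. (pd i a x * pd j b x) * cutoff n x)" for i j
        by (intro I continuous_intros C1_continuous_pd a b)
      then show "integrable lborel (\<lambda>x. pd 1 a x * (pd 2 b x * cutoff n x))" "integrable lborel (\<lambda>x. pd 2 a x * (pd 1 b x * cutoff n x))"
        by (simp_all add: mult.assoc)
    qed
    finally show ?thesis unfolding e by (simp add: mixed_partials_commute[OF b(1,2), of 1 2])
  qed
  have "(\<lambda>n. (LINT x|lborel. a x * pd 1 b x * pd 2 (cutoff n) x) - (LINT x|lborel. a x * pd 2 b x * pd 1 (cutoff n) x)) \<longlonglongrightarrow> 0 - 0"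
    by (intro tendsto_diff cutoff_pd_integral_tendsto a b)
  then show "(\<lambda>n. LINT x|lborel. J x * cutoff n x) \<longlonglongrightarrow> 0" unfolding level by simp
qed

text \<open>The sum of the squares of all first derivatives equals the sum of the squares of curl and
  divergence minus twice the Jacobian determinant.\<close>
theorem div_free_gradient_le_curl:
  assumes a: "C1 a" "L2 a" "\<And>j. L2 (pd j a)" and b: "C1 b" "\<And>j. C1 (pd j b)" "\<And>j. L2 (pd j b)"
    and d: "\<And>x. pd 1 a x + pd 2 b x = 0"
  shows "norm2 (pd j a) \<le> norm2 (\<lambda>x. pd 1 b x - pd 2 a x)" "norm2 (pd j b) \<le> norm2 (\<lambda>x. pd 1 b x - pd 2 a x)"
proof -
  let ?n = "\<lambda>h. (norm2 h)\<^sup>2"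
  have sq: "integrable lborel (\<lambda>x. (pd j a x)\<^sup>2)" "integrable lborel (\<lambda>x. (pd j b x)\<^sup>2)" for j
    using a b by (auto simp: L2_def)
  define J where "J x = pd 1 a x * pd 2 b x - pd 2 a x * pd 1 b x" for x
  have J: "integrable lborel J" unfolding J_def
    by (intro Bochner_Integration.integrable_diff L2_mult_integrable a b)
  have "?n (\<lambda>x. pd 1 b x - pd 2 a x) = (LINT x|lborel. (pd 1 a x)\<^sup>2 + (pd 2 a x)\<^sup>2 + (pd 1 b x)\<^sup>2 + (pd 2 b x)\<^sup>2
        + 2 * J x)"
    unfolding norm2_sq_integral
  proof (rule Bochner_Integration.integral_cong[OF refl])
    fix x
    have "pd 1 a x = - pd 2 b x" using d[of x] by simp
    then show "(pd 1 b x - pd 2 a x)\<^sup>2 = (pd 1 a x)\<^sup>2 + (pd 2 a x)\<^sup>2 + (pd 1 b x)\<^sup>2 + (pd 2 b x)\<^sup>2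
        + 2 * J x"
      unfolding J_def by (simp add: power2_eq_square algebra_simps)
  qed
  also have "\<dots> = ?n (pd 1 a) + ?n (pd 2 a) + ?n (pd 1 b) + ?n (pd 2 b)"
    using sq J integral_Jacobian_eq_0[OF a b, folded J_def] unfolding norm2_sq_integral by simp
  finally have eq: "?n (\<lambda>x. pd 1 b x - pd 2 a x) = ?n (pd 1 a) + ?n (pd 2 a) + ?n (pd 1 b) + ?n (pd 2 b)" .
  have j: "j = 1 \<or> j = 2" by (rule exhaust_2)
  show "norm2 (pd j a) \<le> norm2 (\<lambda>x. pd 1 b x - pd 2 a x)"
    by (rule power2_le_imp_le) (use j eq in auto)
  show "norm2 (pd j b) \<le> norm2 (\<lambda>x. pd 1 b x - pd 2 a x)"
    by (rule power2_le_imp_le) (use j eq in auto)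
qed

section \<open>Stationary damped Navier-Stokes solutions\<close>

lemma in_L2_borel_version:
  assumes "in_L2 h"
  obtains H where "L2 H" "AE x in lebesgue. h x = H x"
proof -
  obtain H where H: "H \<in> borel_measurable lborel" "AE x in lborel. h x = H x"
    using completion_ex_borel_measurable_real assms unfolding in_L2_def by blast
  have ae: "AE x in lebesgue. h x = H x" by (rule AE_completion[OF H(2)])
  have m: "(\<lambda>x. (H x)\<^sup>2) \<in> borel_measurable lborel" using H(1) by measurable
  have "integrable lebesgue (\<lambda>x. (H x)\<^sup>2)"
  proof (rule integrable_cong_AE_imp)
    show "integrable lebesgue (\<lambda>x. (h x)\<^sup>2)" using assms by (simp add: in_L2_def)
    show "(\<lambda>x. (H x)\<^sup>2) \<in> borel_measurable lebesgue" by (rule measurable_completion[OF m])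
    show "AE x in lebesgue. (h x)\<^sup>2 = (H x)\<^sup>2" using ae by eventually_elim simp
  qed
  then have "L2 H" using H(1) integrable_completion[OF m] by (simp add: L2_def)
  then show thesis using ae by (rule that)
qed

lemma integrable_lebesgue_borel:
  "f \<in> borel_measurable borel \<Longrightarrow> integrable lebesgue f \<Longrightarrow> integrable lborel (f :: 'a::euclidean_space \<Rightarrow> real)"
  using integrable_completion[of f lborel] by simp

lemma L2_of_lebesgue:
  fixes f :: "real^2 \<Rightarrow> real"
  assumes "f \<in> borel_measurable borel" "integrable lebesgue q" "\<And>x. (f x)\<^sup>2 \<le> q x"
  shows "L2 f"
  unfolding L2_def
proof
  show "f \<in> borel_measurable borel" by fact
  have m: "(\<lambda>x. (f x)\<^sup>2) \<in> borel_measurable borel" using assms(1) by measurable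
  have "integrable lebesgue (\<lambda>x. (f x)\<^sup>2)"
  proof (rule Bochner_Integration.integrable_bound[OF assms(2)])
    show "(\<lambda>x. (f x)\<^sup>2) \<in> borel_measurable lebesgue" using m by (intro measurable_completion) simp
    show "AE x in lebesgue. norm ((f x)\<^sup>2) \<le> norm (q x)"
      by (intro AE_I2) (simp add: order_trans[OF assms(3) abs_ge_self])
  qed
  then show "integrable lborel (\<lambda>x. (f x)\<^sup>2)" by (rule integrable_lebesgue_borel[OF m])
qed

lemma integral_lebesgue_borel:
  fixes f :: "'a::euclidean_space \<Rightarrow> real"
  shows "f \<in> borel_measurable borel \<Longrightarrow> (LINT x|lebesgue. f x) = (LINT x|lborel. f x)"
  by (rule integral_completion) simp

lemma lebesgue_integral_ip2:
  assumes "L2 G" "L2 w" "AE x in lebesgue. g x = G x" "integrable lebesgue (\<lambda>x. g x * w x)"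
  shows "(LINT x|lebesgue. g x * w x) = ip2 G w"
proof -
  have m: "(\<lambda>x. G x * w x) \<in> borel_measurable borel" using assms(1,2) by (auto simp: L2_def)
  have "(LINT x|lebesgue. g x * w x) = (LINT x|lebesgue. G x * w x)"
  proof (rule integral_cong_AE)
    show "(\<lambda>x. g x * w x) \<in> borel_measurable lebesgue" using assms(4) by (rule borel_measurable_integrable)
    show "(\<lambda>x. G x * w x) \<in> borel_measurable lebesgue" using m by (intro measurable_completion) simp
    show "AE x in lebesgue. g x * w x = G x * w x" using assms(3) by eventually_elim simp
  qed
  then show ?thesis by (simp add: integral_lebesgue_borel[OF m] ip2_def)
qed

text \<open>The weak derivatives that define the curl are not assumed to be those that witness membership in
  \<open>H\<^sup>1\<close>; uniqueness identifies them.\<close>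
lemma weak_curl_L2:
  assumes f: "\<And>i. in_H1 (\<lambda>x. f x $ i)" and g: "has_weak_curl f g"
  obtains G where "L2 G" "AE x in lebesgue. g x = G x"
proof -
  obtain a b where ab: "has_weak_partial 1 (\<lambda>x. f x $ 2) a" "has_weak_partial 2 (\<lambda>x. f x $ 1) b"
      "AE x in lebesgue. g x = a x - b x" using g unfolding has_weak_curl_def by blast
  obtain d1 where d1: "has_weak_partial 1 (\<lambda>x. f x $ 2) d1" "in_L2 d1" using f[of 2] unfolding in_H1_def by blast
  obtain d2 where d2: "has_weak_partial 2 (\<lambda>x. f x $ 1) d2" "in_L2 d2" using f[of 1] unfolding in_H1_def by blast
  obtain A where A: "L2 A" "AE x in lebesgue. d1 x = A x" using in_L2_borel_version[OF d1(2)] by blast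
  obtain B where B: "L2 B" "AE x in lebesgue. d2 x = B x" using in_L2_borel_version[OF d2(2)] by blast
  show thesis
  proof (rule that[of "\<lambda>x. A x - B x"])
    show "L2 (\<lambda>x. A x - B x)" by (intro L2_diff A B)
    show "AE x in lebesgue. g x = A x - B x"
      using ab(3) A(2) B(2) weak_partial_unique[OF ab(1) d1(1)] weak_partial_unique[OF ab(2) d2(1)]
      by eventually_elim simp
  qed
qed

lemma C1_partials_of_Ck2: "Ck 2 h \<Longrightarrow> C1 h \<and> (\<forall>j. C1 (pd j h))"
  unfolding numeral_2_eq_2 One_nat_def[symmetric] Ck_Suc_iff[of 1] Ck_1_iff by simp

lemma NS_regularity:
  assumes "stationary_damped_NS \<nu> \<gamma> f g u \<omega>"
  shows "C1 (\<lambda>x. u x $ i)" "C1 (pd j (\<lambda>x. u x $ i))" "L2 (\<lambda>x. u x $ i)" "L2 (pd j (\<lambda>x. u x $ i))"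
    "\<omega> = (\<lambda>x. pd 1 (\<lambda>x. u x $ 2) x - pd 2 (\<lambda>x. u x $ 1) x)" "C1 \<omega>" "L2 \<omega>" "L2 (pd j \<omega>)"
    "pd 1 (\<lambda>x. u x $ 1) x + pd 2 (\<lambda>x. u x $ 2) x = 0"
proof -
  have ck: "C1 (\<lambda>x. u x $ i)" "C1 (pd j (\<lambda>x. u x $ i))" for i j
    using assms C1_partials_of_Ck2 unfolding stationary_damped_NS_def by blast+
  then show "C1 (\<lambda>x. u x $ i)" "C1 (pd j (\<lambda>x. u x $ i))" by auto
  have eb: "integrable lebesgue (\<lambda>x. (norm (u x))\<^sup>2)" "integrable lebesgue (vgrad_sq u)"
    using assms unfolding stationary_damped_NS_def energy_balance_def by blast+
  have zb: "integrable lebesgue (\<lambda>x. (\<omega> x)\<^sup>2)" "integrable lebesgue (grad_sq \<omega>)"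
    using assms unfolding stationary_damped_NS_def enstrophy_balance_def by blast+
  show "L2 (\<lambda>x. u x $ i)"
  proof (rule L2_of_lebesgue[OF C1_measurable[OF ck(1)] eb(1)])
    fix x
    have "\<bar>u x $ i\<bar>\<^sup>2 \<le> (norm (u x))\<^sup>2" by (intro power_mono component_le_norm_cart) auto
    then show "(u x $ i)\<^sup>2 \<le> (norm (u x))\<^sup>2" by simp
  qed
  show "L2 (pd j (\<lambda>x. u x $ i))"
  proof (rule L2_of_lebesgue[OF C1_measurable_pd[OF ck(1)] eb(2)])
    fix x
    have "(pd j (\<lambda>x. u x $ i) x)\<^sup>2 \<le> grad_sq (\<lambda>y. u y $ i) x"
      unfolding grad_sq_def by (rule member_le_sum) auto
    also have "\<dots> \<le> vgrad_sq u x"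
      unfolding vgrad_sq_def by (rule member_le_sum) (auto simp: grad_sq_def intro: sum_nonneg)
    finally show "(pd j (\<lambda>x. u x $ i) x)\<^sup>2 \<le> vgrad_sq u x" .
  qed
  show w: "\<omega> = (\<lambda>x. pd 1 (\<lambda>x. u x $ 2) x - pd 2 (\<lambda>x. u x $ 1) x)"
    using assms by (auto simp: stationary_damped_NS_def curl_def)
  show C: "C1 \<omega>"
    unfolding w using C1_add[OF ck(2)[of 1 2] C1_scale[OF ck(2)[of 2 1], of "-1"]] by simp
  show "L2 \<omega>" by (rule L2_of_lebesgue[OF C1_measurable[OF C] zb(1)]) simp
  show "L2 (pd j \<omega>)"
  proof (rule L2_of_lebesgue[OF C1_measurable_pd[OF C] zb(2)])
    show "(pd j \<omega> x)\<^sup>2 \<le> grad_sq \<omega> x" for x unfolding grad_sq_def by (rule member_le_sum) auto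
  qed
  show "pd 1 (\<lambda>x. u x $ 1) x + pd 2 (\<lambda>x. u x $ 2) x = 0"
    using assms by (simp add: stationary_damped_NS_def divergence_def sum_2)
qed

lemma NS_enstrophy:
  assumes ns: "stationary_damped_NS \<nu> \<gamma> f g u \<omega>" and G: "L2 G" "AE x in lebesgue. g x = G x"
  shows "\<gamma> * ip2 \<omega> \<omega> + \<nu> * (LINT x|lebesgue. grad_sq \<omega> x) = ip2 G \<omega>"
proof -
  have eb: "integrable lebesgue (\<lambda>x. g x * \<omega> x)"
     "\<gamma> * (LINT x|lebesgue. (\<omega> x)\<^sup>2) + \<nu> * (LINT x|lebesgue. grad_sq \<omega> x) = (LINT x|lebesgue. g x * \<omega> x)"
    using ns unfolding stationary_damped_NS_def enstrophy_balance_def by blast+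
  note w = NS_regularity(7)[OF ns]
  have "(LINT x|lebesgue. (\<omega> x)\<^sup>2) = ip2 \<omega> \<omega>"
    using integral_lebesgue_borel[of "\<lambda>x. (\<omega> x)\<^sup>2"] w by (simp add: ip2_def power2_eq_square L2_def)
  then show ?thesis using eb(2) lebesgue_integral_ip2[OF G(1) w G(2) eb(1)] by simp
qed

lemma grad_sq_integral_nonneg: "0 \<le> (LINT x|lebesgue. grad_sq h x)"
  by (intro integral_nonneg_AE AE_I2) (simp add: grad_sq_def sum_nonneg)

lemma NS_vorticity_bound:
  assumes ns: "stationary_damped_NS \<nu> \<gamma> f g u \<omega>" and G: "L2 G" "AE x in lebesgue. g x = G x"
    and pos: "0 < \<gamma>" "0 < \<nu>"
  shows "norm2 \<omega> \<le> norm2 G / \<gamma>"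
proof -
  note w = NS_regularity(7)[OF ns]
  have "\<gamma> * ip2 \<omega> \<omega> \<le> ip2 G \<omega>"
    using NS_enstrophy[OF ns G] mult_nonneg_nonneg[OF less_imp_le[OF pos(2)] grad_sq_integral_nonneg[of \<omega>]] by linarith
  also have "\<dots> \<le> norm2 G * norm2 \<omega>" using Cauchy_Schwarz_L2[OF G(1) w] by simp
  finally have "(\<gamma> * norm2 \<omega>) * norm2 \<omega> \<le> norm2 G * norm2 \<omega>"
    by (simp add: norm2_sq[symmetric] power2_eq_square mult.assoc)
  then have "\<gamma> * norm2 \<omega> \<le> norm2 G" by (auto simp: mult_le_cancel_right less_le)
  then show ?thesis using pos by (simp add: field_simps)
qed

text \<open>The energy balance bounds the sum of the squared norms of the components; passing to the sum of
  the norms, by \<open>(a + b)\<^sup>2 \<le> 2 (a\<^sup>2 + b\<^sup>2)\<close>, costs the factor two.\<close>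
lemma NS_velocity_bound:
  assumes ns: "stationary_damped_NS \<nu> \<gamma> f g u \<omega>"
    and F: "\<And>i. L2 (F i)" "\<And>i. AE x in lebesgue. f x $ i = F i x" and pos: "0 < \<gamma>" "0 < \<nu>"
  shows "norm2 (\<lambda>x. u x $ i) \<le> 2 * (\<Sum>i\<in>UNIV. norm2 (F i)) / \<gamma>"
proof -
  note L = NS_regularity(3)[OF ns]
  have eb: "integrable lebesgue (\<lambda>x. f x \<bullet> u x)"
     "\<gamma> * (LINT x|lebesgue. (norm (u x))\<^sup>2) + \<nu> * (LINT x|lebesgue. vgrad_sq u x) = (LINT x|lebesgue. f x \<bullet> u x)"
    using ns unfolding stationary_damped_NS_def energy_balance_def by blast+
  have mi: "(\<lambda>x. F i x * u x $ i) \<in> borel_measurable borel" for i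
    using L2_measurable[OF F(1)] L2_measurable[OF L] by measurable
  have "(LINT x|lebesgue. f x \<bullet> u x) = (LINT x|lebesgue. (\<Sum>i\<in>UNIV. F i x * u x $ i))"
  proof (rule integral_cong_AE)
    show "(\<lambda>x. f x \<bullet> u x) \<in> borel_measurable lebesgue" using eb(1) by (rule borel_measurable_integrable)
    show "(\<lambda>x. \<Sum>i\<in>UNIV. F i x * u x $ i) \<in> borel_measurable lebesgue"
      using mi by (intro measurable_completion borel_measurable_sum) simp
    show "AE x in lebesgue. f x \<bullet> u x = (\<Sum>i\<in>UNIV. F i x * u x $ i)"
      using F(2)[of 1] F(2)[of 2] by eventually_elim (simp add: inner_vec_def sum_2)
  qed
  also have "\<dots> = (LINT x|lborel. (\<Sum>i\<in>UNIV. F i x * u x $ i))"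
    by (rule integral_lebesgue_borel) (intro borel_measurable_sum mi)
  also have "\<dots> = (\<Sum>i\<in>UNIV. ip2 (F i) (\<lambda>x. u x $ i))"
    using L2_mult_integrable[OF F(1) L] by (simp add: ip2_def)
  finally have rhs: "(LINT x|lebesgue. f x \<bullet> u x) = (\<Sum>i\<in>UNIV. ip2 (F i) (\<lambda>x. u x $ i))" .
  have "(LINT x|lebesgue. (norm (u x))\<^sup>2) = (LINT x|lborel. (\<Sum>i\<in>UNIV. (u x $ i)\<^sup>2))"
  proof -
    have "(norm (u x))\<^sup>2 = (\<Sum>i\<in>UNIV. (u x $ i)\<^sup>2)" for x
      by (simp add: norm_vec_def L2_set_def sum_nonneg)
    moreover have "(\<lambda>x. \<Sum>i\<in>UNIV. (u x $ i)\<^sup>2) \<in> borel_measurable borel"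
      using L2_measurable[OF L] by measurable
    ultimately show ?thesis by (simp add: integral_lebesgue_borel)
  qed
  also have "\<dots> = (\<Sum>i\<in>UNIV. (norm2 (\<lambda>x. u x $ i))\<^sup>2)"
    using L2_sq_integrable[OF L] by (simp add: norm2_sq_integral)
  finally have lhs: "(LINT x|lebesgue. (norm (u x))\<^sup>2) = (\<Sum>i\<in>UNIV. (norm2 (\<lambda>x. u x $ i))\<^sup>2)" .
  have "0 \<le> (LINT x|lebesgue. vgrad_sq u x)"
    by (intro integral_nonneg_AE AE_I2) (simp add: vgrad_sq_def grad_sq_def sum_nonneg)
  then have "0 \<le> \<nu> * (LINT x|lebesgue. vgrad_sq u x)" using pos by simp
  then have le: "\<gamma> * (\<Sum>i\<in>UNIV. (norm2 (\<lambda>x. u x $ i))\<^sup>2) \<le> (\<Sum>i\<in>UNIV. ip2 (F i) (\<lambda>x. u x $ i))"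
    using eb(2) unfolding lhs rhs by linarith
  define m where "m = (\<Sum>i\<in>UNIV. norm2 (\<lambda>x. u x $ i))"
  define M where "M = (\<Sum>i\<in>UNIV. norm2 (F i))"
  have m0: "0 \<le> m" "0 \<le> M" unfolding m_def M_def by (intro sum_nonneg norm2_nonneg)+
  have "m\<^sup>2 \<le> 2 * (\<Sum>i\<in>UNIV. (norm2 (\<lambda>x. u x $ i))\<^sup>2)"
    using zero_le_power2[of "norm2 (\<lambda>x. u x $ 1) - norm2 (\<lambda>x. u x $ 2)"] unfolding m_def sum_2
    by (simp add: power2_eq_square algebra_simps)
  then have "\<gamma> * m\<^sup>2 \<le> \<gamma> * (2 * (\<Sum>i\<in>UNIV. (norm2 (\<lambda>x. u x $ i))\<^sup>2))" using pos by (intro mult_left_mono) auto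
  also have "\<dots> \<le> 2 * (\<Sum>i\<in>UNIV. ip2 (F i) (\<lambda>x. u x $ i))" using le by simp
  also have "\<dots> \<le> 2 * (\<Sum>i\<in>UNIV. norm2 (F i) * m)"
  proof (intro mult_left_mono sum_mono)
    fix i :: 2
    have "ip2 (F i) (\<lambda>x. u x $ i) \<le> norm2 (F i) * norm2 (\<lambda>x. u x $ i)" using Cauchy_Schwarz_L2[OF F(1) L, of i i] by simp
    also have "\<dots> \<le> norm2 (F i) * m" unfolding m_def by (intro mult_left_mono member_le_sum) auto
    finally show "ip2 (F i) (\<lambda>x. u x $ i) \<le> norm2 (F i) * m" .
  qed simp
  also have "\<dots> = (2 * M) * m" by (simp add: M_def sum_distrib_right)
  finally have "(\<gamma> * m) * m \<le> (2 * M) * m" by (simp add: power2_eq_square mult.assoc)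
  then have "\<gamma> * m \<le> 2 * M" using m0 by (auto simp: mult_le_cancel_right less_le)
  moreover have "norm2 (\<lambda>x. u x $ i) \<le> m" unfolding m_def by (intro member_le_sum) auto
  ultimately have "\<gamma> * norm2 (\<lambda>x. u x $ i) \<le> 2 * M" using pos by (meson mult_left_mono less_imp_le order_trans)
  then show ?thesis using pos by (simp add: M_def[symmetric] field_simps)
qed

lemma trans_bound_mono: "trans_bound L h \<Longrightarrow> L \<le> M \<Longrightarrow> trans_bound M h"
  unfolding trans_bound_def by (meson mult_right_mono norm_ge_zero order_trans)

lemma NS_trans_bound:
  assumes ns: "stationary_damped_NS \<nu> \<gamma> f g u \<omega>"
  shows "trans_bound (2 * norm2 \<omega>) (\<lambda>x. u x $ i)"
proof (rule trans_bound_mono[OF trans_bound_C1])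
  note R = NS_regularity[OF ns]
  note le = div_free_gradient_le_curl[OF R(1)[where i=1] R(3)[where i=1] R(4)[where i=1]
      R(1)[where i=2] R(2)[where i=2] R(4)[where i=2] R(9), folded R(5)]
  have b: "norm2 (pd j (\<lambda>x. u x $ i)) \<le> norm2 \<omega>" for j
    using exhaust_2[of i] le by auto
  show "(\<Sum>j\<in>UNIV. norm2 (pd j (\<lambda>x. u x $ i))) \<le> 2 * norm2 \<omega>"
    unfolding sum_2 using b[of 1] b[of 2] by linarith
qed (use NS_regularity[OF ns] in auto)

lemma NS_weakly_div_free:
  assumes ns: "stationary_damped_NS \<nu> \<gamma> f g u \<omega>"
  shows "weakly_div_free (\<lambda>j x. u x $ j)"
  unfolding weakly_div_free_def
proof (intro allI impI)
  fix \<psi> :: "real^2 \<Rightarrow> real" assume p: "C1 \<psi>" "csupp \<psi>"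
  note R = NS_regularity[OF ns]
  have i: "integrable lborel (\<lambda>x. pd j (\<lambda>x. u x $ j) x * \<psi> x)" for j
    by (intro csupp_integrable continuous_intros C1_continuous_pd C1_continuous R p csupp_mult)
  have "(\<Sum>j\<in>UNIV. LINT x|lborel. u x $ j * pd j \<psi> x) = - (\<Sum>j\<in>UNIV. (LINT x|lborel. pd j (\<lambda>x. u x $ j) x * \<psi> x))"
    unfolding integral_by_parts[OF R(1) p] by (simp add: sum_negf)
  also have "(\<Sum>j\<in>UNIV. (LINT x|lborel. pd j (\<lambda>x. u x $ j) x * \<psi> x))
      = (LINT x|lborel. (\<Sum>j\<in>UNIV. pd j (\<lambda>x. u x $ j) x * \<psi> x))"
    using i by simp
  also have "\<dots> = (LINT x|lborel. (pd 1 (\<lambda>x. u x $ 1) x + pd 2 (\<lambda>x. u x $ 2) x) * \<psi> x)"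
    by (simp add: sum_2 distrib_right)
  also have "\<dots> = 0" unfolding R(9) by simp
  finally show "(\<Sum>j\<in>UNIV. LINT x|lborel. u x $ j * pd j \<psi> x) = 0" by simp
qed

lemma weakly_div_free_limit:
  assumes "\<And>n. weakly_div_free (u n)" "\<And>j. weak_L2 (\<lambda>n. u n j) (U j)"
  shows "weakly_div_free U"
  unfolding weakly_div_free_def
proof (intro allI impI)
  fix \<psi> :: "real^2 \<Rightarrow> real" assume p: "C1 \<psi>" "csupp \<psi>"
  have "L2 (pd j \<psi>)" for j by (intro csupp_L2 C1_continuous_pd csupp_pd p)
  then have "(\<lambda>n. \<Sum>j\<in>UNIV. ip2 (u n j) (pd j \<psi>)) \<longlonglongrightarrow> (\<Sum>j\<in>UNIV. ip2 (U j) (pd j \<psi>))"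
    by (intro tendsto_sum weak_L2_D[OF assms(2)])
  moreover have "(\<Sum>j\<in>UNIV. ip2 (u n j) (pd j \<psi>)) = 0" for n
    using assms(1)[of n] p by (simp add: weakly_div_free_def ip2_def)
  ultimately have "(\<Sum>j\<in>UNIV. ip2 (U j) (pd j \<psi>)) = 0" by (simp add: LIMSEQ_const_iff)
  then show "(\<Sum>j\<in>UNIV. LINT x|lborel. U j x * pd j \<psi> x) = 0" by (simp add: ip2_def)
qed

text \<open>The weak formulation tested with the kernel centred at \<open>x\<close>; the transport term is integrated
  by parts with the divergence-free velocity.\<close>
lemma NS_mollified_vorticity:
  assumes ns: "stationary_damped_NS \<nu> \<gamma> f g u \<omega>" and G: "L2 G" "AE x in lebesgue. g x = G x" and d: "0 < \<delta>"
  shows "\<gamma> * conv \<omega> (moll \<delta>) x + (\<Sum>j\<in>UNIV. conv (\<lambda>y. \<omega> y * u y $ j) (pd j (moll \<delta>)) x)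
      - \<nu> * conv \<omega> (laplacian (moll \<delta>)) x = conv G (moll \<delta>) x"
proof -
  note R = NS_regularity[OF ns]
  define \<phi> where "\<phi> y = moll \<delta> (x - y)" for y
  have eq: "\<phi> = (\<lambda>y. moll \<delta> (x + (-1) *\<^sub>R y))" by (simp add: \<phi>_def fun_eq_iff)
  have cs: "csupp \<phi>" unfolding \<phi>_def by (rule csupp_reflect[OF csupp_moll[OF d]])
  have t: "test_function \<phi>" by (rule test_functionI[OF _ cs]) (unfold eq, rule Ck_affine[OF Ck_moll])
  have c: "C1 \<phi>" unfolding \<phi>_def by (rule C1_reflect[OF C1_moll])
  have p: "pd j \<phi> = (\<lambda>y. - pd j (moll \<delta>) (x - y))" for j unfolding \<phi>_def by (rule pd_reflect[OF C1_moll])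
  have lap: "laplacian \<phi> y = laplacian (moll \<delta>) (x - y)" for y
  proof -
    have "pd j (pd j \<phi>) = (\<lambda>y. pd j (pd j (moll \<delta>)) (x - y))" for j
    proof -
      have "pd j (pd j \<phi>) = pd j (\<lambda>y. (-1) * pd j (moll \<delta>) (x - y))" by (simp add: p)
      also have "\<dots> = (\<lambda>y. (-1) * - pd j (pd j (moll \<delta>)) (x - y))"
        by (simp only: pd_scale[OF C1_reflect[OF C1_pd_moll]] pd_reflect[OF C1_pd_moll])
      finally show ?thesis by simp
    qed
    then show ?thesis by (simp add: laplacian_def)
  qed
  obtain l where l: "has_weak_laplacian \<omega> l" "AE x in lebesgue. \<gamma> * \<omega> x + advect u \<omega> x - \<nu> * l x = g x"
    using ns unfolding stationary_damped_NS_def vorticity_equation_def by blast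
  have ll: "locally_integrable l" "(LINT y|lebesgue. \<omega> y * laplacian \<phi> y) = (LINT y|lebesgue. l y * \<phi> y)"
    using l(1) t unfolding has_weak_laplacian_def by auto
  have lap_cont: "continuous_on UNIV (laplacian (moll \<delta>))"
    unfolding laplacian_def[abs_def] by (intro continuous_intros C1_continuous_pd C1_pd_moll)
  have adv_cont: "continuous_on UNIV (advect u \<omega>)"
    unfolding advect_def[abs_def] by (intro continuous_intros C1_continuous_pd C1_continuous R)
  have lm: "integrable lebesgue F" "(LINT x|lebesgue. F x) = (LINT x|lborel. F x)"
    if "continuous_on UNIV F" "csupp F" for F :: "real^2 \<Rightarrow> real"
  proof -
    have m: "F \<in> borel_measurable borel" by (rule borel_measurable_continuous_onI[OF that(1)])
    show "(LINT x|lebesgue. F x) = (LINT x|lborel. F x)" by (rule integral_lebesgue_borel[OF m])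
    show "integrable lebesgue F" using csupp_integrable[OF that] integrable_completion[of F lborel] m by simp
  qed
  have c1: "continuous_on UNIV (\<lambda>y. \<omega> y * \<phi> y)" "csupp (\<lambda>y. \<omega> y * \<phi> y)"
    by (intro continuous_intros C1_continuous R c csupp_mult cs)+
  have c2: "continuous_on UNIV (\<lambda>y. advect u \<omega> y * \<phi> y)" "csupp (\<lambda>y. advect u \<omega> y * \<phi> y)"
    by (intro continuous_intros adv_cont C1_continuous c csupp_mult cs)+
  have li: "integrable lebesgue (\<lambda>y. l y * \<phi> y)"
    by (rule loc_integrable_mult[OF ll(1) C1_continuous[OF c] cs])
  have Gm: "(\<lambda>y. G y * \<phi> y) \<in> borel_measurable borel"
    using L2_measurable[OF G(1)] C1_measurable[OF c] by measurable
  have "conv G (moll \<delta>) x = (LINT y|lebesgue. G y * \<phi> y)"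
    unfolding conv_def \<phi>_def[symmetric] by (rule integral_lebesgue_borel[OF Gm, symmetric])
  also have "\<dots> = (LINT y|lebesgue. \<gamma> * (\<omega> y * \<phi> y) + advect u \<omega> y * \<phi> y - \<nu> * (l y * \<phi> y))"
  proof (rule integral_cong_AE)
    show "(\<lambda>y. G y * \<phi> y) \<in> borel_measurable lebesgue" using Gm by (intro measurable_completion) simp
    show "(\<lambda>y. \<gamma> * (\<omega> y * \<phi> y) + advect u \<omega> y * \<phi> y - \<nu> * (l y * \<phi> y)) \<in> borel_measurable lebesgue"
      by (rule borel_measurable_integrable)
         (intro Bochner_Integration.integrable_diff Bochner_Integration.integrable_add integrable_mult_right lm c1 c2 li)
    show "AE y in lebesgue. G y * \<phi> y = \<gamma> * (\<omega> y * \<phi> y) + advect u \<omega> y * \<phi> y - \<nu> * (l y * \<phi> y)"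
      using l(2) G(2)
    proof eventually_elim
      fix y assume "\<gamma> * \<omega> y + advect u \<omega> y - \<nu> * l y = g y" "g y = G y"
      then have "G y = \<gamma> * \<omega> y + advect u \<omega> y - \<nu> * l y" by simp
      then show "G y * \<phi> y = \<gamma> * (\<omega> y * \<phi> y) + advect u \<omega> y * \<phi> y - \<nu> * (l y * \<phi> y)"
        by (simp only:) (simp add: algebra_simps)
    qed
  qed
  also have "\<dots> = \<gamma> * (LINT y|lborel. \<omega> y * \<phi> y) + (LINT y|lborel. advect u \<omega> y * \<phi> y) - \<nu> * (LINT y|lebesgue. l y * \<phi> y)"
    using lm(1)[OF c1] lm(1)[OF c2] li by (simp add: lm(2)[OF c1] lm(2)[OF c2])
  also have "(LINT y|lebesgue. l y * \<phi> y) = conv \<omega> (laplacian (moll \<delta>)) x"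
  proof -
    have "(\<lambda>y. \<omega> y * laplacian (moll \<delta>) (x - y)) \<in> borel_measurable borel"
      by (intro borel_measurable_times C1_measurable R borel_measurable_continuous_onI reflect_cont lap_cont)
    then show ?thesis unfolding ll(2)[symmetric] lap conv_def by (rule integral_lebesgue_borel)
  qed
  also have "(LINT y|lborel. advect u \<omega> y * \<phi> y) = (\<Sum>j\<in>UNIV. conv (\<lambda>y. \<omega> y * u y $ j) (pd j (moll \<delta>)) x)"
  proof -
    have uphi: "C1 (\<lambda>y. u y $ j * \<phi> y)" "csupp (\<lambda>y. u y $ j * \<phi> y)" for j
      by (intro C1_mult R c csupp_mult cs)+
    have i1: "integrable lborel (\<lambda>y. \<omega> y * (u y $ j * pd j \<phi> y))" for j
      by (intro csupp_integrable continuous_intros C1_continuous C1_continuous_pd R c csupp_mult csupp_pd cs)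
    have i2: "integrable lborel (\<lambda>y. \<omega> y * (pd j (\<lambda>y. u y $ j) y * \<phi> y))" for j
      by (intro csupp_integrable continuous_intros C1_continuous C1_continuous_pd R c csupp_mult cs)
    have i3: "integrable lborel (\<lambda>y. pd j \<omega> y * (u y $ j * \<phi> y))" for j
      by (intro csupp_integrable continuous_intros C1_continuous C1_continuous_pd R c csupp_mult cs)
    have parts: "(LINT y|lborel. pd j \<omega> y * (u y $ j * \<phi> y))
       = conv (\<lambda>y. \<omega> y * u y $ j) (pd j (moll \<delta>)) x - (LINT y|lborel. \<omega> y * (pd j (\<lambda>y. u y $ j) y * \<phi> y))" for j
    proof -
      have "(LINT y|lborel. pd j \<omega> y * (u y $ j * \<phi> y)) = - (LINT y|lborel. \<omega> y * pd j (\<lambda>y. u y $ j * \<phi> y) y)"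
        using integral_by_parts[OF R(6) uphi, of j j] by simp
      also have "(\<lambda>y. \<omega> y * pd j (\<lambda>y. u y $ j * \<phi> y) y) = (\<lambda>y. \<omega> y * (u y $ j * pd j \<phi> y) + \<omega> y * (pd j (\<lambda>y. u y $ j) y * \<phi> y))"
        by (simp only: pd_mult[OF R(1) c]) (simp add: fun_eq_iff algebra_simps)
      also have "(LINT y|lborel. \<omega> y * (u y $ j * pd j \<phi> y) + \<omega> y * (pd j (\<lambda>y. u y $ j) y * \<phi> y))
         = (LINT y|lborel. \<omega> y * (u y $ j * pd j \<phi> y)) + (LINT y|lborel. \<omega> y * (pd j (\<lambda>y. u y $ j) y * \<phi> y))"
        by (rule Bochner_Integration.integral_add[OF i1 i2])
      also have "(LINT y|lborel. \<omega> y * (u y $ j * pd j \<phi> y)) = - conv (\<lambda>y. \<omega> y * u y $ j) (pd j (moll \<delta>)) x"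
        by (simp add: conv_def p mult.assoc)
      finally show ?thesis by simp
    qed
    have "(LINT y|lborel. advect u \<omega> y * \<phi> y) = (LINT y|lborel. (\<Sum>j\<in>UNIV. pd j \<omega> y * (u y $ j * \<phi> y)))"
      by (intro Bochner_Integration.integral_cong) (auto simp: advect_def sum_2 algebra_simps)
    also have "\<dots> = (\<Sum>j\<in>UNIV. (LINT y|lborel. pd j \<omega> y * (u y $ j * \<phi> y)))"
      using i3 by simp
    also have "\<dots> = (\<Sum>j\<in>UNIV. conv (\<lambda>y. \<omega> y * u y $ j) (pd j (moll \<delta>)) x)
        - (\<Sum>j\<in>UNIV. (LINT y|lborel. \<omega> y * (pd j (\<lambda>y. u y $ j) y * \<phi> y)))"
      unfolding parts by (rule sum_subtractf)
    also have "(\<Sum>j\<in>UNIV. (LINT y|lborel. \<omega> y * (pd j (\<lambda>y. u y $ j) y * \<phi> y)))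
       = (LINT y|lborel. (\<Sum>j\<in>UNIV. \<omega> y * (pd j (\<lambda>y. u y $ j) y * \<phi> y)))"
      using i2 by simp
    also have "\<dots> = (LINT y|lborel. \<omega> y * ((pd 1 (\<lambda>y. u y $ 1) y + pd 2 (\<lambda>y. u y $ 2) y) * \<phi> y))"
      by (intro Bochner_Integration.integral_cong) (auto simp: sum_2 algebra_simps)
    also have "\<dots> = 0" unfolding R(9) by simp
    finally show ?thesis by simp
  qed
  finally show ?thesis by (simp add: conv_def \<phi>_def)
qed

text \<open>Three successive extractions give weak limits of both velocity components and of the vorticity.
  In the mollified vorticity equation the viscous term is bounded by \<open>\<nu>\<close> times a constant that
  depends only on the scale and the data, so the limit satisfies the inviscid equation and hence the inviscid
  enstrophy balance. The dissipation is squeezed between zero and a quantity that converges to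
  the defect in that balance.\<close>
lemma NS_subsequence:
  assumes pos: "0 < \<gamma>" "\<And>n. 0 < \<nu> n" and nu: "\<nu> \<longlonglongrightarrow> 0"
    and f: "\<And>i. in_H1 (\<lambda>x. f x $ i)" and g: "has_weak_curl f g"
    and ns: "\<And>n. stationary_damped_NS (\<nu> n) \<gamma> f g (u n) (\<omega> n)"
  obtains r :: "nat \<Rightarrow> nat" where "strict_mono r" "(\<lambda>n. \<nu> (r n) * (LINT x|lebesgue. grad_sq (\<omega> (r n)) x)) \<longlonglongrightarrow> 0"
proof -
  obtain G where G: "L2 G" "AE x in lebesgue. g x = G x" using weak_curl_L2[OF f g] by blast
  have "\<exists>F. L2 F \<and> (AE x in lebesgue. f x $ i = F x)" for i
    using f[of i] in_L2_borel_version[of "\<lambda>x. f x $ i"] unfolding in_H1_def by blast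
  then obtain F where F: "\<And>i. L2 (F i)" "\<And>i. AE x in lebesgue. f x $ i = F i x" by metis
  note R = NS_regularity[OF ns]
  define B where "B = norm2 G / \<gamma>"
  have B: "norm2 (\<omega> n) \<le> B" for n unfolding B_def by (rule NS_vorticity_bound[OF ns G pos])
  have B0: "0 \<le> B" using B[of 0] norm2_nonneg order_trans by blast
  define A where "A = 2 * (\<Sum>i\<in>UNIV. norm2 (F i)) / \<gamma>"
  have A: "norm2 (\<lambda>x. u n x $ i) \<le> A" for n i unfolding A_def by (rule NS_velocity_bound[OF ns F pos])
  have tb: "trans_bound (2 * B) (\<lambda>x. u n x $ i)" for n i
    by (rule trans_bound_mono[OF NS_trans_bound[OF ns]]) (use B in simp)
  obtain r1 :: "nat \<Rightarrow> nat" and U1 where 1: "strict_mono r1" "L2 U1" "weak_L2 ((\<lambda>n x. u n x $ 1) \<circ> r1) U1"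
    by (rule weak_compactness_L2[of "\<lambda>n x. u n x $ 1" A, OF R(3) A])
  obtain r2 :: "nat \<Rightarrow> nat" and U2 where 2: "strict_mono r2" "L2 U2" "weak_L2 ((\<lambda>n x. u (r1 n) x $ 2) \<circ> r2) U2"
    by (rule weak_compactness_L2[of "\<lambda>n x. u (r1 n) x $ 2" A, OF R(3) A])
  obtain r3 :: "nat \<Rightarrow> nat" and W where 3: "strict_mono r3" "L2 W" "weak_L2 ((\<lambda>n. \<omega> (r1 (r2 n))) \<circ> r3) W"
     "\<forall>e>0. \<exists>s\<in>lin_span (\<lambda>n. \<omega> (r1 (r2 n))). norm2 (\<lambda>x. W x - s x) \<le> e"
    by (rule weak_compactness_L2[of "\<lambda>n. \<omega> (r1 (r2 n))" B, OF R(7) B])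
  define r where "r n = r1 (r2 (r3 n))" for n
  have r: "strict_mono r" using 1(1) 2(1) 3(1) by (simp add: r_def strict_mono_def)
  define U where "U j = (if j = 1 then U1 else U2)" for j :: 2
  have UL: "L2 (U j)" for j by (simp add: U_def 1 2)
  have wU: "weak_L2 (\<lambda>n x. u (r n) x $ j) (U j)" for j
  proof (cases "j = 1")
    case True
    have "weak_L2 (((\<lambda>n x. u n x $ 1) \<circ> r1) \<circ> (\<lambda>n. r2 (r3 n))) U1"
      using 2(1) 3(1) by (intro weak_L2_subseq 1) (simp add: strict_mono_def)
    then show ?thesis by (simp add: True U_def r_def o_def)
  next
    case False
    then have j: "j = 2" using exhaust_2[of j] by auto
    have "weak_L2 (((\<lambda>n x. u (r1 n) x $ 2) \<circ> r2) \<circ> r3) U2" by (intro weak_L2_subseq 2 3)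
    then show ?thesis by (simp add: j U_def r_def o_def)
  qed
  have wW: "weak_L2 (\<lambda>n. \<omega> (r n)) W" using 3(3) by (simp add: r_def o_def)
  have WA: "C1_approximable W"
    unfolding C1_approximable_def
  proof (intro allI impI)
    fix e :: real assume "0 < e"
    then obtain s where s: "s \<in> lin_span (\<lambda>n. \<omega> (r1 (r2 n)))" "norm2 (\<lambda>x. W x - s x) \<le> e" using 3(4) by auto
    have "C1 s \<and> L2 s \<and> (\<forall>j. L2 (pd j s))" using s(1)
    proof induction
      case zero
      show ?case by (simp add: C1_const pd_const)
    next
      case (step s c n)
      then show ?case
        by (simp add: R(6,7,8) C1_add C1_scale pd_add pd_scale L2_add L2_scale)
    qed
    with s(2) show "\<exists>v. C1 v \<and> L2 v \<and> (\<forall>j. L2 (pd j v)) \<and> norm2 (\<lambda>x. W x - v x) \<le> e" by blast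
  qed
  have tU: "trans_bound (2 * B) (U j)" for j
    by (rule trans_bound_weak_limit[OF wU R(3) UL tb])
  have dU: "weakly_div_free U"
    by (rule weakly_div_free_limit[of "\<lambda>n j x. u (r n) x $ j", OF NS_weakly_div_free[OF ns] wU])
  have nur: "(\<lambda>n. \<nu> (r n)) \<longlonglongrightarrow> 0" using LIMSEQ_subseq_LIMSEQ[OF nu r] by (simp add: o_def)
  have E: "\<gamma> * conv W (moll \<delta>) x + (\<Sum>j\<in>UNIV. conv (\<lambda>y. W y * U j y) (pd j (moll \<delta>)) x) = conv G (moll \<delta>) x"
    if d: "0 < \<delta>" for \<delta> x
  proof (rule LIMSEQ_unique)
    note kk = C1_continuous_pd[OF C1_moll[of \<delta>]] csupp_pd[OF csupp_moll[OF d]]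
    have t1: "(\<lambda>n. conv (\<omega> (r n)) (moll \<delta>) x) \<longlonglongrightarrow> conv W (moll \<delta>) x"
      unfolding conv_ip2 by (intro weak_L2_D[OF wW] L2_reflect moll_L2 d)
    have t2: "(\<lambda>n. conv (\<lambda>y. \<omega> (r n) y * u (r n) y $ j) (pd j (moll \<delta>)) x) \<longlonglongrightarrow> conv (\<lambda>y. W y * U j y) (pd j (moll \<delta>)) x" for j
      unfolding conv_def
    proof (rule weak_strong_product[OF wW R(7) B R(3) UL])
      show c: "continuous_on UNIV (\<lambda>y. pd j (moll \<delta>) (x - y))" "csupp (\<lambda>y. pd j (moll \<delta>) (x - y))"
        by (intro reflect_cont csupp_reflect kk)+
      show "(\<lambda>n. norm2 (\<lambda>y. (u (r n) y $ j - U j y) * pd j (moll \<delta>) (x - y))) \<longlonglongrightarrow> 0"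
        by (rule Rellich_local[OF wU R(3) UL A tb _ c]) (use B0 in simp)
    qed
    have lapL: "L2 (laplacian (moll \<delta>))"
      unfolding laplacian_def[abs_def] by (intro L2_sum csupp_L2 C1_continuous_pd C1_pd_moll csupp_pd csupp_moll d)
    have t3: "(\<lambda>n. \<nu> (r n) * conv (\<omega> (r n)) (laplacian (moll \<delta>)) x) \<longlonglongrightarrow> 0"
    proof -
      have le: "norm (\<nu> (r n) * conv (\<omega> (r n)) (laplacian (moll \<delta>)) x) \<le> \<nu> (r n) * (B * norm2 (laplacian (moll \<delta>)))" for n
      proof -
        have "\<bar>conv (\<omega> (r n)) (laplacian (moll \<delta>)) x\<bar> \<le> B * norm2 (laplacian (moll \<delta>))"
          by (rule order_trans[OF conv_bound[OF R(7) lapL]]) (intro mult_right_mono B norm2_nonneg)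
        then show ?thesis using pos(2)[of "r n"] by (simp add: abs_mult)
      qed
      have "(\<lambda>n. \<nu> (r n) * (B * norm2 (laplacian (moll \<delta>)))) \<longlonglongrightarrow> 0"
        using tendsto_mult[OF nur tendsto_const] by simp
      then show ?thesis by (rule Lim_null_comparison[OF always_eventually[OF allI[OF le]]])
    qed
    have "(\<lambda>n. \<gamma> * conv (\<omega> (r n)) (moll \<delta>) x + (\<Sum>j\<in>UNIV. conv (\<lambda>y. \<omega> (r n) y * u (r n) y $ j) (pd j (moll \<delta>)) x)
        - \<nu> (r n) * conv (\<omega> (r n)) (laplacian (moll \<delta>)) x)
      \<longlonglongrightarrow> \<gamma> * conv W (moll \<delta>) x + (\<Sum>j\<in>UNIV. conv (\<lambda>y. W y * U j y) (pd j (moll \<delta>)) x) - 0"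
      by (intro tendsto_intros t1 t2 t3)
    then show "(\<lambda>n. conv G (moll \<delta>) x) \<longlonglongrightarrow> \<gamma> * conv W (moll \<delta>) x + (\<Sum>j\<in>UNIV. conv (\<lambda>y. W y * U j y) (pd j (moll \<delta>)) x)"
      unfolding NS_mollified_vorticity[OF ns G d] by simp
  qed simp
  have id: "\<gamma> * ip2 W W = ip2 G W"
    by (rule limit_enstrophy[OF 3(2) WA UL tU _ dU G(1) E]) (use B0 in auto)
  show thesis
  proof (rule that[OF r])
    let ?D = "\<lambda>n. \<nu> (r n) * (LINT x|lebesgue. grad_sq (\<omega> (r n)) x)"
    \<comment> \<open>Expanding the square of the distance to the limit bounds the enstrophy from below by a weakly continuous expression.\<close>
    let ?Q = "\<lambda>n. ip2 (\<omega> (r n)) G - \<gamma> * (2 * ip2 (\<omega> (r n)) W - ip2 W W)"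
    have Dnn: "0 \<le> ?D n" for n
      using pos(2)[of "r n"] grad_sq_integral_nonneg[of "\<omega> (r n)"] by simp
    have DQ: "?D n \<le> ?Q n" for n
    proof -
      have "0 \<le> ip2 (\<lambda>x. \<omega> (r n) x - W x) (\<lambda>x. \<omega> (r n) x - W x)" by (rule ip2_self_nonneg)
      also have "\<dots> = ip2 (\<omega> (r n)) (\<omega> (r n)) - 2 * ip2 (\<omega> (r n)) W + ip2 W W"
        using R(7)[of "r n"] 3(2) ip2_commute[of W "\<omega> (r n)"] by (simp add: ip2_diff ip2_diff_right L2_diff)
      finally have "\<gamma> * (2 * ip2 (\<omega> (r n)) W - ip2 W W) \<le> \<gamma> * ip2 (\<omega> (r n)) (\<omega> (r n))"
        using pos(1) by (intro mult_left_mono) auto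
      then show ?thesis using NS_enstrophy[OF ns G, of "r n"] ip2_commute[of G "\<omega> (r n)"] by linarith
    qed
    have "?Q \<longlonglongrightarrow> ip2 W G - \<gamma> * (2 * ip2 W W - ip2 W W)"
      by (intro tendsto_intros weak_L2_D[OF wW] G 3)
    moreover have "ip2 W G - \<gamma> * (2 * ip2 W W - ip2 W W) = 0" using id ip2_commute[of G W] by simp
    ultimately have Q: "?Q \<longlonglongrightarrow> 0" by simp
    show "?D \<longlonglongrightarrow> 0"
      by (rule tendsto_sandwich[OF _ _ tendsto_const Q]) (use Dnn DQ in auto)
  qed
qed

text \<open>Otherwise the dissipation stays away from zero along a subsequence, which contradicts
  \<open>NS_subsequence\<close> applied to that subsequence.\<close>
theorem theorem3p2:
  fixes \<gamma> :: real
    and f :: "real^2 \<Rightarrow> real^2" and g :: "real^2 \<Rightarrow> real"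
    and \<nu> :: "nat \<Rightarrow> real"
    and u :: "nat \<Rightarrow> real^2 \<Rightarrow> real^2" and \<omega> :: "nat \<Rightarrow> real^2 \<Rightarrow> real"
  assumes "\<gamma> > 0"
    and "\<And>i. in_W1inf (\<lambda>x. f x $ i)"
    and "\<And>i. in_H1 (\<lambda>x. f x $ i)"
    and "has_bochner_integral lebesgue f 0"
    and "has_weak_curl f g"
    and "\<And>n. \<nu> n > 0"
    and "\<nu> \<longlonglongrightarrow> 0"
    and "\<And>n. stationary_damped_NS (\<nu> n) \<gamma> f g (u n) (\<omega> n)"
  shows "(\<lambda>n. \<nu> n * (LINT x|lebesgue. grad_sq (\<omega> n) x)) \<longlonglongrightarrow> 0"
proof (rule ccontr)
  let ?D = "\<lambda>n. \<nu> n * (LINT x|lebesgue. grad_sq (\<omega> n) x)"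
  assume "\<not> ?D \<longlonglongrightarrow> 0"
  then obtain e where e: "0 < e" "\<And>N. \<exists>n\<ge>N. e \<le> \<bar>?D n\<bar>"
    unfolding LIMSEQ_iff by (auto simp: not_less)
  then have inf: "infinite {n. e \<le> \<bar>?D n\<bar>}" unfolding infinite_nat_iff_unbounded_le by blast
  define s where "s = enumerate {n. e \<le> \<bar>?D n\<bar>}"
  have s: "strict_mono s" unfolding s_def by (rule strict_mono_enumerate[OF inf])
  have se: "e \<le> \<bar>?D (s n)\<bar>" for n using enumerate_in_set[OF inf, of n] by (simp add: s_def)
  have "(\<lambda>n. \<nu> (s n)) \<longlonglongrightarrow> 0" using LIMSEQ_subseq_LIMSEQ[OF assms(7) s] by (simp add: o_def)
  then obtain r :: "nat \<Rightarrow> nat" where r: "strict_mono r" "(\<lambda>n. ?D (s (r n))) \<longlonglongrightarrow> 0"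
    using NS_subsequence[of \<gamma> "\<lambda>n. \<nu> (s n)" f g "\<lambda>n. u (s n)" "\<lambda>n. \<omega> (s n)"] assms(1,3,5,6,8) by blast
  then obtain n where "\<bar>?D (s (r n))\<bar> < e" using LIMSEQ_D[OF r(2) e(1)] by auto
  then show False using se[of "r n"] by linarith
qed

end
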